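(* Let $\tilde\Gamma$ be a path on the fixed-point bundle $E$ of ${\rm VI}(F,\Delta)$ with finitely many segments, ending at $(\sigma^\star,\mathbf 0)$ and satisfying $\tilde\Gamma\cap S\subseteq\{(\sigma^\star,\mathbf 0)\}$. Let $\zeta\ge 0$, with $\zeta\neq 0$ if $J(\sigma^\star)$ is singular, let $d>0$ be such that $\mathcal N_{\tilde\Gamma}(\zeta)\cap S=\varnothing$, and assume $F\in C^2(p_\Delta(\mathcal N_{\tilde\Gamma}(\zeta)))$. Consider the predictor-corrector path-following algorithm along $\tilde\Gamma$ described in the context. Then: (1) $\tilde G(\sigma,\mu)$ achieves uniform quadratic convergence to $0$ under corrector subiterations, i.e. there is a constant $C_1>0$, the same for all $\mu$ occurring, with $\|\tilde G(\sigma_{k+1},\mu)\|\le C_1\|\tilde G(\sigma_k,\mu)\|^2$ for corrector steps from points $(\sigma_k,\mu)\in\mathcal N_{\tilde\Gamma}(\zeta)$, and the corrector converges from its convergence region; (2) there exists $\eta\in(0,1)$, independent of the iteration index $t$, such that after each predictor step with step size $\eta$ the new point remains in the convergence region of the corrector; (3) $\mathbf 1^\top\mu$ achieves linear reduction to $\zeta$ under the overall iteration. Consequently the algorithm achieves global linear convergence along $\tilde\Gamma$ to the ending point where $\mathbf 1^\top\mu=\zeta$. In particular, if $J(\sigma^\star)$ is nonsingular one may take $\zeta=0$ and the algorithm converges globally linearly to $(\sigma^\star,\mathbf 0)$; if $J(\sigma^\star)$ is singular, the algorithm retains global linear reduction up to any prescribed precision $\zeta>0$.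
   Context: Notation. $\Delta=\{\sigma\in\mathbb R^n:\sigma\ge 0,\ \mathbf 1^\top\sigma=1\}$, with $\mathbf 1$ the all-ones vector. Vector inequalities, $\circ$ (product), $/$ (quotient) and $\ln$ are componentwise; for a matrix $A$ and vector $b$, $A\circ b=A\,{\rm diag}(b)$ and $b\circ A={\rm diag}(b)A$. $\|\cdot\|$ is the Euclidean (spectral) norm. ${\rm softmax}(\theta)=\exp(\theta)/(\mathbf 1^\top\exp(\theta))$. $F:\Delta\to\mathbb R^n$ is continuously differentiable (as a map with a $C^1$ extension to a neighborhood of $\Delta$), and no monotonicity is assumed. A solution of ${\rm VI}(F,\Delta)$ is $\sigma^\star\in\Delta$ with $\langle F(\sigma^\star),\sigma'-\sigma^\star\rangle\ge 0$ for all $\sigma'\in\Delta$. Bundle. $G(\sigma,\mu)=(I-\sigma\mathbf 1^\top)(\sigma\circ F(\sigma)-\mu)$ for $(\sigma,\mu)\in\Delta\times\mathbb R^n$; $E=\{(\sigma,\mu)\in\Delta\times\mathbb R^n:G(\sigma,\mu)=0\}=\{(\sigma,\sigma\circ F(\sigma)+v\sigma):\sigma\in\Delta,\ v\in\mathbb R\}$; $\tilde G(\sigma,\mu)=G(\sigma,\mu)/\sigma$ for $\sigma>0$; $\tilde\mu(\sigma)=(I-\sigma\mathbf 1^\top)(\sigma\circ F(\sigma))$. $$J(\sigma)=(I-\mathbf 1\sigma^\top)\left(\frac{\partial F(\sigma)}{\partial\sigma}\circ\sigma+\left((I-\mathbf 1\sigma^\top)F(\sigma)\right)\circ I\right)(I-\mathbf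 1\sigma^\top)+k\mathbf 1\sigma^\top,$$ where $k\neq0$ is a fixed scalar such that $k+\mathbf 1^\top\mu\ne0$ for all $(\sigma,\mu)\in\mathcal N_{\tilde\Gamma}(\zeta)$. The subspace $\ker(\sigma^\top)$ is $J(\sigma)$-invariant; let $\lambda_j^\perp(J(\sigma))$ be the real eigenvalues of $J(\sigma)$ other than the eigenvalue $k$ belonging to the eigenvector $\mathbf 1$, i.e. the real eigenvalues of $J(\sigma)|_{\ker(\sigma^\top)}$. The singular manifold is $S=\{(\sigma,\tilde\mu(\sigma)-\lambda_j^\perp(J(\sigma))\sigma):\lambda_j^\perp(J(\sigma))\in\mathbb R,\ \sigma\in\Delta\}$. Path. Given $\sigma_{\rm init}\in\Delta$ with positive entries and sufficiently large $v_{\rm init}$, a path is a set $$\tilde\Gamma=\bigcup_{i=1}^q\{(\sigma,\gamma\mu_i)\in E:\ \mu_i=\gamma_{i-1}\mu_{i-1}+\beta_i\sigma_{i-1},\ \gamma\in[\gamma_i,1]\},$$ with $\gamma_0\mu_0=v_{\rm init}\sigma_{\rm init}$, $(\sigma_0,\gamma_0\mu_0)\in E$, $\beta_i\in\mathbb R$, $\mu_i>0$ and $\gamma_q\mathbf 1^\top\mu_q=0$. Here the $i$-th segment is a curve: $\sigma$ is a continuous function of $\gamma\in[\gamma_i,1]$ that equals $\sigma_{i-1}$ at $\gamma=1$ and $\sigma_i$ at $\gamma=\gamma_i$; thus consecutive segments are concatenated in $\sigma$ and jump along the fiber (by $\beta_i\sigma_{i-1}$) in $\mu$. The end point is $(\sigma^\star,\mathbf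 0)$, where $\sigma^\star=\sigma_q$ is a solution of ${\rm VI}(F,\Delta)$. Neighborhood. $\mathcal N_{\tilde\Gamma}(\zeta)$ is the closure of $\{({\rm softmax}(\theta),\mu):\|\theta-\ln\sigma_\mu\|\le d,\ (\sigma_\mu,\mu)\in\tilde\Gamma,\ \mathbf 1^\top\mu>\zeta\}$, and $p_\Delta(\mathcal N_{\tilde\Gamma}(\zeta))$ is its projection to the $\sigma$-space. $F\in C^m(X)$ means that $F$ has continuous derivatives up to order $m$ on $X$. Algorithm. A corrector step at fixed $\mu$ is $\theta_{k+1}=\theta_k+\overline{d\theta}_k$, $\sigma_k={\rm softmax}(\theta_k)$, where $(J(\sigma_k)+(\mathbf 1^\top\mu)I)\overline{d\theta}_k=-(I-\mathbf 1\sigma_k^\top)(F(\sigma_k)-\mu/\sigma_k)$. The convergence region of the corrector at $\mu$ is the set of $\sigma$ with $(\sigma,\mu)\in\mathcal N_{\tilde\Gamma}(\zeta)$ from which the corrector iteration drives $\tilde G(\cdot,\mu)$ quadratically to $0$. A predictor step with step size $\eta\in(0,1)$ is $\mu_{t+1}=(1-\eta)\mu_t$, $\theta_{t+1}=\theta_t+\overline{d\theta}_t$, where $\sigma_t={\rm softmax}(\theta_t)$ and $(J(\sigma_t)+(\mathbf 1^\top\mu_t)I)\overline{d\theta}_t=(I-\mathbf 1\sigma_t^\top)(d\mu_t/\sigma_t)$ with $d\mu_t=-\eta\mu_t$. The algorithm starts at the start of $\tilde\Gamma$ and alternates a sufficiently converged corrector subiteration with one predictor step along each segment; between segments $\mu$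 is changed along the fiber as prescribed by $\tilde\Gamma$ (this happens finitely many times and leaves $G$ unchanged, as $G(\sigma,\mu+\beta\sigma)=G(\sigma,\mu)$).
   Formalization: In (1) the bound holds at points of N with nonsingular system if the residual is small, the next iterate stays in N, or all systems on N are nonsingular; γ_i ≥ 0, with γ_i > 0 before the last segment; the run halts before a fibre move that would drop 1ᵀμ to ζ or below. *)

theory Defs
  imports "HOL-Analysis.Analysis"
begin

section \<open>Vectors, matrices, smoothness\<close>

definition vsum :: "real^'n \<Rightarrow> real" where
  "vsum x = (\<Sum>i\<in>UNIV. x $ i)"

definition hprod :: "real^'n \<Rightarrow> real^'n \<Rightarrow> real^'n" where
  "hprod a b = (\<chi> i. a $ i * b $ i)"

definition hquot :: "real^'n \<Rightarrow> real^'n \<Rightarrow> real^'n" where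
  "hquot a b = (\<chi> i. a $ i / b $ i)"

definition hln :: "real^'n \<Rightarrow> real^'n" where
  "hln a = (\<chi> i. ln (a $ i))"

definition softmax :: "real^'n \<Rightarrow> real^'n" where
  "softmax \<theta> = (\<chi> i. exp (\<theta> $ i) / (\<Sum>j\<in>UNIV. exp (\<theta> $ j)))"

definition std_simplex :: "(real^'n) set" where
  "std_simplex = {\<sigma>. (\<forall>i. 0 \<le> \<sigma> $ i) \<and> vsum \<sigma> = 1}"

definition diagm :: "real^'n \<Rightarrow> real^'n^'n" where
  "diagm b = (\<chi> i j. if i = j then b $ i else 0)"

text \<open>The matrix $\mathbf 1 \sigma^\top$, and the two projections
  $I - \sigma \mathbf 1^\top$ and $I - \mathbf 1 \sigma^\top$.\<close>

definition one_out :: "real^'n \<Rightarrow> real^'n^'n" where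
  "one_out \<sigma> = (\<chi> i j. \<sigma> $ j)"

definition projL :: "real^'n \<Rightarrow> real^'n^'n" where
  "projL \<sigma> = mat 1 - transpose (one_out \<sigma>)"

definition projR :: "real^'n \<Rightarrow> real^'n^'n" where
  "projR \<sigma> = mat 1 - one_out \<sigma>"

definition C1_on_open :: "'a::real_normed_vector set \<Rightarrow> ('a \<Rightarrow> 'b::real_normed_vector) \<Rightarrow> bool" where
  "C1_on_open U f \<longleftrightarrow> open U \<and>
     (\<exists>f' :: 'a \<Rightarrow> 'a \<Rightarrow>\<^sub>L 'b. (\<forall>x\<in>U. (f has_derivative blinfun_apply (f' x)) (at x)) \<and>
        continuous_on U f')"

definition C2_on_open :: "'a::real_normed_vector set \<Rightarrow> ('a \<Rightarrow> 'b::real_normed_vector) \<Rightarrow> bool" where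
  "C2_on_open U f \<longleftrightarrow> open U \<and>
     (\<exists>f' :: 'a \<Rightarrow> 'a \<Rightarrow>\<^sub>L 'b. (\<forall>x\<in>U. (f has_derivative blinfun_apply (f' x)) (at x)) \<and>
        C1_on_open U f')"

text \<open>On a set without interior, such as a subset of the simplex, $C^m$ means $C^m$ on an open
  neighbourhood; the map \<open>F\<close> below stands for its own extension.\<close>

definition C1_near :: "'a::real_normed_vector set \<Rightarrow> ('a \<Rightarrow> 'b::real_normed_vector) \<Rightarrow> bool" where
  "C1_near X f \<longleftrightarrow> (\<exists>U. X \<subseteq> U \<and> C1_on_open U f)"

definition C2_near :: "'a::real_normed_vector set \<Rightarrow> ('a \<Rightarrow> 'b::real_normed_vector) \<Rightarrow> bool" where
  "C2_near X f \<longleftrightarrow> (\<exists>U. X \<subseteq> U \<and> C2_on_open U f)"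

definition vi_solution :: "(real^'n \<Rightarrow> real^'n) \<Rightarrow> real^'n \<Rightarrow> bool" where
  "vi_solution F \<sigma> \<longleftrightarrow> \<sigma> \<in> std_simplex \<and> (\<forall>\<sigma>'\<in>std_simplex. 0 \<le> F \<sigma> \<bullet> (\<sigma>' - \<sigma>))"

section \<open>The fixed-point bundle and its singular manifold\<close>

definition G :: "(real^'n \<Rightarrow> real^'n) \<Rightarrow> real^'n \<Rightarrow> real^'n \<Rightarrow> real^'n" where
  "G F \<sigma> \<mu> = projL \<sigma> *v (hprod \<sigma> (F \<sigma>) - \<mu>)"

definition fp_bundle :: "(real^'n \<Rightarrow> real^'n) \<Rightarrow> ((real^'n) \<times> (real^'n)) set" where
  "fp_bundle F = {(\<sigma>, \<mu>). \<sigma> \<in> std_simplex \<and> G F \<sigma> \<mu> = 0}"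

text \<open>Meaningful for entrywise positive \<open>\<sigma>\<close> only; it is used at values of \<open>softmax\<close>.\<close>

definition Gt :: "(real^'n \<Rightarrow> real^'n) \<Rightarrow> real^'n \<Rightarrow> real^'n \<Rightarrow> real^'n" where
  "Gt F \<sigma> \<mu> = hquot (G F \<sigma> \<mu>) \<sigma>"

definition mut :: "(real^'n \<Rightarrow> real^'n) \<Rightarrow> real^'n \<Rightarrow> real^'n" where
  "mut F \<sigma> = projL \<sigma> *v hprod \<sigma> (F \<sigma>)"

definition J :: "(real^'n \<Rightarrow> real^'n) \<Rightarrow> real \<Rightarrow> real^'n \<Rightarrow> real^'n^'n" where
  "J F k \<sigma> = projR \<sigma> ** (jacobian F (at \<sigma>) ** diagm \<sigma> + diagm (projR \<sigma> *v F \<sigma>)) ** projR \<sigma>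
     + k *\<^sub>R one_out \<sigma>"

text \<open>Real eigenvalues of the restriction of \<open>J\<close> to the invariant subspace $\ker(\sigma^\top)$.\<close>

definition perp_eigs :: "(real^'n \<Rightarrow> real^'n) \<Rightarrow> real \<Rightarrow> real^'n \<Rightarrow> real set" where
  "perp_eigs F k \<sigma> = {l. \<exists>y. y \<noteq> 0 \<and> \<sigma> \<bullet> y = 0 \<and> J F k \<sigma> *v y = l *\<^sub>R y}"

definition singular_manifold :: "(real^'n \<Rightarrow> real^'n) \<Rightarrow> real \<Rightarrow> ((real^'n) \<times> (real^'n)) set" where
  "singular_manifold F k = {(\<sigma>, mut F \<sigma> - l *\<^sub>R \<sigma>) |\<sigma> l. \<sigma> \<in> std_simplex \<and> l \<in> perp_eigs F k \<sigma>}"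

section \<open>Paths and their neighbourhoods\<close>

text \<open>Segment \<open>i\<close>, for \<open>1 \<le> i \<le> seg_num\<close>, is the curve
  \<open>g \<mapsto> (seg_curve i g, g * seg_mu i)\<close>, run through from \<open>g = 1\<close> down to \<open>g = seg_gam i\<close>.
  Index \<open>0\<close> carries the initial data.\<close>

record 'n fp_path =
  seg_num :: nat
  seg_sig :: "nat \<Rightarrow> real^'n"
  seg_mu :: "nat \<Rightarrow> real^'n"
  seg_gam :: "nat \<Rightarrow> real"
  seg_bet :: "nat \<Rightarrow> real"
  seg_curve :: "nat \<Rightarrow> real \<Rightarrow> real^'n"

text \<open>The last segment is the first one to reach \<open>\<mu> = 0\<close>: \<open>seg_gam i > 0\<close> before it. Positivity is
  all that is kept of the requirement that the starting level be sufficiently large, which serves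
  the existence of a path.\<close>

definition is_path ::
  "(real^'n \<Rightarrow> real^'n) \<Rightarrow> real^'n \<Rightarrow> real \<Rightarrow> 'n fp_path \<Rightarrow> bool" where
  "is_path F \<sigma>init vinit P \<longleftrightarrow>
     \<sigma>init \<in> std_simplex \<and> (\<forall>j. 0 < \<sigma>init $ j) \<and> 0 < vinit \<and>
     1 \<le> seg_num P \<and>
     seg_gam P 0 *\<^sub>R seg_mu P 0 = vinit *\<^sub>R \<sigma>init \<and>
     (seg_sig P 0, seg_gam P 0 *\<^sub>R seg_mu P 0) \<in> fp_bundle F \<and>
     (\<forall>i\<in>{1..seg_num P}.
        seg_mu P i = seg_gam P (i - 1) *\<^sub>R seg_mu P (i - 1) + seg_bet P i *\<^sub>R seg_sig P (i - 1) \<and>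
        (\<forall>j. 0 < seg_mu P i $ j) \<and>
        0 \<le> seg_gam P i \<and> seg_gam P i \<le> 1 \<and> (i < seg_num P \<longrightarrow> 0 < seg_gam P i) \<and>
        continuous_on {seg_gam P i..1} (seg_curve P i) \<and>
        seg_curve P i 1 = seg_sig P (i - 1) \<and>
        seg_curve P i (seg_gam P i) = seg_sig P i \<and>
        (\<forall>g\<in>{seg_gam P i..1}. (seg_curve P i g, g *\<^sub>R seg_mu P i) \<in> fp_bundle F)) \<and>
     seg_gam P (seg_num P) * vsum (seg_mu P (seg_num P)) = 0 \<and>
     vi_solution F (seg_sig P (seg_num P))"

definition path_point :: "('n::finite) fp_path \<Rightarrow> nat \<times> real \<Rightarrow> (real^'n) \<times> (real^'n)" where
  "path_point P = (\<lambda>(i, g). (seg_curve P i g, g *\<^sub>R seg_mu P i))"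

definition path_set :: "('n::finite) fp_path \<Rightarrow> ((real^'n) \<times> (real^'n)) set" where
  "path_set P = (\<Union>i\<in>{1..seg_num P}. \<Union>g\<in>{seg_gam P i..1}. {path_point P (i, g)})"

definition path_nbhd :: "('n::finite) fp_path \<Rightarrow> real \<Rightarrow> real \<Rightarrow> ((real^'n) \<times> (real^'n)) set" where
  "path_nbhd P d \<zeta> = closure {(softmax \<theta>, \<mu>) |\<theta> \<sigma>\<mu> \<mu>.
     norm (\<theta> - hln \<sigma>\<mu>) \<le> d \<and> (\<sigma>\<mu>, \<mu>) \<in> path_set P \<and> vsum \<mu> > \<zeta>}"

section \<open>Corrector and predictor\<close>

definition newton_mat ::
  "(real^'n \<Rightarrow> real^'n) \<Rightarrow> real \<Rightarrow> real^'n \<Rightarrow> real^'n \<Rightarrow> real^'n^'n" where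
  "newton_mat F k \<mu> \<sigma> = J F k \<sigma> + vsum \<mu> *\<^sub>R mat 1"

text \<open>The steps solve the linear systems with matrix \<open>newton_mat\<close>. They are meaningful only
  where that matrix is invertible, which is required or asserted wherever they are used.
  On the bundle, and for $k + \mathbf 1^\top\mu \neq 0$, it is singular exactly on the singular
  manifold; away from the bundle that manifold does not control it.\<close>

definition corrector ::
  "(real^'n \<Rightarrow> real^'n) \<Rightarrow> real \<Rightarrow> real^'n \<Rightarrow> real^'n \<Rightarrow> real^'n" where
  "corrector F k \<mu> \<theta> = (let \<sigma> = softmax \<theta> in
     \<theta> + matrix_inv (newton_mat F k \<mu> \<sigma>) *v (- (projR \<sigma> *v (F \<sigma> - hquot \<mu> \<sigma>))))"

definition predictor ::
  "(real^'n \<Rightarrow> real^'n) \<Rightarrow> real \<Rightarrow> real \<Rightarrow> real^'n \<Rightarrow> real^'n \<Rightarrow> real^'n" where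
  "predictor F k \<eta> \<mu> \<theta> = (let \<sigma> = softmax \<theta>; d\<mu> = - \<eta> *\<^sub>R \<mu> in
     \<theta> + matrix_inv (newton_mat F k \<mu> \<sigma>) *v (projR \<sigma> *v hquot d\<mu> \<sigma>))"

definition conv_region ::
  "(real^'n \<Rightarrow> real^'n) \<Rightarrow> real \<Rightarrow> ((real^'n) \<times> (real^'n)) set \<Rightarrow> real^'n \<Rightarrow> (real^'n) set" where
  "conv_region F k N \<mu> = {\<sigma>. \<exists>\<theta>. \<sigma> = softmax \<theta> \<and>
     (let s = (\<lambda>j. softmax ((corrector F k \<mu> ^^ j) \<theta>)) in
       (\<forall>j. (s j, \<mu>) \<in> N \<and> invertible (newton_mat F k \<mu> (s j))) \<and>
       (\<exists>C. \<forall>j. norm (Gt F (s (Suc j)) \<mu>) \<le> C * (norm (Gt F (s j) \<mu>))\<^sup>2) \<and>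
       (\<lambda>j. Gt F (s j) \<mu>) \<longlonglongrightarrow> 0)}"

definition corrects_to ::
  "(real^'n \<Rightarrow> real^'n) \<Rightarrow> real \<Rightarrow> real^'n \<Rightarrow> real \<Rightarrow> real^'n \<Rightarrow> real^'n \<Rightarrow> bool" where
  "corrects_to F k \<mu> \<epsilon> \<theta> \<theta>' \<longleftrightarrow> (\<exists>m.
     (\<forall>j<m. invertible (newton_mat F k \<mu> (softmax ((corrector F k \<mu> ^^ j) \<theta>)))) \<and>
     \<theta>' = (corrector F k \<mu> ^^ m) \<theta> \<and>
     norm (Gt F (softmax \<theta>') \<mu>) \<le> \<epsilon>)"

section \<open>The predictor-corrector algorithm\<close>

text \<open>A position \<open>(i, g)\<close> is a point of the path, at which \<open>\<mu> = g * seg_mu i\<close>. The algorithm halts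
  when the level $\mathbf 1^\top\mu$ has come down to \<open>\<zeta>\<close>, or when it is at the end of a segment and
  the move along the fibre to the next one would by itself bring the level down to \<open>\<zeta>\<close>.
  A predictor step that would overshoot the end of the segment or the level \<open>\<zeta>\<close> is shortened so as
  to hit it.\<close>

definition pc_halted :: "('n::finite) fp_path \<Rightarrow> real \<Rightarrow> nat \<times> real \<Rightarrow> bool" where
  "pc_halted P \<zeta> = (\<lambda>(i, g). vsum (g *\<^sub>R seg_mu P i) \<le> \<zeta> \<or>
     (g \<le> seg_gam P i \<and> \<not> (i < seg_num P \<and> \<zeta> < vsum (seg_mu P (i + 1)))))"

definition pc_predicts :: "('n::finite) fp_path \<Rightarrow> real \<Rightarrow> nat \<times> real \<Rightarrow> bool" where
  "pc_predicts P \<zeta> x \<longleftrightarrow> \<not> pc_halted P \<zeta> x \<and> seg_gam P (fst x) < snd x"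

definition pc_next :: "('n::finite) fp_path \<Rightarrow> real \<Rightarrow> real \<Rightarrow> nat \<times> real \<Rightarrow> nat \<times> real" where
  "pc_next P \<zeta> \<eta> = (\<lambda>(i, g).
     if pc_halted P \<zeta> (i, g) then (i, g)
     else if pc_predicts P \<zeta> (i, g)
       then (i, Max {(1 - \<eta>) * g, seg_gam P i, \<zeta> / vsum (seg_mu P i)})
     else (i + 1, 1))"

definition pc_pos :: "('n::finite) fp_path \<Rightarrow> real \<Rightarrow> real \<Rightarrow> nat \<Rightarrow> nat \<times> real" where
  "pc_pos P \<zeta> \<eta> t = (pc_next P \<zeta> \<eta> ^^ t) (1, 1)"

definition pc_mu :: "('n::finite) fp_path \<Rightarrow> real \<Rightarrow> real \<Rightarrow> nat \<Rightarrow> real^'n" where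
  "pc_mu P \<zeta> \<eta> t = snd (path_point P (pc_pos P \<zeta> \<eta> t))"

text \<open>The first \<open>T\<close> steps of a run. Step \<open>t\<close> enters with \<open>\<theta>in t\<close>, corrects at fixed \<open>\<mu>\<close> until the
  residual is at most \<open>tol t\<close>, with result \<open>\<theta> t\<close>, and then makes a predictor step or a move
  along the fibre; the latter does not change \<open>\<theta>\<close>. A halted run only corrects further.\<close>

definition pc_run ::
  "(real^'n \<Rightarrow> real^'n) \<Rightarrow> real \<Rightarrow> 'n fp_path \<Rightarrow> real \<Rightarrow> real \<Rightarrow> (nat \<Rightarrow> real) \<Rightarrow> nat \<Rightarrow>
   (nat \<Rightarrow> real^'n) \<Rightarrow> (nat \<Rightarrow> real^'n) \<Rightarrow> bool" where
  "pc_run F k P \<zeta> \<eta> tol T \<theta>in \<theta> \<longleftrightarrow>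
     softmax (\<theta>in 0) = seg_sig P 0 \<and>
     (\<forall>t<T. corrects_to F k (pc_mu P \<zeta> \<eta> t) (tol t) (\<theta>in t) (\<theta> t) \<and>
        \<theta>in (Suc t) =
          (if pc_predicts P \<zeta> (pc_pos P \<zeta> \<eta> t)
           then predictor F k
                  (1 - snd (pc_pos P \<zeta> \<eta> (Suc t)) / snd (pc_pos P \<zeta> \<eta> t))
                  (pc_mu P \<zeta> \<eta> t) (\<theta> t)
           else \<theta> t))"

end

theory Submission
  imports Defs
begin

text \<open>
  In the coordinates \<open>\<theta>\<close> the residual \<open>Gt\<close> equals $(I - \mathbf 1\sigma^\top)(F(\sigma) - \mu/\sigma)$, and on
  $\ker\sigma^\top$ the Newton matrix is its derivative up to a term of the size of \<open>Gt\<close>. On the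
  neighbourhood \<open>N\<close> the quotients \<open>\<mu>/\<sigma>\<close> stay bounded even where \<open>\<sigma>\<close> and \<open>\<mu>\<close> approach the boundary
  together, so the second-order Taylor estimate in \<open>\<theta>\<close> is uniform. The inverse of the Newton matrix is
  uniformly bounded where the residual is small, by compactness of \<open>N\<close>: at a point of \<open>N\<close> with zero
  residual, singularity would mean lying on the singular manifold. Hence the corrector is uniformly
  quadratic, and around each path point there is a ball of uniform radius, in the deviation
  \<open>dev \<sigma> \<theta>\<close> of \<open>\<theta>\<close> from $\ln\sigma$ modulo constants, which the corrector contracts.

  A relative change \<open>\<eta>\<close> of \<open>\<mu>\<close> changes the residual by \<open>O(\<eta>)\<close>, so both the predictor and the path
  itself move by \<open>O(\<eta>)\<close> in this deviation, and a fixed \<open>\<eta>\<close> keeps the iteration in the ball. Each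
  full predictor step reduces the level by \<open>1 - \<eta>\<close>, and only finitely many steps are not full. For
  \<open>\<zeta> = 0\<close> the path reaches \<open>\<sigma>star\<close> at a linear rate in the path parameter, since the derivative of
  $G(\cdot,0)$ is injective on tangent vectors of the simplex when \<open>J F k \<sigma>star\<close> is invertible.
\<close>

text \<open>Regularity is known on the bundle only, so the Newton matrix may degenerate inside
  \<open>N\<close> where the residual is large. Inverse bounds are therefore tied to a small
  residual, and a step from a large residual needs a separate bound on the next residual. A path is
  merely continuous, without a rate in \<open>g\<close>, and its levels may go down to 0. The
  closeness of consecutive path points thus cannot be read off from the curve; it comes from
  comparing residual and deviation at a fixed level. Uniformity towards the boundary of the simplex
  rests on relative estimates: adding a small \<open>x\<close> to \<theta> multiplies each entry of
  \<open>softmax\<close> by a factor close to 1, however small that entry is. The term with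
  \<open>k\<close> makes \<sigma> a left eigenvector of the Newton matrix for k + 1^T\<mu>. This
  keeps corrector steps in ker \<sigma>^T, where the normalising sum of \<open>softmax\<close> has
  no first-order change.\<close>

definition pr :: "real^'n \<Rightarrow> real^'n \<Rightarrow> real^'n" where
  "pr \<sigma> w = w - (\<sigma> \<bullet> w) *\<^sub>R 1"

definition pos :: "real^'n \<Rightarrow> bool" where
  "pos \<sigma> \<longleftrightarrow> (\<forall>i. 0 < \<sigma> $ i) \<and> vsum \<sigma> = 1"

text \<open>For \<sigma> of total mass 1 this is the representative of \<theta> - ln \<sigma> modulo
  constants that lies in ker \<sigma>^T, so that the \<open>softmax\<close> expansion applies to it
  directly.\<close>

definition dev :: "real^'n \<Rightarrow> real^'n \<Rightarrow> real^'n" where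
  "dev \<sigma> \<theta> = pr \<sigma> (\<theta> - hln \<sigma>)"

section \<open>Algebra and norms of the projections\<close>

lemma vsum_inner: "vsum \<sigma> = \<sigma> \<bullet> 1"
  by (simp add: vsum_def inner_vec_def)

lemma vsum_scaleR: "vsum (c *\<^sub>R a) = c * vsum a"
  by (simp add: vsum_inner)

lemma one_out_mult: "one_out \<sigma> *v w = (\<sigma> \<bullet> w) *\<^sub>R 1"
  by (vector one_out_def matrix_vector_mult_def inner_vec_def)

lemma projR_mult: "projR \<sigma> *v w = pr \<sigma> w"
  by (simp add: projR_def pr_def matrix_vector_mult_diff_rdistrib one_out_mult)

lemma projL_mult: "projL \<sigma> *v w = w - vsum w *\<^sub>R \<sigma>"
proof -
  have "transpose (one_out \<sigma>) *v w = vsum w *\<^sub>R \<sigma>"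
    by (simp add: vec_eq_iff one_out_def transpose_def matrix_vector_mult_def vsum_def sum_distrib_left mult.commute)
  then show ?thesis
    by (simp add: projL_def matrix_vector_mult_diff_rdistrib)
qed

lemma diagm_mult: "diagm b *v w = hprod b w"
proof -
  have "(\<Sum>j\<in>UNIV. (if i = j then b $ i else 0) * w $ j) = (\<Sum>j\<in>UNIV. if i = j then b $ i * w $ j else 0)" for i
    by (rule sum.cong) auto
  then show ?thesis
    by (simp add: vec_eq_iff diagm_def hprod_def matrix_vector_mult_def)
qed

lemma pr_one: "vsum \<sigma> = 1 \<Longrightarrow> pr \<sigma> 1 = 0"
  by (simp add: pr_def vsum_inner)

lemma inner_pr: "vsum \<sigma> = 1 \<Longrightarrow> \<sigma> \<bullet> pr \<sigma> w = 0"
  by (simp add: pr_def vsum_inner inner_diff_right)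

lemma pr_id: "\<sigma> \<bullet> w = 0 \<Longrightarrow> pr \<sigma> w = w"
  by (simp add: pr_def)

lemma pr_add: "pr \<sigma> (a + b) = pr \<sigma> a + pr \<sigma> b"
  by (simp add: pr_def inner_add_right algebra_simps)

lemma pr_diff: "pr \<sigma> (a - b) = pr \<sigma> a - pr \<sigma> b"
  by (simp add: pr_def inner_diff_right algebra_simps)

lemma pr_scaleR: "pr \<sigma> (c *\<^sub>R a) = c *\<^sub>R pr \<sigma> a"
  by (simp add: pr_def algebra_simps)

lemma pr_shift: "vsum \<sigma> = 1 \<Longrightarrow> pr \<sigma> (a + c *\<^sub>R 1) = pr \<sigma> a"
  by (simp add: pr_add pr_scaleR pr_one)

lemma pos_simplex: "pos \<sigma> \<Longrightarrow> \<sigma> \<in> std_simplex"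
  by (auto simp: pos_def std_simplex_def less_imp_le)

lemma simplex_vsum: "\<sigma> \<in> std_simplex \<Longrightarrow> vsum \<sigma> = 1"
  by (simp add: std_simplex_def)

lemma simplex_norm: "\<sigma> \<in> std_simplex \<Longrightarrow> norm \<sigma> \<le> 1"
  using norm_le_l1_cart[of \<sigma>] by (auto simp: std_simplex_def vsum_def)

lemma norm_pr_le:
  fixes w :: "real^'n"
  assumes "\<sigma> \<in> std_simplex"
  shows "norm (pr \<sigma> w) \<le> (1 + norm (1 :: real^'n)) * norm w"
proof -
  have "norm (pr \<sigma> w) \<le> norm w + \<bar>\<sigma> \<bullet> w\<bar> * norm (1 :: real^'n)"
    unfolding pr_def by (rule order_trans[OF norm_triangle_ineq4]) simp
  also have "\<bar>\<sigma> \<bullet> w\<bar> \<le> 1 * norm w"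
    by (rule order_trans[OF Cauchy_Schwarz_ineq2]) (intro mult_right_mono simplex_norm assms, simp)
  finally show ?thesis
    by (simp add: algebra_simps mult_right_mono)
qed

lemma norm_hprod_le: "norm (hprod a b) \<le> norm a * norm b" for a b :: "real^'n"
proof -
  have "norm (hprod a b) \<le> norm (norm a *\<^sub>R b)"
    by (rule norm_le_componentwise_cart)
      (auto simp: hprod_def abs_mult intro!: mult_right_mono component_le_norm_cart)
  then show ?thesis by simp
qed

lemma compact_simplex: "compact (std_simplex :: (real^'n) set)"
proof -
  have "closed (std_simplex :: (real^'n) set)"
    unfolding std_simplex_def vsum_inner
    by (intro closed_Collect_conj closed_Collect_all closed_Collect_le closed_Collect_eq continuous_intros)
  moreover have "bounded (std_simplex :: (real^'n) set)"
    unfolding bounded_iff using simplex_norm by blast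
  ultimately show ?thesis by (simp add: compact_eq_bounded_closed)
qed

section \<open>Softmax and deviations\<close>

lemma softmax_pos: "pos (softmax \<theta>)" for \<theta> :: "real^'n"
proof -
  have "0 < (\<Sum>j\<in>UNIV. exp (\<theta> $ j))" by (simp add: sum_pos)
  then show ?thesis
    by (simp add: pos_def softmax_def vsum_def flip: sum_divide_distrib)
qed

lemma softmax_hln: "pos \<sigma> \<Longrightarrow> softmax (hln \<sigma>) = \<sigma>"
  by (simp add: vec_eq_iff pos_def softmax_def hln_def vsum_def)

lemma softmax_shift: "softmax (\<theta> + c *\<^sub>R 1) = softmax \<theta>"
  by (simp add: vec_eq_iff softmax_def exp_add flip: sum_distrib_right)

text \<open>The constant is the log-sum-exp of \<theta>: \<open>softmax\<close> determines its
  argument up to a multiple of the all-ones vector.\<close>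

lemma hln_softmax: "\<exists>c. \<theta> = hln (softmax \<theta>) + c *\<^sub>R 1"
proof -
  have S: "0 < (\<Sum>j\<in>UNIV. exp (\<theta> $ j))" by (simp add: sum_pos)
  show ?thesis
    by (rule exI[of _ "ln (\<Sum>j\<in>UNIV. exp (\<theta> $ j))"])
      (use S in \<open>simp add: vec_eq_iff hln_def softmax_def ln_div\<close>)
qed

text \<open>Adding \<open>x\<close> reweights the old entries by \<open>exp (x $ i)\<close> and
  renormalises. Estimates derived from this are relative to \<sigma> and do not deteriorate where
  entries of \<sigma> are small.\<close>

lemma softmax_add:
  "softmax (\<theta> + x) $ i = softmax \<theta> $ i * exp (x $ i) / (\<Sum>j\<in>UNIV. softmax \<theta> $ j * exp (x $ j))"
proof -
  have S: "0 < (\<Sum>j\<in>UNIV. exp (\<theta> $ j))" by (simp add: sum_pos)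
  have "(\<Sum>j\<in>UNIV. softmax \<theta> $ j * exp (x $ j)) = (\<Sum>j\<in>UNIV. exp (\<theta> $ j + x $ j)) / (\<Sum>j\<in>UNIV. exp (\<theta> $ j))"
    by (simp add: softmax_def exp_add sum_divide_distrib)
  then show ?thesis using S by (simp add: softmax_def exp_add)
qed

lemma dev_decomp: "\<exists>c. \<theta> = hln \<sigma> + dev \<sigma> \<theta> + c *\<^sub>R 1"
  by (rule exI[of _ "\<sigma> \<bullet> (\<theta> - hln \<sigma>)"]) (simp add: dev_def pr_def)

lemma softmax_dev: "softmax \<theta> = softmax (hln \<sigma> + dev \<sigma> \<theta>)"
  by (metis dev_decomp softmax_shift)

lemma inner_dev: "vsum \<sigma> = 1 \<Longrightarrow> \<sigma> \<bullet> dev \<sigma> \<theta> = 0"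
  by (simp add: dev_def inner_pr)

text \<open>The factor 2 counts one \<open>exp (- norm x)\<close> from the weight itself and one
  from the normalising sum, which is at most \<open>exp (norm x)\<close>.\<close>

lemma softmax_ratio_ge: "softmax \<theta> $ i * exp (- 2 * norm x) \<le> softmax (\<theta> + x) $ i"
proof -
  have p: "pos (softmax \<theta>)" by (rule softmax_pos)
  let ?E = "\<Sum>j\<in>UNIV. softmax \<theta> $ j * exp (x $ j)"
  have xi: "\<bar>x $ j\<bar> \<le> norm x" for j by (rule component_le_norm_cart)
  have "?E \<le> (\<Sum>j\<in>UNIV. softmax \<theta> $ j * exp (norm x))"
    using p xi by (intro sum_mono mult_left_mono) (auto simp: pos_def less_imp_le abs_le_iff)
  also have "\<dots> = exp (norm x)" using p by (simp add: pos_def vsum_def flip: sum_distrib_right)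
  finally have E: "?E \<le> exp (norm x)" .
  have E0: "0 < ?E" using p by (intro sum_pos) (auto simp: pos_def)
  have "softmax \<theta> $ i * exp (- 2 * norm x) = softmax \<theta> $ i * (exp (- norm x) / exp (norm x))"
    by (simp flip: exp_diff)
  also have "\<dots> \<le> softmax \<theta> $ i * (exp (x $ i) / ?E)"
    using p E E0 xi[of i] by (intro mult_left_mono frac_le) (auto simp: pos_def less_imp_le)
  finally show ?thesis by (simp add: softmax_add)
qed

text \<open>Change of base point: \<theta> and ln \<tau> are both written relative to \<sigma>, and
  \<open>pr \<tau>\<close> kills the constants left over. It transfers the deviation from one path
  point to the next.\<close>

lemma hln_eq_dev:
  assumes "vsum \<tau> = 1"
  shows "dev \<tau> \<theta> = pr \<tau> (dev \<sigma> \<theta> - dev \<sigma> (hln \<tau>))"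
proof -
  obtain c where c: "\<theta> = hln \<sigma> + dev \<sigma> \<theta> + c *\<^sub>R 1" using dev_decomp by blast
  obtain e where e: "hln \<tau> = hln \<sigma> + dev \<sigma> (hln \<tau>) + e *\<^sub>R 1" using dev_decomp by blast
  have "\<theta> - hln \<tau> = (dev \<sigma> \<theta> - dev \<sigma> (hln \<tau>)) + (c - e) *\<^sub>R 1"
    by (subst c, subst e) (simp add: algebra_simps)
  then show ?thesis using pr_shift[OF assms] by (simp add: dev_def[of \<tau> \<theta>])
qed

section \<open>The residual and the Newton matrix\<close>

lemma G_eq: "G F \<sigma> \<mu> = hprod \<sigma> (F \<sigma>) - \<mu> - (\<sigma> \<bullet> F \<sigma> - vsum \<mu>) *\<^sub>R \<sigma>"
proof -
  have "vsum (hprod \<sigma> (F \<sigma>) - \<mu>) = \<sigma> \<bullet> F \<sigma> - vsum \<mu>"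
    by (simp add: vsum_def hprod_def inner_vec_def sum_subtractf)
  then show ?thesis by (simp add: G_def projL_mult)
qed

text \<open>Puts a bundle point into the form occurring in \<open>singular_manifold\<close>, with -
  1^T\<mu> in the place of the eigenvalue.\<close>

lemma G_mut: "G F \<sigma> \<mu> = 0 \<Longrightarrow> \<sigma> \<in> std_simplex \<Longrightarrow> mut F \<sigma> - (- vsum \<mu>) *\<^sub>R \<sigma> = \<mu>"
proof -
  assume a: "G F \<sigma> \<mu> = 0"
  have "vsum (hprod \<sigma> (F \<sigma>)) = \<sigma> \<bullet> F \<sigma>"
    by (simp add: vsum_def hprod_def inner_vec_def)
  then show ?thesis using a by (simp add: mut_def projL_mult G_eq algebra_simps)
qed

lemma pos_nth_neq: "pos \<sigma> \<Longrightarrow> \<sigma> $ i \<noteq> 0"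
  by (simp add: pos_def less_imp_neq[symmetric])

lemma inner_hquot: "pos \<sigma> \<Longrightarrow> \<sigma> \<bullet> hquot \<mu> \<sigma> = vsum \<mu>"
  by (simp add: pos_nth_neq inner_vec_def hquot_def vsum_def)

lemma Gt_eq: "pos \<sigma> \<Longrightarrow> Gt F \<sigma> \<mu> = F \<sigma> - hquot \<mu> \<sigma> - (\<sigma> \<bullet> F \<sigma> - vsum \<mu>) *\<^sub>R 1"
  by (simp add: pos_nth_neq vec_eq_iff Gt_def G_eq hquot_def hprod_def diff_divide_distrib)

lemma Gt_pr: "pos \<sigma> \<Longrightarrow> Gt F \<sigma> \<mu> = pr \<sigma> (F \<sigma> - hquot \<mu> \<sigma>)"
  by (simp add: Gt_eq pr_def inner_diff_right inner_hquot)

lemma G_hprod_Gt: "pos \<sigma> \<Longrightarrow> G F \<sigma> \<mu> = hprod \<sigma> (Gt F \<sigma> \<mu>)"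
  by (simp add: pos_nth_neq vec_eq_iff Gt_def hquot_def hprod_def)

text \<open>\<open>G\<close> is continuous up to the boundary of the simplex while \<open>Gt\<close>
  divides by \<sigma>; compactness arguments are run for \<open>G\<close> and reach
  \<open>Gt\<close> through this bound.\<close>

lemma norm_G_le_Gt:
  assumes "pos \<sigma>"
  shows "norm (G F \<sigma> \<mu>) \<le> norm (Gt F \<sigma> \<mu>)"
proof -
  have "norm (G F \<sigma> \<mu>) \<le> norm \<sigma> * norm (Gt F \<sigma> \<mu>)"
    using assms by (simp add: G_hprod_Gt norm_hprod_le)
  also have "\<dots> \<le> 1 * norm (Gt F \<sigma> \<mu>)"
    using assms by (intro mult_right_mono simplex_norm pos_simplex) auto
  finally show ?thesis by simp
qed

lemma inner_Gt: "pos \<sigma> \<Longrightarrow> \<sigma> \<bullet> Gt F \<sigma> \<mu> = 0"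
  by (simp add: Gt_pr inner_pr pos_def)

lemma J_mult:
  "J F k \<sigma> *v y = pr \<sigma> (jacobian F (at \<sigma>) *v hprod \<sigma> (pr \<sigma> y) + hprod (pr \<sigma> (F \<sigma>)) (pr \<sigma> y))
     + (k * (\<sigma> \<bullet> y)) *\<^sub>R 1"
  by (simp add: J_def matrix_vector_mult_add_rdistrib scaleR_matrix_vector_assoc[symmetric]
      one_out_mult projR_mult diagm_mult flip: matrix_vector_mul_assoc)

lemma newton_mult:
  "newton_mat F k \<mu> \<sigma> *v y
    = pr \<sigma> (jacobian F (at \<sigma>) *v hprod \<sigma> (pr \<sigma> y) + hprod (pr \<sigma> (F \<sigma>)) (pr \<sigma> y))
     + (k * (\<sigma> \<bullet> y)) *\<^sub>R 1 + vsum \<mu> *\<^sub>R y"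
  by (simp add: newton_mat_def matrix_vector_mult_add_rdistrib scaleR_matrix_vector_assoc[symmetric] J_mult)

text \<open>\<sigma> is a left eigenvector of the Newton matrix: the projections annihilate
  everything except the contributions of \<open>k\<close> and of the level.\<close>

lemma inner_newton:
  "vsum \<sigma> = 1 \<Longrightarrow> \<sigma> \<bullet> (newton_mat F k \<mu> \<sigma> *v y) = (k + vsum \<mu>) * (\<sigma> \<bullet> y)"
  by (simp add: newton_mult inner_add_right inner_pr vsum_inner algebra_simps)

text \<open>On $\ker\sigma^\top$ the Newton matrix is the derivative of the residual in \<open>\<theta>\<close> up to the
  term \<open>hprod (Gt F \<sigma> \<mu>) y\<close>, which is what makes the corrector quadratic.\<close>

lemma newton_split:
  assumes "pos \<sigma>" "\<sigma> \<bullet> y = 0"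
  shows "newton_mat F k \<mu> \<sigma> *v y - hprod (Gt F \<sigma> \<mu>) y
    = pr \<sigma> (jacobian F (at \<sigma>) *v hprod \<sigma> y) + hprod (hquot \<mu> \<sigma>) y - (F \<sigma> \<bullet> hprod \<sigma> y) *\<^sub>R 1"
proof -
  have 1: "\<sigma> \<bullet> hprod (pr \<sigma> (F \<sigma>)) y = F \<sigma> \<bullet> hprod \<sigma> y - (\<sigma> \<bullet> F \<sigma>) * (\<sigma> \<bullet> y)"
  proof -
    have "\<sigma> \<bullet> hprod (w - c *\<^sub>R 1) y = w \<bullet> hprod \<sigma> y - c * (\<sigma> \<bullet> y)" for w and c :: real
      by (simp add: inner_vec_def hprod_def sum_distrib_left sum_subtractf algebra_simps)
    then show ?thesis by (simp add: pr_def)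
  qed
  \<comment> \<open>By \<open>Gt_eq\<close>, subtracting the residual from
    \<open>pr \<sigma> (F \<sigma>)\<close> shifted by 1^T\<mu> leaves exactly
    \<mu>/\<sigma>.\<close>
  have 2: "hprod (pr \<sigma> (F \<sigma>)) y + vsum \<mu> *\<^sub>R y - hprod (Gt F \<sigma> \<mu>) y = hprod (hquot \<mu> \<sigma>) y"
    using assms by (simp add: vec_eq_iff hprod_def pr_def Gt_eq algebra_simps)
  show ?thesis
    using 2 by (simp add: newton_mult pr_id assms pr_add pr_def[of _ "hprod (pr \<sigma> (F \<sigma>)) y"] 1 algebra_simps)
qed

section \<open>Second-order estimates\<close>

lemma compact_inside_open:
  fixes K :: "'a::heine_borel set"
  assumes "compact K" "open U" "K \<subseteq> U"
  shows "\<exists>\<rho>>0. \<forall>a\<in>K. cball a \<rho> \<subseteq> U"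
proof -
  obtain e where e: "e > 0" "\<And>x y. x \<in> K \<Longrightarrow> y \<in> - U \<Longrightarrow> e \<le> dist x y"
  proof -
    have "K \<inter> - U = {}" using assms(3) by blast
    then show thesis
      using separate_compact_closed[of K "- U"] assms that by (auto simp: closed_def)
  qed
  have "cball a (e/2) \<subseteq> U" if "a \<in> K" for a
    using e(2)[OF that] e(1) by (force simp: not_le[symmetric])
  with e(1) show ?thesis by (intro exI[of _ "e/2"]) auto
qed

text \<open>The second derivative is bounded by \<open>B\<close> on the compact thickening
  \<open>K'\<close> of \<open>K\<close>. Hence the first derivative is \<open>B\<close>-Lipschitz on
  each ball, and linearising over the ball of radius \<open>norm y\<close> costs
  \<open>B * norm y\<close> per unit length.\<close>

lemma C2_taylor:
  fixes F :: "real^'n \<Rightarrow> real^'n"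
  assumes "C2_near K F" and K: "compact K"
  shows "\<exists>\<rho>>0. \<exists>C\<ge>0. \<forall>a\<in>K. \<forall>y. norm y \<le> \<rho> \<longrightarrow>
    norm (F (a + y) - F a - jacobian F (at a) *v y) \<le> C * (norm y)\<^sup>2"
proof -
  obtain U f' where U: "K \<subseteq> U" "open U"
    and f': "\<And>x. x \<in> U \<Longrightarrow> (F has_derivative blinfun_apply (f' x)) (at x)"
    and "C1_on_open U f'"
    using assms by (auto simp: C2_near_def C2_on_open_def)
  then obtain f'' where f'': "\<And>x. x \<in> U \<Longrightarrow> (f' has_derivative blinfun_apply (f'' x)) (at x)"
    and f''c: "continuous_on U f''"
    by (auto simp: C1_on_open_def)
  obtain \<rho> where \<rho>: "\<rho> > 0" "\<And>a. a \<in> K \<Longrightarrow> cball a \<rho> \<subseteq> U"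
    using compact_inside_open[OF K U(2,1)] by blast
  define K' where "K' = {x + y | x y. x \<in> K \<and> y \<in> cball 0 \<rho>}"
  have K'U: "K' \<subseteq> U" using \<rho>(2) by (fastforce simp: K'_def dist_norm)
  have "compact K'" unfolding K'_def by (intro compact_sums K compact_cball)
  then have "bounded (f'' ` K')"
    by (intro compact_imp_bounded compact_continuous_image continuous_on_subset[OF f''c K'U])
  then obtain B where B: "B > 0" "\<And>z. z \<in> K' \<Longrightarrow> norm (f'' z) \<le> B"
    by (auto simp: bounded_pos)
  have cb: "z \<in> K'" if "a \<in> K" "z \<in> cball a \<rho>" for a z
    using that unfolding K'_def by (intro CollectI exI[of _ a] exI[of _ "z - a"]) (auto simp: dist_norm norm_minus_commute)
  have "norm (F (a + y) - F a - jacobian F (at a) *v y) \<le> B * (norm y)\<^sup>2"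
    if a: "a \<in> K" and y: "norm y \<le> \<rho>" for a y
  proof -
    have sub: "cball a (norm y) \<subseteq> cball a \<rho>" using y by (simp add: subset_cball)
    have lip: "norm (f' z - f' a) \<le> B * norm y" if z: "z \<in> cball a (norm y)" for z
    proof -
      have "norm (f' z - f' a) \<le> B * norm (z - a)"
      proof (rule differentiable_bound[of "cball a \<rho>" f' "\<lambda>x. blinfun_apply (f'' x)"])
        fix w assume w: "w \<in> cball a \<rho>"
        then have "w \<in> U" using \<rho>(2)[OF a] by blast
        then show "(f' has_derivative blinfun_apply (f'' w)) (at w within cball a \<rho>)"
          by (rule has_derivative_at_withinI[OF f''])
        show "onorm (blinfun_apply (f'' w)) \<le> B"
          using B(2)[OF cb[OF a w]] by (simp add: norm_blinfun.rep_eq)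
      next
        show "z \<in> cball a \<rho>" using z sub by blast
      qed (use \<rho>(1) in auto)
      also have "\<dots> \<le> B * norm y"
        using z B(1) by (intro mult_left_mono) (auto simp: dist_norm norm_minus_commute)
      finally show ?thesis .
    qed
    have der: "(F has_derivative blinfun_apply (f' z)) (at z within cball a (norm y))"
      if "z \<in> cball a (norm y)" for z
    proof -
      have "z \<in> U" using that sub \<rho>(2)[OF a] by blast
      then show ?thesis by (rule has_derivative_at_withinI[OF f'])
    qed
    have on: "onorm (blinfun_apply (f' z) - blinfun_apply (f' a)) \<le> B * norm y"
      if "z \<in> cball a (norm y)" for z
      using lip[OF that] by (simp add: norm_blinfun.rep_eq minus_blinfun.rep_eq fun_diff_def)
    have seg: "a + t *\<^sub>R (a + y - a) \<in> cball a (norm y)" if "t \<in> {0..1}" for t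
      using that by (simp add: dist_norm mult_left_le_one_le)
    have "norm (F (a + y) - F a - blinfun_apply (f' a) ((a + y) - a)) \<le> norm ((a + y) - a) * (B * norm y)"
      by (rule differentiable_bound_linearization[OF seg der on]) auto
    moreover have "jacobian F (at a) *v y = blinfun_apply (f' a) y"
    proof -
      have h: "(F has_derivative blinfun_apply (f' a)) (at a)" using f' a U(1) by blast
      then have "F differentiable (at a)" by (rule differentiableI)
      then have "(F has_derivative (\<lambda>h. jacobian F (at a) *v h)) (at a)"
        by (simp add: jacobian_works)
      from has_derivative_unique[OF this h] show ?thesis by metis
    qed
    ultimately show ?thesis by (simp add: power2_eq_square mult_ac)
  qed
  then have "\<forall>a\<in>K. \<forall>y. norm y \<le> \<rho> \<longrightarrow>
      norm (F (a + y) - F a - jacobian F (at a) *v y) \<le> B * (norm y)\<^sup>2"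
    by blast
  with \<rho>(1) less_imp_le[OF B(1)] show ?thesis by blast
qed

text \<open>For negative \<open>z\<close> the upper bound follows on dividing \<open>exp z * (1 - z)
  \<le> 1 \<le> 1 - z ^ 3 = (1 + z + z\<^sup>2) * (1 - z)\<close> by the positive number
  \<open>1 - z\<close>.\<close>

lemma exp_bound_abs: "\<bar>exp z - 1 - z\<bar> \<le> z\<^sup>2" if "\<bar>z\<bar> \<le> 1" for z :: real
proof -
  have "exp z \<le> 1 + z + z\<^sup>2"
  proof (cases "0 \<le> z")
    case False
    have "exp z * (1 - z) \<le> exp z * exp (- z)"
      using exp_ge_add_one_self[of "- z"] by (intro mult_left_mono) auto
    also have "\<dots> = 1" by (simp flip: exp_add)
    also have "1 \<le> (1 + z + z\<^sup>2) * (1 - z)"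
    proof -
      have "(1 + z + z\<^sup>2) * (1 - z) = 1 - z ^ 3" by (simp add: algebra_simps power2_eq_square power3_eq_cube)
      moreover have "z ^ 3 \<le> 0" using False by (simp add: power3_eq_cube mult_nonneg_nonpos)
      ultimately show ?thesis by simp
    qed
    finally show ?thesis using False by simp
  qed (use that exp_bound in auto)
  then show ?thesis using exp_ge_add_one_self[of z] by linarith
qed

text \<open>\<open>u i\<close> is the ratio of new to old entry. Its expansion serves the change of
  \<sigma>, that of its reciprocal serves the change of \<mu>/\<sigma>.\<close>

lemma softmax_taylor:
  fixes \<theta> x :: "real^'n"
  assumes x0: "softmax \<theta> \<bullet> x = 0" and xn: "norm x \<le> 1 / 2"
  defines "u \<equiv> \<lambda>i. exp (x $ i) / (\<Sum>j\<in>UNIV. softmax \<theta> $ j * exp (x $ j))"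
  shows "softmax (\<theta> + x) $ i = softmax \<theta> $ i * u i" "0 < u i"
    "\<bar>u i - 1 - x $ i\<bar> \<le> 3 * (norm x)\<^sup>2" "\<bar>1 / u i - 1 + x $ i\<bar> \<le> 3 * (norm x)\<^sup>2"
proof -
  define \<sigma> where "\<sigma> = softmax \<theta>"
  define E where "E = (\<Sum>j\<in>UNIV. \<sigma> $ j * exp (x $ j))"
  have s: "0 < \<sigma> $ j" "(\<Sum>j\<in>UNIV. \<sigma> $ j) = 1" for j
    using softmax_pos[of \<theta>] by (auto simp: \<sigma>_def pos_def vsum_def)
  have u: "u i = exp (x $ i) / E" for i by (simp add: u_def E_def \<sigma>_def)
  have xi: "\<bar>x $ j\<bar> \<le> norm x" for j by (rule component_le_norm_cart)
  then have xj: "\<bar>x $ j\<bar> \<le> 1 / 2" for j using xn order_trans by blast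
  have x2: "(x $ j)\<^sup>2 \<le> (norm x)\<^sup>2" for j using power_mono[OF xi[of j], of 2] by simp
  \<comment> \<open>Orthogonality of \<open>x\<close> to \<sigma> removes the linear term, so the
    normalising sum is 1 up to second order. It is also at least 1, so dividing by it only
    helps.\<close>
  have E1: "E - 1 = (\<Sum>j\<in>UNIV. \<sigma> $ j * (exp (x $ j) - 1 - x $ j))"
    using x0 s(2) by (simp add: E_def \<sigma>_def inner_vec_def algebra_simps sum.distrib sum_subtractf)
  have "0 \<le> E - 1"
    unfolding E1 using s(1) exp_ge_add_one_self
    by (intro sum_nonneg mult_nonneg_nonneg) (auto simp: less_imp_le algebra_simps)
  moreover have "E - 1 \<le> (\<Sum>j\<in>UNIV. \<sigma> $ j * (norm x)\<^sup>2)"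
    unfolding E1
  proof (intro sum_mono mult_left_mono)
    fix j show "exp (x $ j) - 1 - x $ j \<le> (norm x)\<^sup>2"
      using exp_bound_abs[of "x $ j"] xj[of j] x2[of j] by linarith
  qed (use s in \<open>auto simp: less_imp_le\<close>)
  ultimately have E: "1 \<le> E" "E - 1 \<le> (norm x)\<^sup>2" using s(2) by (auto simp flip: sum_distrib_right)
  show "softmax (\<theta> + x) $ i = softmax \<theta> $ i * u i" by (simp add: softmax_add u_def)
  show "0 < u i" using E by (simp add: u)
  let ?t = "(norm x)\<^sup>2"
  have a: "\<bar>exp (x $ i) - 1 - x $ i\<bar> \<le> ?t"
    using exp_bound_abs[of "x $ i"] xj[of i] x2[of i] by linarith
  have b: "\<bar>exp (- x $ i) - 1 + x $ i\<bar> \<le> ?t"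
    using exp_bound_abs[of "- x $ i"] xj[of i] x2[of i] by auto
  have c: "\<bar>(1 + x $ i) * (E - 1)\<bar> \<le> 2 * ?t"
    unfolding abs_mult using E xj[of i] by (intro mult_mono) auto
  \<comment> \<open>The constant 3 is 1 for the remainder of the exponential plus 2 for the
    normalising sum, since \<open>1 + x $ i\<close> is at most 2 in absolute value.\<close>
  have "u i - 1 - x $ i = ((exp (x $ i) - 1 - x $ i) - (1 + x $ i) * (E - 1)) / E"
    using E by (simp add: u field_simps)
  also have "\<bar>\<dots>\<bar> \<le> \<bar>(exp (x $ i) - 1 - x $ i) - (1 + x $ i) * (E - 1)\<bar> / 1"
    unfolding abs_divide using E by (intro divide_left_mono) auto
  also have "\<dots> \<le> 3 * ?t" unfolding div_by_1 using a c by linarith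
  finally show "\<bar>u i - 1 - x $ i\<bar> \<le> 3 * ?t" .
  have "(norm x)\<^sup>2 \<le> (1/2)\<^sup>2" using xn by (intro power_mono) auto
  then have e2: "exp (- x $ i) \<le> 2" using b xj[of i] by (simp add: power2_eq_square abs_le_iff) linarith
  have "1 / u i - 1 + x $ i = exp (- x $ i) * (E - 1) + (exp (- x $ i) - 1 + x $ i)"
    by (simp add: u algebra_simps exp_minus divide_inverse)
  also have "\<bar>\<dots>\<bar> \<le> exp (- x $ i) * (E - 1) + ?t"
    using b E by (intro order_trans[OF abs_triangle_ineq add_mono[OF _ b]]) (simp add: abs_mult)
  also have "exp (- x $ i) * (E - 1) \<le> 2 * ?t" using e2 E by (intro mult_mono) auto
  finally show "\<bar>1 / u i - 1 + x $ i\<bar> \<le> 3 * ?t" by simp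
qed

lemma norm_le_scaled_vec:
  fixes v w :: "real^'n"
  assumes "\<And>i. \<bar>v $ i\<bar> \<le> c * \<bar>w $ i\<bar>"
  shows "norm v \<le> \<bar>c\<bar> * norm w"
proof -
  have "norm v \<le> norm (c *\<^sub>R w)"
  proof (rule norm_le_componentwise_cart)
    fix i show "norm (v $ i) \<le> norm ((c *\<^sub>R w) $ i)"
      using assms[of i] mult_right_mono[OF abs_ge_self[of c] abs_ge_zero[of "w $ i"]]
      by (simp add: abs_mult)
  qed
  then show ?thesis by simp
qed

text \<open>The error splits into \<open>e1\<close> from \<open>F\<close>, \<open>e2\<close> from
  \<mu>/\<sigma> and a multiple \<open>s\<close> of the all-ones vector. With
  \<open>norm y \<le> 3 * norm x\<close>, the Taylor remainder of \<open>F\<close> gives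
  \<open>9 * C\<close> and the second-order part \<open>e0\<close> of the displacement gives
  \<open>3 * B\<close>; the three terms of \<open>s\<close> add up to
  \<open>36 * C + 15 * B + 3 * BF\<close>.\<close>

lemma residual_taylor:
  fixes F :: "real^'n \<Rightarrow> real^'n" and \<theta> x \<mu> :: "real^'n"
  defines "\<sigma> \<equiv> softmax \<theta>"
  assumes x0: "\<sigma> \<bullet> x = 0" and xn: "norm x \<le> 1 / 2"
    and B: "0 \<le> B" "\<And>z. norm (jacobian F (at \<sigma>) *v z) \<le> B * norm z"
    and C: "0 \<le> C" "\<And>y. norm y \<le> 3 * norm x \<Longrightarrow>
        norm (F (\<sigma> + y) - F \<sigma> - jacobian F (at \<sigma>) *v y) \<le> C * (norm y)\<^sup>2"
    and BF: "norm (F \<sigma>) \<le> BF"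
    and M: "0 \<le> M" "\<And>i. \<bar>\<mu> $ i\<bar> \<le> M * \<sigma> $ i"
  shows "norm (Gt F (softmax (\<theta> + x)) \<mu> - Gt F \<sigma> \<mu> - (newton_mat F k \<mu> \<sigma> *v x - hprod (Gt F \<sigma> \<mu>) x))
    \<le> ((9 * C + 3 * B) + (3 * M + 36 * C + 15 * B + 3 * BF) * norm (1 :: real^'n)) * (norm x)\<^sup>2"
proof -
  let ?n = "norm (1 :: real^'n)" and ?t = "(norm x)\<^sup>2"
  define \<tau> where "\<tau> = softmax (\<theta> + x)"
  define u where "u i = exp (x $ i) / (\<Sum>j\<in>UNIV. softmax \<theta> $ j * exp (x $ j))" for i
  have p: "pos \<sigma>" "pos \<tau>" by (simp_all add: \<sigma>_def \<tau>_def softmax_pos)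
  note u = softmax_taylor[OF x0[unfolded \<sigma>_def] xn, folded u_def \<sigma>_def \<tau>_def]
  have sn: "norm \<sigma> \<le> 1" using p by (simp add: pos_simplex simplex_norm)
  define A where "A = jacobian F (at \<sigma>) *v hprod \<sigma> x"
  define y where "y = \<tau> - \<sigma>"
  define e0 where "e0 = y - hprod \<sigma> x"
  define e1 where "e1 = F \<tau> - F \<sigma> - A"
  define e2 where "e2 = hquot \<mu> \<tau> - hquot \<mu> \<sigma> + hprod (hquot \<mu> \<sigma>) x"
  have t: "?t \<le> norm x / 2"
    using mult_left_mono[OF xn norm_ge_zero[of x]] by (simp add: power2_eq_square)
  have sx: "norm (hprod \<sigma> x) \<le> norm x"
    using order_trans[OF norm_hprod_le mult_right_mono[OF sn norm_ge_zero]] by simp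
  have "norm e0 \<le> \<bar>3 * ?t\<bar> * norm \<sigma>"
  proof (rule norm_le_scaled_vec)
    fix i
    have "e0 $ i = \<sigma> $ i * (u i - 1 - x $ i)"
      by (simp add: e0_def y_def hprod_def u(1) algebra_simps)
    then show "\<bar>e0 $ i\<bar> \<le> 3 * ?t * \<bar>\<sigma> $ i\<bar>"
      using mult_left_mono[OF u(3)[of i] abs_ge_zero[of "\<sigma> $ i"]] by (simp add: abs_mult mult_ac)
  qed
  also have "\<dots> \<le> 3 * ?t" using mult_left_mono[OF sn, of "3 * ?t"] by simp
  finally have e0: "norm e0 \<le> 3 * ?t" .
  have "norm y \<le> norm (hprod \<sigma> x) + norm e0"
    using norm_triangle_ineq[of "hprod \<sigma> x" e0] by (simp add: e0_def)
  then have y: "norm y \<le> 3 * norm x" using sx e0 t norm_ge_zero[of x] by linarith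
  have y2: "(norm y)\<^sup>2 \<le> 9 * ?t" using power_mono[OF y norm_ge_zero, of 2] by (simp add: power_mult_distrib)
  have "e1 = (F (\<sigma> + y) - F \<sigma> - jacobian F (at \<sigma>) *v y) + jacobian F (at \<sigma>) *v e0"
    by (simp add: e1_def y_def A_def e0_def matrix_vector_mult_diff_distrib)
  then have "norm e1 \<le> C * (norm y)\<^sup>2 + B * norm e0"
    using norm_triangle_le[OF add_mono[OF C(2)[OF y] B(2)[of e0]]] by simp
  also have "\<dots> \<le> C * (9 * ?t) + B * (3 * ?t)"
    using B(1) C(1) y2 e0 by (intro add_mono mult_left_mono) auto
  finally have e1: "norm e1 \<le> (9 * C + 3 * B) * ?t" by (simp add: algebra_simps)
  \<comment> \<open>\<mu>/\<tau> is \<mu>/\<sigma> times \<open>1 / u i\<close>, so only the bound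
    \<open>M\<close> on the quotient enters and no lower bound on \<sigma>.\<close>
  have "norm e2 \<le> \<bar>3 * M * ?t\<bar> * ?n"
  proof (rule norm_le_scaled_vec)
    fix i
    have "\<sigma> $ i > 0" using p by (simp add: pos_def)
    then have q: "\<bar>\<mu> $ i / \<sigma> $ i\<bar> \<le> M" using M(2)[of i] by (simp add: abs_divide divide_le_eq)
    have "e2 $ i = (\<mu> $ i / \<sigma> $ i) * (1 / u i - 1 + x $ i)"
      by (simp add: e2_def hquot_def hprod_def u(1) algebra_simps)
    also have "\<bar>\<dots>\<bar> \<le> M * (3 * ?t)"
      unfolding abs_mult using q u(4)[of i] M(1) by (intro mult_mono) auto
    finally show "\<bar>e2 $ i\<bar> \<le> 3 * M * ?t * \<bar>(1 :: real^'n) $ i\<bar>" by (simp add: mult_ac)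
  qed
  then have e2: "norm e2 \<le> 3 * M * ?t * ?n" using M(1) by simp
  \<comment> \<open>The second-order remainder of the scalar product of \<sigma> with
    \<open>F \<sigma>\<close>, sorted by the product rule.\<close>
  define s where "s = \<sigma> \<bullet> e1 + e0 \<bullet> F \<sigma> + y \<bullet> (F \<tau> - F \<sigma>)"
  have dF: "norm (F \<tau> - F \<sigma>) \<le> B * norm x + (9 * C + 3 * B) * norm x"
  proof -
    have "norm (F \<tau> - F \<sigma>) \<le> norm A + norm e1"
      using norm_triangle_ineq[of A e1] by (simp add: e1_def)
    also have "norm A \<le> B * norm x"
      unfolding A_def using order_trans[OF B(2) mult_left_mono[OF sx B(1)]] .
    also have "norm e1 \<le> (9 * C + 3 * B) * norm x"
      using B(1) C(1) t by (intro order_trans[OF e1] mult_left_mono) (auto intro: order_trans[OF t])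
    finally show ?thesis by simp
  qed
  have "\<bar>\<sigma> \<bullet> e1\<bar> \<le> (9 * C + 3 * B) * ?t"
    using order_trans[OF Cauchy_Schwarz_ineq2 mult_right_mono[OF sn norm_ge_zero], of e1] e1 by simp
  moreover have "\<bar>e0 \<bullet> F \<sigma>\<bar> \<le> 3 * ?t * BF"
    by (rule order_trans[OF Cauchy_Schwarz_ineq2]) (use e0 BF in \<open>auto intro!: mult_mono\<close>)
  moreover have "\<bar>y \<bullet> (F \<tau> - F \<sigma>)\<bar> \<le> (3 * norm x) * (B * norm x + (9 * C + 3 * B) * norm x)"
    by (rule order_trans[OF Cauchy_Schwarz_ineq2]) (use y dF in \<open>auto intro!: mult_mono\<close>)
  ultimately have s: "\<bar>s\<bar> \<le> (36 * C + 15 * B + 3 * BF) * ?t"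
    unfolding s_def by (simp add: algebra_simps power2_eq_square)
  have "Gt F \<tau> \<mu> - Gt F \<sigma> \<mu> - (newton_mat F k \<mu> \<sigma> *v x - hprod (Gt F \<sigma> \<mu>) x) = e1 - e2 - s *\<^sub>R 1"
  proof -
    have yx: "y \<bullet> F \<sigma> = e0 \<bullet> F \<sigma> + F \<sigma> \<bullet> hprod \<sigma> x"
      by (simp add: e0_def inner_diff_left inner_commute[of "hprod \<sigma> x"])
    have "s = \<sigma> \<bullet> e1 + (y \<bullet> F \<sigma> - F \<sigma> \<bullet> hprod \<sigma> x) + y \<bullet> (F \<tau> - F \<sigma>)"
      unfolding s_def yx by simp
    then have s': "s = (\<tau> \<bullet> F \<tau> - vsum \<mu>) - (\<sigma> \<bullet> F \<sigma> - vsum \<mu>) - F \<sigma> \<bullet> hprod \<sigma> x - \<sigma> \<bullet> A"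
      unfolding e1_def y_def by (simp add: inner_diff_left inner_diff_right)
    show ?thesis
      unfolding newton_split[OF p(1) x0] unfolding Gt_eq[OF p(1)] Gt_eq[OF p(2)] s' A_def[symmetric] e1_def e2_def pr_def
      by (simp only: scaleR_diff_left) (simp add: algebra_simps)
  qed
  then have "norm (Gt F \<tau> \<mu> - Gt F \<sigma> \<mu> - (newton_mat F k \<mu> \<sigma> *v x - hprod (Gt F \<sigma> \<mu>) x))
      \<le> norm e1 + norm e2 + \<bar>s\<bar> * ?n"
    using norm_triangle_ineq4[of "e1 - e2" "s *\<^sub>R 1"] norm_triangle_ineq4[of e1 e2] by simp
  also have "\<dots> \<le> (9 * C + 3 * B) * ?t + 3 * M * ?t * ?n + (36 * C + 15 * B + 3 * BF) * ?t * ?n"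
    by (intro add_mono e1 e2 mult_right_mono s) auto
  finally show ?thesis by (simp add: \<tau>_def algebra_simps)
qed

section \<open>Continuity, compactness and inverse bounds\<close>

lemma continuous_on_hprod [continuous_intros]:
  "continuous_on S f \<Longrightarrow> continuous_on S g \<Longrightarrow> continuous_on S (\<lambda>x. hprod (f x) (g x))"
  unfolding hprod_def by (intro continuous_intros)

lemma continuous_on_pr [continuous_intros]:
  "continuous_on S f \<Longrightarrow> continuous_on S g \<Longrightarrow> continuous_on S (\<lambda>x. pr (f x) (g x))"
  unfolding pr_def by (intro continuous_intros)

lemma continuous_on_vsum [continuous_intros]:
  "continuous_on S f \<Longrightarrow> continuous_on S (\<lambda>x. vsum (f x))"
  unfolding vsum_inner by (intro continuous_intros)

lemma compact_pos_min:
  fixes h :: "'a::topological_space \<Rightarrow> real"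
  assumes "compact S" "continuous_on S h" "\<And>x. x \<in> S \<Longrightarrow> 0 < h x"
  shows "\<exists>m>0. \<forall>x\<in>S. m \<le> h x"
proof (cases "S = {}")
  case False
  with continuous_attains_inf[OF assms(1) _ assms(2)] assms(3) show ?thesis by blast
qed (auto intro: exI[of _ 1])

lemma compact_upper_bound:
  fixes h :: "'a::topological_space \<Rightarrow> real"
  assumes "compact S" "continuous_on S h"
  shows "\<exists>m>0. \<forall>x\<in>S. h x \<le> m"
proof (cases "S = {}")
  case False
  with continuous_attains_sup[OF assms(1) _ assms(2)] obtain a where "\<forall>x\<in>S. h x \<le> h a" by blast
  then show ?thesis by (intro exI[of _ "max 1 (h a)"]) (auto simp: le_max_iff_disj)
qed (auto intro: exI[of _ 1])

text \<open>By uniqueness of the derivative the matrix \<open>jacobian F (at a)\<close> acts as the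
  given continuous derivative; continuity statements about the Jacobian are obtained through
  \<open>D\<close>.\<close>

lemma C1_jacobian:
  fixes F :: "real^'n \<Rightarrow> real^'n"
  assumes "C1_near K F"
  shows "\<exists>D :: real^'n \<Rightarrow> (real^'n) \<Rightarrow>\<^sub>L (real^'n). continuous_on K D \<and> continuous_on K F \<and>
    (\<forall>a\<in>K. (F has_derivative (\<lambda>z. jacobian F (at a) *v z)) (at a) \<and>
      (\<forall>z. jacobian F (at a) *v z = blinfun_apply (D a) z))"
proof -
  obtain U D where U: "K \<subseteq> U" "\<And>x. x \<in> U \<Longrightarrow> (F has_derivative blinfun_apply (D x)) (at x)"
    "continuous_on U D"
    using assms by (auto simp: C1_near_def C1_on_open_def)
  have *: "(F has_derivative (\<lambda>z. jacobian F (at a) *v z)) (at a)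
      \<and> (\<forall>z. jacobian F (at a) *v z = blinfun_apply (D a) z)" if "a \<in> K" for a
  proof -
    have h: "(F has_derivative blinfun_apply (D a)) (at a)" using U that by blast
    then have "F differentiable (at a)" by (rule differentiableI)
    then have h2: "(F has_derivative (\<lambda>h. jacobian F (at a) *v h)) (at a)"
      by (simp add: jacobian_works)
    from has_derivative_unique[OF this h] h2 show ?thesis by metis
  qed
  have "continuous_on K F"
    using U by (meson continuous_at_imp_continuous_on has_derivative_continuous subsetD)
  with * continuous_on_subset[OF U(3,1)] show ?thesis by blast
qed

lemma invertible_iff_ker: "invertible A \<longleftrightarrow> (\<forall>x. A *v x = 0 \<longrightarrow> x = 0)" for A :: "real^'n^'n"
  by (simp add: invertible_left_inverse matrix_left_invertible_ker)

lemma matrix_inv_mult: "invertible A \<Longrightarrow> A *v (matrix_inv A *v w) = w" for A :: "real^'n^'n"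
proof -
  assume "invertible A"
  then have "A ** matrix_inv A = mat 1"
    unfolding invertible_def matrix_inv_def by (rule someI2_ex) auto
  then show ?thesis by (simp add: matrix_vector_mul_assoc)
qed

lemma norm_ge_unit_sphere:
  fixes A :: "real^'n^'n"
  assumes "\<And>y. norm y = 1 \<Longrightarrow> m \<le> norm (A *v y)" "0 < m"
  shows "norm y \<le> (1 / m) * norm (A *v y)"
proof (cases "y = 0")
  case False
  have "m \<le> norm (A *v (inverse (norm y) *\<^sub>R y))" using False by (intro assms) auto
  also have "\<dots> = norm (A *v y) / norm y"
    by (simp add: matrix_vector_mult_scaleR divide_inverse mult.commute)
  finally show ?thesis using False assms(2) by (simp add: field_simps)
qed simp

lemma norm_le_unit_sphere:
  fixes A :: "real^'n^'n"
  assumes "\<And>y. norm y = 1 \<Longrightarrow> norm (A *v y) \<le> m"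
  shows "norm (A *v y) \<le> m * norm y"
proof (cases "y = 0")
  case False
  have "norm (A *v (inverse (norm y) *\<^sub>R y)) \<le> m" using False by (intro assms) auto
  also have "norm (A *v (inverse (norm y) *\<^sub>R y)) = norm (A *v y) / norm y"
    by (simp add: matrix_vector_mult_scaleR divide_inverse mult.commute)
  finally show ?thesis using False by (simp add: field_simps)
qed simp

section \<open>Uniform bounds on the neighbourhood\<close>

text \<open>Collects what the local analysis uses of the neighbourhood. The quotient bound is
  written with \<sigma> on the right-hand side because points of \<open>N\<close> may have vanishing
  entries of \<sigma>.\<close>

locale newton_region =
  fixes F :: "real^'n \<Rightarrow> real^'n" and k M d :: real and N :: "((real^'n) \<times> (real^'n)) set"
  assumes compact_N: "compact N"
    and simplex_N: "(\<sigma>, \<mu>) \<in> N \<Longrightarrow> \<sigma> \<in> std_simplex"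
    and quot_N: "(\<sigma>, \<mu>) \<in> N \<Longrightarrow> \<bar>\<mu> $ i\<bar> \<le> M * \<sigma> $ i"
    and C1: "C1_near std_simplex F" and C2: "C2_near (fst ` N) F"
    and regular: "N \<inter> singular_manifold F k = {}"
    and k_nz: "(\<sigma>, \<mu>) \<in> N \<Longrightarrow> k + vsum \<mu> \<noteq> 0"
    and M_nonneg: "0 \<le> M" and d_pos: "0 < d"
begin

lemma continuous_F: "continuous_on std_simplex F"
  using C1_jacobian[OF C1] by blast

lemma continuous_on_F [continuous_intros]:
  "continuous_on S f \<Longrightarrow> f ` S \<subseteq> std_simplex \<Longrightarrow> continuous_on S (\<lambda>x. F (f x))"
  by (rule continuous_on_compose2[OF continuous_F])

lemma continuous_newton:
  "continuous_on (N \<times> UNIV) (\<lambda>p. newton_mat F k (snd (fst p)) (fst (fst p)) *v snd p)"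
proof -
  obtain D :: "real^'n \<Rightarrow> (real^'n) \<Rightarrow>\<^sub>L (real^'n)" where D: "continuous_on std_simplex D"
    "\<And>a z. a \<in> std_simplex \<Longrightarrow> jacobian F (at a) *v z = blinfun_apply (D a) z"
    using C1_jacobian[OF C1] by blast
  have D': "continuous_on (N \<times> UNIV) (\<lambda>p. D (fst (fst p)))"
    by (rule continuous_on_compose2[OF D(1)]) (auto intro!: continuous_intros simp: simplex_N)
  have "continuous_on (N \<times> UNIV) (\<lambda>p. let \<sigma> = fst (fst p); y = snd p in
      pr \<sigma> (blinfun_apply (D \<sigma>) (hprod \<sigma> (pr \<sigma> y)) + hprod (pr \<sigma> (F \<sigma>)) (pr \<sigma> y))
     + (k * (\<sigma> \<bullet> y)) *\<^sub>R 1 + vsum (snd (fst p)) *\<^sub>R y)"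
    unfolding Let_def
    by (intro continuous_intros D' bounded_bilinear.continuous_on[OF bounded_bilinear_blinfun_apply])
      (auto simp: simplex_N)
  then show ?thesis
    by (rule continuous_on_eq) (auto simp: newton_mult D(2) simplex_N Let_def)
qed

lemma continuous_G: "continuous_on N (\<lambda>p. G F (fst p) (snd p))"
  unfolding G_eq by (intro continuous_intros) (auto simp: simplex_N)

text \<open>Pairing with \<sigma> forces a kernel vector into ker \<sigma>^T, since k + 1^T\<mu> is
  nonzero on \<open>N\<close>. There it is an eigenvector of \<open>J\<close> for - 1^T\<mu>, and
  the zero residual identifies the point as one of the singular manifold.\<close>

lemma newton_kernel_trivial:
  assumes N: "(\<sigma>, \<mu>) \<in> N" and "G F \<sigma> \<mu> = 0" and ker: "newton_mat F k \<mu> \<sigma> *v y = 0"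
  shows "y = 0"
proof (rule ccontr)
  assume y: "y \<noteq> 0"
  have s: "\<sigma> \<in> std_simplex" using N by (rule simplex_N)
  have "\<sigma> \<bullet> y = 0"
    using inner_newton[OF simplex_vsum[OF s], of F k \<mu> y] ker k_nz[OF N] by simp
  moreover have "J F k \<sigma> *v y = (- vsum \<mu>) *\<^sub>R y"
  proof -
    have "newton_mat F k \<mu> \<sigma> *v y = J F k \<sigma> *v y + vsum \<mu> *\<^sub>R y"
      by (simp add: newton_mat_def matrix_vector_mult_add_rdistrib scaleR_matrix_vector_assoc[symmetric])
    then show ?thesis using ker by (simp add: add_eq_0_iff)
  qed
  ultimately have "- vsum \<mu> \<in> perp_eigs F k \<sigma>" using y by (auto simp: perp_eigs_def)
  then have "(\<sigma>, mut F \<sigma> - (- vsum \<mu>) *\<^sub>R \<sigma>) \<in> singular_manifold F k"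
    unfolding singular_manifold_def using s by blast
  then show False using G_mut[OF assms(2) s] regular N by auto
qed

lemma compact_N_sphere: "compact (N \<times> sphere (0 :: real^'n) 1)"
  by (intro compact_Times compact_N compact_sphere)

text \<open>On \<open>N\<close> times the unit sphere the sum of the norms of the residual and of
  the image of the vector has a positive minimum \<open>m\<close>. Where the residual is at most
  \<open>m / 2\<close>, the Newton matrix must supply the other half.\<close>

lemma inverse_bound:
  "\<exists>\<delta>>0. \<exists>K>0. \<forall>\<sigma> \<mu>. (\<sigma>, \<mu>) \<in> N \<and> norm (G F \<sigma> \<mu>) \<le> \<delta> \<longrightarrow>
    invertible (newton_mat F k \<mu> \<sigma>) \<and> (\<forall>y. norm y \<le> K * norm (newton_mat F k \<mu> \<sigma> *v y))"
proof -
  have "\<exists>m>0. \<forall>p\<in>N \<times> sphere (0 :: real^'n) 1.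
      m \<le> norm (G F (fst (fst p)) (snd (fst p))) + norm (newton_mat F k (snd (fst p)) (fst (fst p)) *v snd p)"
  proof (rule compact_pos_min[OF compact_N_sphere])
    show "continuous_on (N \<times> sphere 0 1) (\<lambda>p. norm (G F (fst (fst p)) (snd (fst p)))
        + norm (newton_mat F k (snd (fst p)) (fst (fst p)) *v snd p))"
      by (intro continuous_intros continuous_on_subset[OF continuous_newton]
          continuous_on_compose2[OF continuous_G, of _ fst]) auto
  next
    fix p :: "((real^'n) \<times> (real^'n)) \<times> (real^'n)" assume p: "p \<in> N \<times> sphere 0 1"
    then have "snd p \<noteq> 0" by auto
    with p newton_kernel_trivial[of "fst (fst p)" "snd (fst p)" "snd p"]
    have "G F (fst (fst p)) (snd (fst p)) \<noteq> 0 \<or> newton_mat F k (snd (fst p)) (fst (fst p)) *v snd p \<noteq> 0"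
      by auto
    then show "0 < norm (G F (fst (fst p)) (snd (fst p)))
        + norm (newton_mat F k (snd (fst p)) (fst (fst p)) *v snd p)"
      by (auto intro: add_pos_nonneg add_nonneg_pos)
  qed
  then obtain m where m: "m > 0" "\<And>\<sigma> \<mu> y. (\<sigma>, \<mu>) \<in> N \<Longrightarrow> norm y = 1 \<Longrightarrow>
      m \<le> norm (G F \<sigma> \<mu>) + norm (newton_mat F k \<mu> \<sigma> *v y)" by fastforce
  have b: "norm y \<le> (1 / (m / 2)) * norm (newton_mat F k \<mu> \<sigma> *v y)"
    if N: "(\<sigma>, \<mu>) \<in> N" and "norm (G F \<sigma> \<mu>) \<le> m / 2" for \<sigma> \<mu> y
  proof (rule norm_ge_unit_sphere)
    show "m / 2 \<le> norm (newton_mat F k \<mu> \<sigma> *v z)" if "norm z = 1" for z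
      using m(2)[OF N that] \<open>norm (G F \<sigma> \<mu>) \<le> m / 2\<close> by linarith
  qed (use m in auto)
  have "invertible (newton_mat F k \<mu> \<sigma>) \<and> (\<forall>y. norm y \<le> (1 / (m / 2)) * norm (newton_mat F k \<mu> \<sigma> *v y))"
    if "(\<sigma>, \<mu>) \<in> N \<and> norm (G F \<sigma> \<mu>) \<le> m / 2" for \<sigma> \<mu>
  proof -
    have "y = 0" if "newton_mat F k \<mu> \<sigma> *v y = 0" for y
      using b[of \<sigma> \<mu> y] \<open>_ \<and> _\<close> that by simp
    then show ?thesis using b that unfolding invertible_iff_ker by blast
  qed
  moreover have "0 < m / 2" "0 < 1 / (m / 2)" using m(1) by auto
  ultimately show ?thesis by blast
qed

text \<open>Bounds the step length also at large residuals; it serves the third alternative of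
  \<open>corrector_quadratic\<close>.\<close>

lemma all_invertible_bound:
  assumes "\<forall>(s, m)\<in>N. invertible (newton_mat F k m s)"
  shows "\<exists>K>0. \<forall>\<sigma> \<mu> y. (\<sigma>, \<mu>) \<in> N \<longrightarrow> norm y \<le> K * norm (newton_mat F k \<mu> \<sigma> *v y)"
proof -
  have "\<exists>m>0. \<forall>p\<in>N \<times> sphere (0 :: real^'n) 1.
      m \<le> norm (newton_mat F k (snd (fst p)) (fst (fst p)) *v snd p)"
  proof (rule compact_pos_min[OF compact_N_sphere])
    show "continuous_on (N \<times> sphere 0 1) (\<lambda>p. norm (newton_mat F k (snd (fst p)) (fst (fst p)) *v snd p))"
      by (intro continuous_intros continuous_on_subset[OF continuous_newton]) auto
    fix p :: "((real^'n) \<times> (real^'n)) \<times> (real^'n)" assume p: "p \<in> N \<times> sphere 0 1"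
    then have "snd p \<noteq> 0" and "fst p \<in> N" by auto
    then have "invertible (newton_mat F k (snd (fst p)) (fst (fst p)))"
      using assms by (metis (mono_tags, lifting) case_prod_beta)
    then show "0 < norm (newton_mat F k (snd (fst p)) (fst (fst p)) *v snd p)"
      using \<open>snd p \<noteq> 0\<close> unfolding invertible_iff_ker by auto
  qed
  then obtain m where m: "m > 0" "\<And>\<sigma> \<mu> y. (\<sigma>, \<mu>) \<in> N \<Longrightarrow> norm y = 1 \<Longrightarrow>
      m \<le> norm (newton_mat F k \<mu> \<sigma> *v y)" by fastforce
  then have "norm y \<le> (1 / m) * norm (newton_mat F k \<mu> \<sigma> *v y)" if "(\<sigma>, \<mu>) \<in> N" for \<sigma> \<mu> y
    using norm_ge_unit_sphere that by blast
  moreover have "0 < 1 / m" using m(1) by simp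
  ultimately show ?thesis by blast
qed

lemma newton_upper: "\<exists>L>0. \<forall>\<sigma> \<mu> y. (\<sigma>, \<mu>) \<in> N \<longrightarrow> norm (newton_mat F k \<mu> \<sigma> *v y) \<le> L * norm y"
proof -
  have "\<exists>m>0. \<forall>p\<in>N \<times> sphere (0 :: real^'n) 1.
      norm (newton_mat F k (snd (fst p)) (fst (fst p)) *v snd p) \<le> m"
    by (intro compact_upper_bound[OF compact_N_sphere] continuous_intros
        continuous_on_subset[OF continuous_newton]) auto
  then obtain m where m: "m > 0" "\<And>\<sigma> \<mu> y. (\<sigma>, \<mu>) \<in> N \<Longrightarrow> norm y = 1 \<Longrightarrow>
      norm (newton_mat F k \<mu> \<sigma> *v y) \<le> m" by fastforce
  then show ?thesis using norm_le_unit_sphere by blast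
qed

lemma F_bound: "\<exists>B>0. \<forall>\<sigma>\<in>std_simplex. norm (F \<sigma>) \<le> B"
  by (intro compact_upper_bound compact_simplex continuous_intros continuous_F)

lemma jacobian_bound: "\<exists>B>0. \<forall>\<sigma>\<in>std_simplex. \<forall>z. norm (jacobian F (at \<sigma>) *v z) \<le> B * norm z"
proof -
  obtain D :: "real^'n \<Rightarrow> (real^'n) \<Rightarrow>\<^sub>L (real^'n)" where D: "continuous_on std_simplex D"
    "\<And>a z. a \<in> std_simplex \<Longrightarrow> jacobian F (at a) *v z = blinfun_apply (D a) z"
    using C1_jacobian[OF C1] by blast
  obtain B where B: "B > 0" "\<And>\<sigma>. \<sigma> \<in> std_simplex \<Longrightarrow> norm (D \<sigma>) \<le> B"
    using compact_upper_bound[OF compact_simplex continuous_on_norm[OF D(1)]] by blast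
  have "norm (jacobian F (at \<sigma>) *v z) \<le> B * norm z" if "\<sigma> \<in> std_simplex" for \<sigma> z
    unfolding D(2)[OF that]
    by (rule order_trans[OF norm_blinfun mult_right_mono[OF B(2)[OF that] norm_ge_zero]])
  with B(1) show ?thesis by blast
qed

lemma taylor:
  "\<exists>\<rho>>0. \<exists>C>0. \<forall>\<theta> \<mu> x. (softmax \<theta>, \<mu>) \<in> N \<and> softmax \<theta> \<bullet> x = 0 \<and> norm x \<le> \<rho> \<longrightarrow>
    norm (Gt F (softmax (\<theta> + x)) \<mu> - Gt F (softmax \<theta>) \<mu>
      - (newton_mat F k \<mu> (softmax \<theta>) *v x - hprod (Gt F (softmax \<theta>) \<mu>) x)) \<le> C * (norm x)\<^sup>2"
proof -
  have "compact (fst ` N)" by (intro compact_continuous_image compact_N continuous_intros)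
  then obtain \<rho> C where C: "\<rho> > 0" "C \<ge> 0" "\<And>a y. a \<in> fst ` N \<Longrightarrow> norm y \<le> \<rho> \<Longrightarrow>
    norm (F (a + y) - F a - jacobian F (at a) *v y) \<le> C * (norm y)\<^sup>2"
    using C2_taylor[OF C2] by blast
  obtain BF where BF: "BF > 0" "\<And>\<sigma>. \<sigma> \<in> std_simplex \<Longrightarrow> norm (F \<sigma>) \<le> BF" using F_bound by blast
  obtain B where B: "B > 0" "\<And>\<sigma> z. \<sigma> \<in> std_simplex \<Longrightarrow> norm (jacobian F (at \<sigma>) *v z) \<le> B * norm z"
    using jacobian_bound by blast
  let ?K = "(9 * C + 3 * B) + (3 * M + 36 * C + 15 * B + 3 * BF) * norm (1 :: real^'n)"
  \<comment> \<open>The radius 1/2 is the range of \<open>softmax_taylor\<close>;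
    \<open>\<rho> / 3\<close> keeps the displacement of \<sigma>, at most \<open>3 * norm x\<close>,
    within the Taylor radius of \<open>F\<close>.\<close>
  have "norm (Gt F (softmax (\<theta> + x)) \<mu> - Gt F (softmax \<theta>) \<mu>
      - (newton_mat F k \<mu> (softmax \<theta>) *v x - hprod (Gt F (softmax \<theta>) \<mu>) x)) \<le> ?K * (norm x)\<^sup>2"
    if "(softmax \<theta>, \<mu>) \<in> N" "softmax \<theta> \<bullet> x = 0" "norm x \<le> min (1 / 2) (\<rho> / 3)" for \<theta> \<mu> x
  proof (rule residual_taylor)
    show "norm (F (softmax \<theta> + y) - F (softmax \<theta>) - jacobian F (at (softmax \<theta>)) *v y) \<le> C * (norm y)\<^sup>2"
      if "norm y \<le> 3 * norm x" for y
      by (rule C(3)) (use that \<open>norm x \<le> _\<close> \<open>(softmax \<theta>, \<mu>) \<in> N\<close> in \<open>force+\<close>)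
  qed (use that BF B C M_nonneg quot_N simplex_N in \<open>auto\<close>)
  moreover have "0 < min (1 / 2) (\<rho> / 3)" using C(1) by simp
  moreover have "0 < ?K" using C(2) B(1) BF(1) M_nonneg by (intro add_pos_nonneg[OF add_nonneg_pos]) auto
  ultimately show ?thesis by blast
qed

text \<open>The displaced point may lie outside \<open>N\<close>. Entries of \<sigma> shrink by at
  most \<open>exp (- 2 * norm x)\<close>, which limits the growth of \<mu>/\<sigma>. With
  \<open>x = 0\<close> this bounds the residual on \<open>N\<close>.\<close>

lemma Gt_bound:
  "\<exists>B>0. \<forall>\<theta> \<mu> x. (softmax \<theta>, \<mu>) \<in> N \<longrightarrow> norm (Gt F (softmax (\<theta> + x)) \<mu>) \<le> B * exp (2 * norm x)"
proof -
  let ?n = "norm (1 :: real^'n)"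
  obtain BF where BF: "BF > 0" "\<And>\<sigma>. \<sigma> \<in> std_simplex \<Longrightarrow> norm (F \<sigma>) \<le> BF" using F_bound by blast
  have "norm (Gt F (softmax (\<theta> + x)) \<mu>) \<le> ((1 + ?n) * (BF + M * ?n)) * exp (2 * norm x)"
    if N: "(softmax \<theta>, \<mu>) \<in> N" for \<theta> \<mu> x
  proof -
    let ?\<tau> = "softmax (\<theta> + x)"
    have p: "pos ?\<tau>" by (rule softmax_pos)
    have "norm (hquot \<mu> ?\<tau>) \<le> \<bar>M * exp (2 * norm x)\<bar> * ?n"
    proof (rule norm_le_scaled_vec)
      fix i
      have m: "\<bar>\<mu> $ i\<bar> \<le> M * softmax \<theta> $ i" by (rule quot_N[OF N])
      have "softmax \<theta> $ i \<le> ?\<tau> $ i * exp (2 * norm x)"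
        using mult_right_mono[OF softmax_ratio_ge[of \<theta> i x], of "exp (2 * norm x)"]
        by (simp add: mult.assoc flip: exp_add)
      from order_trans[OF m mult_left_mono[OF this M_nonneg]]
      have "\<bar>\<mu> $ i\<bar> \<le> M * exp (2 * norm x) * ?\<tau> $ i" by (simp add: mult_ac)
      then show "\<bar>hquot \<mu> ?\<tau> $ i\<bar> \<le> M * exp (2 * norm x) * \<bar>(1 :: real^'n) $ i\<bar>"
        using p by (simp add: hquot_def abs_divide divide_le_eq pos_def abs_of_pos)
    qed
    then have q: "norm (hquot \<mu> ?\<tau>) \<le> M * ?n * exp (2 * norm x)" using M_nonneg by (simp add: mult_ac)
    have a: "norm (Gt F ?\<tau> \<mu>) \<le> (1 + ?n) * norm (F ?\<tau> - hquot \<mu> ?\<tau>)"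
      unfolding Gt_pr[OF p] by (intro norm_pr_le pos_simplex p)
    have b: "norm (F ?\<tau> - hquot \<mu> ?\<tau>) \<le> BF * exp (2 * norm x) + M * ?n * exp (2 * norm x)"
    proof (rule order_trans[OF norm_triangle_ineq4 add_mono[OF _ q]])
      have "norm (F ?\<tau>) \<le> BF * 1" using BF(2)[OF pos_simplex[OF p]] by simp
      also have "\<dots> \<le> BF * exp (2 * norm x)" using BF(1) by (intro mult_left_mono) auto
      finally show "norm (F ?\<tau>) \<le> BF * exp (2 * norm x)" .
    qed
    show ?thesis using order_trans[OF a mult_left_mono[OF b]] by (simp add: algebra_simps)
  qed
  moreover have "0 < (1 + ?n) * (BF + M * ?n)"
    using BF(1) M_nonneg by (intro mult_pos_pos add_pos_nonneg) auto
  ultimately show ?thesis by blast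
qed

text \<open>The residual is orthogonal to \<sigma>; by \<open>inner_newton\<close> and
  \<open>k_nz\<close> the step is so as well, as \<open>taylor\<close> requires.\<close>

lemma corrector_step:
  assumes "(softmax \<theta>, \<mu>) \<in> N" and inv: "invertible (newton_mat F k \<mu> (softmax \<theta>))"
  shows "\<exists>x. corrector F k \<mu> \<theta> = \<theta> + x \<and> softmax \<theta> \<bullet> x = 0 \<and>
    newton_mat F k \<mu> (softmax \<theta>) *v x = - Gt F (softmax \<theta>) \<mu>"
proof -
  define x where "x = matrix_inv (newton_mat F k \<mu> (softmax \<theta>)) *v
      (- (projR (softmax \<theta>) *v (F (softmax \<theta>) - hquot \<mu> (softmax \<theta>))))"
  have e: "newton_mat F k \<mu> (softmax \<theta>) *v x = - Gt F (softmax \<theta>) \<mu>"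
    unfolding x_def matrix_inv_mult[OF inv] by (simp add: projR_mult Gt_pr softmax_pos)
  have "(k + vsum \<mu>) * (softmax \<theta> \<bullet> x) = 0"
    using inner_newton[of "softmax \<theta>" F k \<mu> x] softmax_pos[of \<theta>]
    by (simp add: e inner_Gt pos_def)
  then have "softmax \<theta> \<bullet> x = 0" using k_nz[OF assms(1)] by simp
  with e show ?thesis by (auto simp: corrector_def x_def Let_def)
qed

text \<open>The right-hand side is a relative change of \<mu>, so \<open>M\<close> controls it.
  Together with an inverse bound the predictor then moves by a multiple of \<open>e\<close>.\<close>

lemma predictor_step:
  assumes "(softmax \<theta>, \<mu>) \<in> N" and inv: "invertible (newton_mat F k \<mu> (softmax \<theta>))" and "0 \<le> e"
  shows "\<exists>x. predictor F k e \<mu> \<theta> = \<theta> + x \<and>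
    norm (newton_mat F k \<mu> (softmax \<theta>) *v x) \<le> (1 + norm (1 :: real^'n)) * (M * norm (1 :: real^'n)) * e"
proof -
  let ?\<sigma> = "softmax \<theta>"
  have p: "pos ?\<sigma>" by (rule softmax_pos)
  define x where "x = matrix_inv (newton_mat F k \<mu> ?\<sigma>) *v (projR ?\<sigma> *v hquot (- e *\<^sub>R \<mu>) ?\<sigma>)"
  have "newton_mat F k \<mu> ?\<sigma> *v x = pr ?\<sigma> (hquot (- e *\<^sub>R \<mu>) ?\<sigma>)"
    unfolding x_def matrix_inv_mult[OF inv] by (simp add: projR_mult)
  then have a: "norm (newton_mat F k \<mu> ?\<sigma> *v x) \<le> (1 + norm (1 :: real^'n)) * norm (hquot (- e *\<^sub>R \<mu>) ?\<sigma>)"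
    using norm_pr_le[OF pos_simplex[OF p]] by simp
  have b: "norm (hquot (- e *\<^sub>R \<mu>) ?\<sigma>) \<le> \<bar>M * e\<bar> * norm (1 :: real^'n)"
  proof (rule norm_le_scaled_vec)
    fix i
    have "\<bar>\<mu> $ i\<bar> * e \<le> M * ?\<sigma> $ i * e" by (intro mult_right_mono quot_N[OF assms(1)] assms)
    then show "\<bar>hquot (- e *\<^sub>R \<mu>) ?\<sigma> $ i\<bar> \<le> M * e * \<bar>(1 :: real^'n) $ i\<bar>"
      using p assms(3) by (simp add: hquot_def abs_mult abs_divide divide_le_eq pos_def abs_of_pos mult_ac)
  qed
  have "norm (newton_mat F k \<mu> ?\<sigma> *v x) \<le> (1 + norm (1 :: real^'n)) * (M * norm (1 :: real^'n)) * e"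
    using order_trans[OF a mult_left_mono[OF b]] assms(3) M_nonneg by (simp add: mult_ac)
  then show ?thesis
    by (intro exI[of _ x]) (simp add: predictor_def x_def Let_def)
qed

end

section \<open>Quadratic convergence of the corrector and contraction around bundle points\<close>

context newton_region
begin

text \<open>Up to \<delta> the Taylor estimate applies. Above \<delta> a quadratic bound only
  requires the next residual to be bounded by some \<open>B'\<close>, at the cost of
  \<open>B' / \<delta>\<^sup>2\<close>; such a bound comes either from the new point lying in
  \<open>N\<close> or from a uniformly bounded step length. This is the origin of the three
  alternatives.\<close>

lemma corrector_quadratic:
  "\<exists>C1>0. \<exists>\<delta>>0. \<forall>\<theta> \<mu>. (softmax \<theta>, \<mu>) \<in> N \<longrightarrow>
       (norm (Gt F (softmax \<theta>) \<mu>) \<le> \<delta> \<longrightarrow> invertible (newton_mat F k \<mu> (softmax \<theta>))) \<and>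
       (invertible (newton_mat F k \<mu> (softmax \<theta>)) \<and>
        (norm (Gt F (softmax \<theta>) \<mu>) \<le> \<delta> \<or>
         (softmax (corrector F k \<mu> \<theta>), \<mu>) \<in> N \<or>
         (\<forall>(s, m)\<in>N. invertible (newton_mat F k m s))) \<longrightarrow>
        norm (Gt F (softmax (corrector F k \<mu> \<theta>)) \<mu>) \<le> C1 * (norm (Gt F (softmax \<theta>) \<mu>))\<^sup>2)"
proof -
  obtain \<delta>0 K where K: "\<delta>0 > 0" "K > 0" "\<And>\<sigma> \<mu>. (\<sigma>, \<mu>) \<in> N \<Longrightarrow> norm (G F \<sigma> \<mu>) \<le> \<delta>0 \<Longrightarrow>
      invertible (newton_mat F k \<mu> \<sigma>) \<and> (\<forall>y. norm y \<le> K * norm (newton_mat F k \<mu> \<sigma> *v y))"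
    using inverse_bound by blast
  obtain \<rho> C where T: "\<rho> > 0" "C > 0"
    "\<And>\<theta> \<mu> x. (softmax \<theta>, \<mu>) \<in> N \<Longrightarrow> softmax \<theta> \<bullet> x = 0 \<Longrightarrow> norm x \<le> \<rho> \<Longrightarrow>
      norm (Gt F (softmax (\<theta> + x)) \<mu> - Gt F (softmax \<theta>) \<mu>
      - (newton_mat F k \<mu> (softmax \<theta>) *v x - hprod (Gt F (softmax \<theta>) \<mu>) x)) \<le> C * (norm x)\<^sup>2"
    using taylor by blast
  obtain B where B: "B > 0" "\<And>\<theta> \<mu> x. (softmax \<theta>, \<mu>) \<in> N \<Longrightarrow>
      norm (Gt F (softmax (\<theta> + x)) \<mu>) \<le> B * exp (2 * norm x)"
    using Gt_bound by blast
  \<comment> \<open>When some Newton matrix on \<open>N\<close> is singular the implication is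
    vacuous and \<open>K' = 1\<close> will do.\<close>
  have "\<exists>K'>0. (\<forall>(s, m)\<in>N. invertible (newton_mat F k m s)) \<longrightarrow>
      (\<forall>\<sigma> \<mu> y. (\<sigma>, \<mu>) \<in> N \<longrightarrow> norm y \<le> K' * norm (newton_mat F k \<mu> \<sigma> *v y))"
    using all_invertible_bound zero_less_one by blast
  then obtain K' where K': "K' > 0" "\<And>\<sigma> \<mu> y. \<forall>(s, m)\<in>N. invertible (newton_mat F k m s) \<Longrightarrow>
      (\<sigma>, \<mu>) \<in> N \<Longrightarrow> norm y \<le> K' * norm (newton_mat F k \<mu> \<sigma> *v y)"
    by blast
  define \<delta> where "\<delta> = min \<delta>0 (\<rho> / K)"
  have \<delta>: "0 < \<delta>" "\<delta> \<le> \<delta>0" "\<delta> \<le> \<rho> / K" using K T by (auto simp: \<delta>_def)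
  define B' where "B' = B * exp (2 * (K' * B))"
  have B': "B \<le> B'" "0 < B'" using B(1) K'(1) by (simp_all add: B'_def)
  define C1 where "C1 = (K + C * K\<^sup>2) + B' / \<delta>\<^sup>2"
  have parts: "0 < K + C * K\<^sup>2" "0 < B' / \<delta>\<^sup>2" using K T B' \<delta> by (auto intro: add_pos_nonneg)
  have small: "invertible (newton_mat F k \<mu> \<sigma>) \<and> (\<forall>y. norm y \<le> K * norm (newton_mat F k \<mu> \<sigma> *v y))"
    if "(\<sigma>, \<mu>) \<in> N" "pos \<sigma>" "norm (Gt F \<sigma> \<mu>) \<le> \<delta>" for \<sigma> \<mu>
    by (rule K(3)[OF that(1)]) (use norm_G_le_Gt[OF that(2), of F \<mu>] that(3) \<delta>(2) in linarith)
  have quad: "norm (Gt F (softmax (corrector F k \<mu> \<theta>)) \<mu>) \<le> C1 * (norm (Gt F (softmax \<theta>) \<mu>))\<^sup>2"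
    if N: "(softmax \<theta>, \<mu>) \<in> N" and inv: "invertible (newton_mat F k \<mu> (softmax \<theta>))"
      and cs: "norm (Gt F (softmax \<theta>) \<mu>) \<le> \<delta> \<or> (softmax (corrector F k \<mu> \<theta>), \<mu>) \<in> N \<or>
         (\<forall>(s, m)\<in>N. invertible (newton_mat F k m s))" for \<theta> \<mu>
  proof -
    let ?g = "Gt F (softmax \<theta>) \<mu>"
    obtain x where x: "corrector F k \<mu> \<theta> = \<theta> + x" "softmax \<theta> \<bullet> x = 0"
      "newton_mat F k \<mu> (softmax \<theta>) *v x = - ?g"
      using corrector_step[OF N inv] by blast
    show ?thesis
    proof (cases "norm ?g \<le> \<delta>")
      case True
      have xg: "norm x \<le> K * norm ?g"
        using small[OF N softmax_pos True] x(3) by (metis norm_minus_cancel)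
      also have "\<dots> \<le> K * (\<rho> / K)" using True \<delta>(3) K(2) by (intro mult_left_mono) auto
      finally have "norm x \<le> \<rho>" using K(2) by simp
      \<comment> \<open>The Newton equation cancels the residual. What remains is the product of the
        residual with a step of its own size, and the quadratic remainder.\<close>
      from T(3)[OF N x(2) this]
      have "norm (Gt F (softmax (\<theta> + x)) \<mu> + hprod ?g x) \<le> C * (norm x)\<^sup>2"
        by (simp add: x(3))
      then have "norm (Gt F (softmax (\<theta> + x)) \<mu>) \<le> C * (norm x)\<^sup>2 + norm (hprod ?g x)"
        using norm_triangle_ineq4[of "Gt F (softmax (\<theta> + x)) \<mu> + hprod ?g x" "hprod ?g x"] by simp
      also have "\<dots> \<le> C * (K * norm ?g)\<^sup>2 + norm ?g * (K * norm ?g)"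
        using T(2) xg by (intro add_mono mult_left_mono power_mono order_trans[OF norm_hprod_le]) auto
      also have "\<dots> = (K + C * K\<^sup>2) * (norm ?g)\<^sup>2" by (simp add: algebra_simps power2_eq_square)
      also have "\<dots> \<le> C1 * (norm ?g)\<^sup>2"
        using parts by (intro mult_right_mono) (auto simp: C1_def)
      finally show ?thesis by (simp add: x(1))
    next
      case False
      have "norm (Gt F (softmax (\<theta> + x)) \<mu>) \<le> B'"
      proof (cases "(softmax (\<theta> + x), \<mu>) \<in> N")
        case True
        then show ?thesis using B(2)[OF True, of 0] B' by simp
      next
        case False
        then have "norm x \<le> K' * norm ?g"
          using cs \<open>\<not> norm ?g \<le> \<delta>\<close> K'(2)[OF _ N, of x] x(1,3) by auto
        also have "\<dots> \<le> K' * B" using B(2)[OF N, of 0] K'(1) by (intro mult_left_mono) auto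
        finally have "B * exp (2 * norm x) \<le> B'" using B(1) by (simp add: B'_def)
        with B(2)[OF N, of x] show ?thesis by linarith
      qed
      also have "B' = B' / \<delta>\<^sup>2 * \<delta>\<^sup>2" using \<delta>(1) by simp
      also have "\<dots> \<le> C1 * (norm ?g)\<^sup>2"
        using parts \<delta>(1) False by (intro mult_mono power_mono) (auto simp: C1_def)
      finally show ?thesis by (simp add: x(1))
    qed
  qed
  have "0 < C1" using parts by (simp add: C1_def)
  show ?thesis
  proof (rule exI[of _ C1], rule conjI[OF \<open>0 < C1\<close>], rule exI[of _ \<delta>], rule conjI[OF \<delta>(1)], intro allI impI conjI)
    fix \<theta> \<mu> assume "(softmax \<theta>, \<mu>) \<in> N" "norm (Gt F (softmax \<theta>) \<mu>) \<le> \<delta>"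
    then show "invertible (newton_mat F k \<mu> (softmax \<theta>))" using small softmax_pos by blast
  qed (use quad in blast)
qed

text \<open>Abstracts from the path: a bundle point together with its full ball of radius
  \<open>d\<close> in log-coordinates inside \<open>N\<close>. Shift invariance of
  \<open>softmax\<close> extends this to balls in the deviation.\<close>

definition good :: "real^'n \<Rightarrow> real^'n \<Rightarrow> bool" where
  "good \<sigma> \<mu> \<longleftrightarrow> pos \<sigma> \<and> G F \<sigma> \<mu> = 0 \<and> (\<forall>\<theta>. norm (\<theta> - hln \<sigma>) \<le> d \<longrightarrow> (softmax \<theta>, \<mu>) \<in> N)"

lemma good_mem: "good \<sigma> \<mu> \<Longrightarrow> (\<sigma>, \<mu>) \<in> N"
  using d_pos softmax_hln[of \<sigma>] unfolding good_def by (metis diff_self less_imp_le norm_zero)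

lemma good_Gt: "good \<sigma> \<mu> \<Longrightarrow> Gt F \<sigma> \<mu> = 0"
  by (simp add: good_def Gt_def hquot_def vec_eq_iff)

lemma good_dev_mem: "good \<sigma> \<mu> \<Longrightarrow> norm (dev \<sigma> \<theta>) \<le> d \<Longrightarrow> (softmax \<theta>, \<mu>) \<in> N"
  by (subst softmax_dev[of _ \<sigma>]) (simp add: good_def)

lemma dev_add: "dev \<sigma> (\<theta> + x) = dev \<sigma> \<theta> + pr \<sigma> x"
  by (simp add: dev_def pr_add pr_diff)

text \<open>The deviation is comparable to the residual, hence a quadratic decrease of the residual
  is a contraction of the deviation, and a ball around a bundle point is never left.\<close>

lemma basin_step:
  "\<exists>r0>0. \<exists>C1>0. \<exists>C2>0. \<exists>L>0. \<exists>Kp>0. \<forall>\<sigma> \<mu> \<theta>. good \<sigma> \<mu> \<and> norm (dev \<sigma> \<theta>) \<le> r0 \<longrightarrow>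
     (softmax \<theta>, \<mu>) \<in> N \<and> invertible (newton_mat F k \<mu> (softmax \<theta>)) \<and>
     norm (dev \<sigma> (corrector F k \<mu> \<theta>)) \<le> norm (dev \<sigma> \<theta>) / 2 \<and>
     norm (Gt F (softmax (corrector F k \<mu> \<theta>)) \<mu>) \<le> C1 * (norm (Gt F (softmax \<theta>) \<mu>))\<^sup>2 \<and>
     norm (dev \<sigma> \<theta>) \<le> C2 * norm (Gt F (softmax \<theta>) \<mu>) \<and>
     norm (Gt F (softmax \<theta>) \<mu>) \<le> L * norm (dev \<sigma> \<theta>) \<and>
     (\<forall>e\<ge>0. norm (dev \<sigma> (predictor F k e \<mu> \<theta>)) \<le> norm (dev \<sigma> \<theta>) + Kp * e)"
proof -
  obtain \<delta>0 K where K: "\<delta>0 > 0" "K > 0" "\<And>\<sigma> \<mu>. (\<sigma>, \<mu>) \<in> N \<Longrightarrow> norm (G F \<sigma> \<mu>) \<le> \<delta>0 \<Longrightarrow>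
      invertible (newton_mat F k \<mu> \<sigma>) \<and> (\<forall>y. norm y \<le> K * norm (newton_mat F k \<mu> \<sigma> *v y))"
    using inverse_bound by blast
  obtain \<rho> C where T: "\<rho> > 0" "C > 0"
    "\<And>\<theta> \<mu> x. (softmax \<theta>, \<mu>) \<in> N \<Longrightarrow> softmax \<theta> \<bullet> x = 0 \<Longrightarrow> norm x \<le> \<rho> \<Longrightarrow>
      norm (Gt F (softmax (\<theta> + x)) \<mu> - Gt F (softmax \<theta>) \<mu>
      - (newton_mat F k \<mu> (softmax \<theta>) *v x - hprod (Gt F (softmax \<theta>) \<mu>) x)) \<le> C * (norm x)\<^sup>2"
    using taylor by blast
  obtain L0 where L0: "L0 > 0"
    "\<And>\<sigma> \<mu> y. (\<sigma>, \<mu>) \<in> N \<Longrightarrow> norm (newton_mat F k \<mu> \<sigma> *v y) \<le> L0 * norm y"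
    using newton_upper by blast
  obtain C1 \<delta>1 where C1: "C1 > 0" "\<delta>1 > 0" "\<And>\<theta> \<mu>. (softmax \<theta>, \<mu>) \<in> N \<Longrightarrow>
      norm (Gt F (softmax \<theta>) \<mu>) \<le> \<delta>1 \<Longrightarrow> invertible (newton_mat F k \<mu> (softmax \<theta>)) \<and>
      norm (Gt F (softmax (corrector F k \<mu> \<theta>)) \<mu>) \<le> C1 * (norm (Gt F (softmax \<theta>) \<mu>))\<^sup>2"
    using corrector_quadratic by meson
  let ?n = "1 + norm (1 :: real^'n)"
  have n: "0 < ?n" by (simp add: add_pos_nonneg)
  \<comment> \<open>The last entry gives \<open>K * C * \<rho>2 \<le> 1 / 2\<close>, so the Taylor
    remainder absorbs at most half of the deviation, which explains the factor \<open>2 * K\<close>;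
    \<open>d\<close> keeps the ball inside \<open>N\<close>.\<close>
  define \<rho>2 where "\<rho>2 = min (min \<rho> d) (1 / (2 * K * C))"
  have \<rho>2: "0 < \<rho>2" "\<rho>2 \<le> \<rho>" "\<rho>2 \<le> d" "\<rho>2 \<le> 1 / (2 * K * C)"
    using T K d_pos by (auto simp: \<rho>2_def)
  define L where "L = L0 + C * \<rho>2"
  have L: "0 < L" using L0 T \<rho>2 by (simp add: L_def add_pos_pos)
  have equiv: "(softmax \<theta>, \<mu>) \<in> N" "norm (dev \<sigma> \<theta>) \<le> (2 * K) * norm (Gt F (softmax \<theta>) \<mu>)"
    "norm (Gt F (softmax \<theta>) \<mu>) \<le> L * norm (dev \<sigma> \<theta>)"
    if g: "good \<sigma> \<mu>" and r: "norm (dev \<sigma> \<theta>) \<le> \<rho>2" for \<sigma> \<mu> \<theta>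
  proof -
    let ?x = "dev \<sigma> \<theta>" and ?g = "Gt F (softmax \<theta>) \<mu>"
    have p: "pos \<sigma>" using g by (simp add: good_def)
    show "(softmax \<theta>, \<mu>) \<in> N" using good_dev_mem[OF g] r \<rho>2(3) by simp
    have N: "(softmax (hln \<sigma>), \<mu>) \<in> N" by (simp add: softmax_hln p good_mem g)
    \<comment> \<open>The expansion is taken at \<sigma> itself. There the residual vanishes and
      with it the \<open>hprod\<close> term, so the residual at \<theta> is the Newton matrix
      applied to the deviation, up to second order.\<close>
    have "norm (?g - newton_mat F k \<mu> \<sigma> *v ?x) \<le> C * (norm ?x)\<^sup>2"
      using T(3)[OF N, of ?x] r \<rho>2(2) p inner_dev[of \<sigma> \<theta>]
      by (simp add: softmax_hln good_Gt[OF g] pos_def flip: softmax_dev)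
        (simp add: hprod_def zero_vec_def[symmetric])
    moreover have "C * (norm ?x)\<^sup>2 \<le> C * \<rho>2 * norm ?x"
      using r T(2) by (simp add: power2_eq_square mult_right_mono)
    ultimately have e: "norm (?g - newton_mat F k \<mu> \<sigma> *v ?x) \<le> C * \<rho>2 * norm ?x" by linarith
    have "norm ?g \<le> C * \<rho>2 * norm ?x + L0 * norm ?x"
      using norm_triangle_sub[of ?g "newton_mat F k \<mu> \<sigma> *v ?x"] e L0(2)[OF good_mem[OF g], of ?x] by linarith
    then show "norm ?g \<le> L * norm ?x" by (simp add: L_def algebra_simps)
    have "norm ?x \<le> K * norm (newton_mat F k \<mu> \<sigma> *v ?x)"
      using K(1) K(3)[OF good_mem[OF g]] g by (simp add: good_def)
    also have "\<dots> \<le> K * (norm ?g + C * \<rho>2 * norm ?x)"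
      using norm_triangle_sub[of "newton_mat F k \<mu> \<sigma> *v ?x" ?g] e K(2)
      by (intro mult_left_mono) (auto simp: norm_minus_commute)
    also have "\<dots> = K * norm ?g + (K * C * \<rho>2) * norm ?x" by (simp add: algebra_simps)
    also have "K * C * \<rho>2 \<le> 1 / 2"
      using mult_left_mono[OF \<rho>2(4), of "K * C"] K T by (simp add: field_simps)
    finally show "norm ?x \<le> (2 * K) * norm ?g"
      by (simp add: mult_right_mono)
  qed
  define c0 where "c0 = ?n * (M * norm (1 :: real^'n))"
  \<comment> \<open>The summand 1 keeps \<open>Kp\<close> positive even if
    \<open>M = 0\<close>.\<close>
  define Kp where "Kp = ?n * K * c0 + 1"
  have c0: "0 \<le> c0" using M_nonneg n by (simp add: c0_def)
  have Kp: "0 < Kp" using c0 K n by (simp add: Kp_def add_nonneg_pos)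
  \<comment> \<open>\<open>\<rho>2 / (1 + ?n * K * L)\<close> keeps the corrector image in the ball
    where deviation and residual are comparable; \<open>\<delta>0 / L\<close> and
    \<open>\<delta>1 / L\<close> make the residual small enough for the inverse bound and the
    quadratic estimate; the last entry turns the quadratic bound into a halving.\<close>
  define r0 where "r0 = min (min \<rho>2 (\<rho>2 / (1 + ?n * K * L))) (min (min (\<delta>0 / L) (\<delta>1 / L)) (1 / (4 * K * C1 * L\<^sup>2)))"
  have q: "0 < 1 + ?n * K * L" using n K L by (simp add: add_pos_pos)
  have r0: "0 < r0" "r0 \<le> \<rho>2" "r0 * (1 + ?n * K * L) \<le> \<rho>2" "L * r0 \<le> \<delta>0" "L * r0 \<le> \<delta>1"
    "4 * K * C1 * L\<^sup>2 * r0 \<le> 1"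
  proof -
    show "0 < r0" using \<rho>2 q K C1 L by (simp add: r0_def)
    show "r0 \<le> \<rho>2" by (simp add: r0_def)
    have "r0 \<le> \<rho>2 / (1 + ?n * K * L)" by (simp add: r0_def)
    then show "r0 * (1 + ?n * K * L) \<le> \<rho>2" by (simp only: pos_le_divide_eq[OF q])
    have "r0 \<le> \<delta>0 / L" "r0 \<le> \<delta>1 / L" by (simp_all add: r0_def)
    then show "L * r0 \<le> \<delta>0" "L * r0 \<le> \<delta>1" using L by (simp_all add: pos_le_divide_eq mult.commute)
    have "0 < 4 * K * C1 * L\<^sup>2" using K C1 L by simp
    moreover have "r0 \<le> 1 / (4 * K * C1 * L\<^sup>2)" by (simp add: r0_def)
    ultimately show "4 * K * C1 * L\<^sup>2 * r0 \<le> 1" by (simp add: pos_le_divide_eq mult.commute)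
  qed
  have *: "(softmax \<theta>, \<mu>) \<in> N \<and> invertible (newton_mat F k \<mu> (softmax \<theta>)) \<and>
     norm (dev \<sigma> (corrector F k \<mu> \<theta>)) \<le> norm (dev \<sigma> \<theta>) / 2 \<and>
     norm (Gt F (softmax (corrector F k \<mu> \<theta>)) \<mu>) \<le> C1 * (norm (Gt F (softmax \<theta>) \<mu>))\<^sup>2 \<and>
     norm (dev \<sigma> \<theta>) \<le> (2 * K) * norm (Gt F (softmax \<theta>) \<mu>) \<and>
     norm (Gt F (softmax \<theta>) \<mu>) \<le> L * norm (dev \<sigma> \<theta>) \<and>
     (\<forall>e\<ge>0. norm (dev \<sigma> (predictor F k e \<mu> \<theta>)) \<le> norm (dev \<sigma> \<theta>) + Kp * e)"
    if g: "good \<sigma> \<mu>" and r: "norm (dev \<sigma> \<theta>) \<le> r0" for \<sigma> \<mu> \<theta>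
  proof -
    let ?g = "Gt F (softmax \<theta>) \<mu>" and ?x = "dev \<sigma> \<theta>"
    have s: "\<sigma> \<in> std_simplex" using g by (simp add: good_def pos_simplex)
    note eq = equiv[OF g order_trans[OF r r0(2)]]
    have gx: "norm ?g \<le> L * r0" using eq(3) mult_left_mono[OF r, of L] L by linarith
    have inv: "invertible (newton_mat F k \<mu> (softmax \<theta>))" "\<And>y. norm y \<le> K * norm (newton_mat F k \<mu> (softmax \<theta>) *v y)"
      using K(3)[OF eq(1)] norm_G_le_Gt[OF softmax_pos, of F \<theta> \<mu>] gx r0(4) by auto
    have quad: "norm (Gt F (softmax (corrector F k \<mu> \<theta>)) \<mu>) \<le> C1 * (norm ?g)\<^sup>2"
      using C1(3)[OF eq(1)] gx r0(5) by auto
    obtain x where x: "corrector F k \<mu> \<theta> = \<theta> + x" "newton_mat F k \<mu> (softmax \<theta>) *v x = - ?g"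
      using corrector_step[OF eq(1) inv(1)] by blast
    have xn: "norm x \<le> K * norm ?g" using inv(2)[of x] x(2) by simp
    have "norm (dev \<sigma> (corrector F k \<mu> \<theta>)) \<le> norm ?x + ?n * norm x"
      using norm_triangle_ineq[of ?x "pr \<sigma> x"] norm_pr_le[OF s, of x] by (simp add: x(1) dev_add)
    also have "\<dots> \<le> r0 + ?n * (K * (L * r0))"
      using n K gx by (intro add_mono r mult_left_mono order_trans[OF xn]) auto
    also have "\<dots> = r0 * (1 + ?n * K * L)" by (simp add: algebra_simps)
    finally have "norm (dev \<sigma> (corrector F k \<mu> \<theta>)) \<le> \<rho>2" using r0(3) by linarith
    from equiv(2)[OF g this]
    have "norm (dev \<sigma> (corrector F k \<mu> \<theta>)) \<le> (2 * K) * (C1 * (norm ?g)\<^sup>2)"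
      using mult_left_mono[OF quad, of "2 * K"] K by linarith
    also have "\<dots> \<le> (2 * K) * (C1 * ((L * norm ?x) * (L * r0)))"
      unfolding power2_eq_square using K C1 L eq(3) gx r0(1) by (intro mult_left_mono mult_mono) auto
    also have "\<dots> = (4 * K * C1 * L\<^sup>2 * r0) * (norm ?x / 2)" by (simp add: power2_eq_square)
    also have "\<dots> \<le> 1 * (norm ?x / 2)" using r0(6) by (intro mult_right_mono) auto
    finally have half: "norm (dev \<sigma> (corrector F k \<mu> \<theta>)) \<le> norm ?x / 2" by simp
    have "norm (dev \<sigma> (predictor F k e \<mu> \<theta>)) \<le> norm ?x + Kp * e" if e: "0 \<le> e" for e
    proof -
      obtain z where z: "predictor F k e \<mu> \<theta> = \<theta> + z" "norm (newton_mat F k \<mu> (softmax \<theta>) *v z) \<le> c0 * e"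
        using predictor_step[OF eq(1) inv(1) e] unfolding c0_def by blast
      have "norm (dev \<sigma> (predictor F k e \<mu> \<theta>)) \<le> norm ?x + ?n * norm z"
        using norm_triangle_ineq[of ?x "pr \<sigma> z"] norm_pr_le[OF s, of z] by (simp add: z(1) dev_add)
      also have "\<dots> \<le> norm ?x + ?n * (K * (c0 * e))"
        using n K(2) order_trans[OF inv(2)[of z] mult_left_mono[OF z(2), of K]]
        by (intro add_left_mono mult_left_mono) auto
      also have "\<dots> \<le> norm ?x + Kp * e" using e by (simp add: Kp_def algebra_simps)
      finally show ?thesis .
    qed
    with eq inv(1) quad half show ?thesis by blast
  qed
  have main: "\<forall>\<sigma> \<mu> \<theta>. good \<sigma> \<mu> \<and> norm (dev \<sigma> \<theta>) \<le> r0 \<longrightarrow>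
     (softmax \<theta>, \<mu>) \<in> N \<and> invertible (newton_mat F k \<mu> (softmax \<theta>)) \<and>
     norm (dev \<sigma> (corrector F k \<mu> \<theta>)) \<le> norm (dev \<sigma> \<theta>) / 2 \<and>
     norm (Gt F (softmax (corrector F k \<mu> \<theta>)) \<mu>) \<le> C1 * (norm (Gt F (softmax \<theta>) \<mu>))\<^sup>2 \<and>
     norm (dev \<sigma> \<theta>) \<le> (2 * K) * norm (Gt F (softmax \<theta>) \<mu>) \<and>
     norm (Gt F (softmax \<theta>) \<mu>) \<le> L * norm (dev \<sigma> \<theta>) \<and>
     (\<forall>e\<ge>0. norm (dev \<sigma> (predictor F k e \<mu> \<theta>)) \<le> norm (dev \<sigma> \<theta>) + Kp * e)"
    by (intro allI impI, elim conjE, rule *)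
  have "0 < 2 * K" using K by simp
  show ?thesis
    by (rule exI[of _ r0], rule conjI[OF r0(1)], rule exI[of _ C1], rule conjI[OF C1(1)],
        rule exI[of _ "2 * K"], rule conjI[OF \<open>0 < 2 * K\<close>], rule exI[of _ L], rule conjI[OF L],
        rule exI[of _ Kp], rule conjI[OF Kp]) (rule main)
qed

end

text \<open>Fixes one set of constants as provided by \<open>basin_step\<close>. \<open>Cv\<close>
  converts a relative change of the level into a deviation: the change alters the residual by at
  most \<open>(1 + norm 1) * (M * norm 1)\<close> times its size, and \<open>C2\<close> passes from
  residual to deviation.\<close>

locale newton_basin = newton_region F k M d N
  for F :: "real^'n \<Rightarrow> real^'n" and k M d :: real and N +
  fixes r0 C1 C2 L Kp Cv :: real
  assumes radii_pos: "0 < r0" "0 < C1" "0 < C2" "0 < L" "0 < Kp"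
    and Cv_def: "Cv = C2 * ((1 + norm (1 :: real^'n)) * (M * norm (1 :: real^'n)))"
    and basin: "good \<sigma> \<mu> \<Longrightarrow> norm (dev \<sigma> \<theta>) \<le> r0 \<Longrightarrow>
     (softmax \<theta>, \<mu>) \<in> N \<and> invertible (newton_mat F k \<mu> (softmax \<theta>)) \<and>
     norm (dev \<sigma> (corrector F k \<mu> \<theta>)) \<le> norm (dev \<sigma> \<theta>) / 2 \<and>
     norm (Gt F (softmax (corrector F k \<mu> \<theta>)) \<mu>) \<le> C1 * (norm (Gt F (softmax \<theta>) \<mu>))\<^sup>2 \<and>
     norm (dev \<sigma> \<theta>) \<le> C2 * norm (Gt F (softmax \<theta>) \<mu>) \<and>
     norm (Gt F (softmax \<theta>) \<mu>) \<le> L * norm (dev \<sigma> \<theta>) \<and>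
     (\<forall>e\<ge>0. norm (dev \<sigma> (predictor F k e \<mu> \<theta>)) \<le> norm (dev \<sigma> \<theta>) + Kp * e)"
begin

lemma basin_iterate:
  assumes g: "good \<sigma> \<mu>" and r: "norm (dev \<sigma> \<theta>) \<le> r0"
  shows "norm (dev \<sigma> ((corrector F k \<mu> ^^ j) \<theta>)) \<le> norm (dev \<sigma> \<theta>) / 2 ^ j" (is "?A j")
    and "norm (dev \<sigma> ((corrector F k \<mu> ^^ j) \<theta>)) \<le> r0"
proof -
  have le: "norm (dev \<sigma> \<theta>) / 2 ^ i \<le> r0" for i
    using divide_left_mono[of 1 "2 ^ i :: real" "norm (dev \<sigma> \<theta>)"] r by simp
  show A: "?A j" for j
  proof (induction j)
    case (Suc j)
    have "norm (dev \<sigma> ((corrector F k \<mu> ^^ Suc j) \<theta>)) \<le> norm (dev \<sigma> ((corrector F k \<mu> ^^ j) \<theta>)) / 2"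
      using basin[OF g order_trans[OF Suc le]] by simp
    with Suc show ?case by simp
  qed simp
  show "norm (dev \<sigma> ((corrector F k \<mu> ^^ j) \<theta>)) \<le> r0" using order_trans[OF A le] .
qed

lemma basin_Gt_iterate:
  assumes g: "good \<sigma> \<mu>" and r: "norm (dev \<sigma> \<theta>) \<le> r0"
  shows "norm (Gt F (softmax ((corrector F k \<mu> ^^ j) \<theta>)) \<mu>) \<le> L * r0 * (1 / 2) ^ j"
proof -
  have "norm (Gt F (softmax ((corrector F k \<mu> ^^ j) \<theta>)) \<mu>) \<le> L * norm (dev \<sigma> ((corrector F k \<mu> ^^ j) \<theta>))"
    using basin[OF g basin_iterate(2)[OF g r]] by blast
  also have "\<dots> \<le> L * (norm (dev \<sigma> \<theta>) / 2 ^ j)"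
    using radii_pos by (intro mult_left_mono basin_iterate(1)[OF g r]) auto
  also have "\<dots> \<le> L * (r0 / 2 ^ j)"
    using radii_pos r by (intro mult_left_mono divide_right_mono) auto
  finally show ?thesis by (simp add: power_divide)
qed

lemma basin_conv_region:
  assumes g: "good \<sigma> \<mu>" and r: "norm (dev \<sigma> \<theta>) \<le> r0"
  shows "softmax \<theta> \<in> conv_region F k N \<mu>"
proof -
  note b = basin[OF g basin_iterate(2)[OF g r]]
  have "(\<lambda>j. L * r0 * (1 / 2) ^ j) \<longlonglongrightarrow> L * r0 * 0"
    by (intro tendsto_intros LIMSEQ_power_zero) simp
  then have "(\<lambda>j. Gt F (softmax ((corrector F k \<mu> ^^ j) \<theta>)) \<mu>) \<longlonglongrightarrow> 0"
    by (intro Lim_null_comparison[OF always_eventually[OF allI[OF basin_Gt_iterate[OF g r]]]]) simp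
  moreover have "norm (Gt F (softmax ((corrector F k \<mu> ^^ Suc j) \<theta>)) \<mu>)
      \<le> C1 * (norm (Gt F (softmax ((corrector F k \<mu> ^^ j) \<theta>)) \<mu>))\<^sup>2" for j
    using b[of j] by simp
  ultimately show ?thesis
    unfolding conv_region_def Let_def using b by blast
qed

text \<open>\<open>corrects_to\<close> leaves the number of corrector steps open. The second claim
  holds for any such number because the ball is invariant, and inside it the deviation is at most
  \<open>C2\<close> times the residual.\<close>

lemma basin_corrects_to:
  assumes g: "good \<sigma> \<mu>" and r: "norm (dev \<sigma> \<theta>) \<le> r0"
  shows "0 < \<epsilon> \<Longrightarrow> \<exists>\<theta>'. corrects_to F k \<mu> \<epsilon> \<theta> \<theta>'"
    and "corrects_to F k \<mu> \<epsilon> \<theta> \<theta>' \<Longrightarrow> norm (dev \<sigma> \<theta>') \<le> r0 \<and> norm (dev \<sigma> \<theta>') \<le> C2 * \<epsilon>"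
proof -
  note b = basin[OF g basin_iterate(2)[OF g r]]
  {
    assume e: "0 < \<epsilon>"
    obtain m where "(1 / 2) ^ m < \<epsilon> / (L * r0)"
      using real_arch_pow_inv[of "\<epsilon> / (L * r0)" "1/2"] e radii_pos by auto
    then have "L * r0 * (1 / 2) ^ m \<le> \<epsilon>" using radii_pos by (simp add: pos_less_divide_eq mult.commute less_imp_le)
    then have "norm (Gt F (softmax ((corrector F k \<mu> ^^ m) \<theta>)) \<mu>) \<le> \<epsilon>"
      using basin_Gt_iterate[OF g r, of m] by linarith
    then show "\<exists>\<theta>'. corrects_to F k \<mu> \<epsilon> \<theta> \<theta>'"
      unfolding corrects_to_def using b by blast
  }
  assume "corrects_to F k \<mu> \<epsilon> \<theta> \<theta>'"
  then obtain m where m: "\<theta>' = (corrector F k \<mu> ^^ m) \<theta>" "norm (Gt F (softmax \<theta>') \<mu>) \<le> \<epsilon>"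
    unfolding corrects_to_def by blast
  show "norm (dev \<sigma> \<theta>') \<le> r0 \<and> norm (dev \<sigma> \<theta>') \<le> C2 * \<epsilon>"
  proof
    show "norm (dev \<sigma> \<theta>') \<le> r0" using basin_iterate(2)[OF g r, of m] m by simp
    have "norm (dev \<sigma> \<theta>') \<le> C2 * norm (Gt F (softmax \<theta>') \<mu>)" using b[of m] m by simp
    also have "\<dots> \<le> C2 * \<epsilon>" using m(2) radii_pos by (intro mult_left_mono) auto
    finally show "norm (dev \<sigma> \<theta>') \<le> C2 * \<epsilon>" .
  qed
qed

end

section \<open>Log-coordinates near the bundle\<close>

lemma continuous_softmax: "continuous_on S softmax"
proof -
  have "(\<Sum>j\<in>UNIV. exp (\<theta> $ j)) \<noteq> 0" for \<theta> :: "real^'n"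
    by (rule less_imp_neq[symmetric]) (simp add: sum_pos)
  then show ?thesis unfolding softmax_def by (intro continuous_intros) auto
qed

lemma continuous_hln:
  assumes "continuous_on S c" "\<And>t. t \<in> S \<Longrightarrow> pos (c t)"
  shows "continuous_on S (\<lambda>t. hln (c t))"
  unfolding hln_def using assms by (intro continuous_intros) (auto simp: pos_nth_neq)

text \<open>On the bundle \<mu>/\<sigma> is \<open>F \<sigma>\<close> up to a multiple of the
  all-ones vector; this is the source of the quotient bound \<open>M\<close>.\<close>

lemma bundle_quot:
  assumes "(\<sigma>, \<mu>) \<in> fp_bundle F"
  shows "\<mu> $ i = \<sigma> $ i * (F \<sigma> $ i - (\<sigma> \<bullet> F \<sigma> - vsum \<mu>))"
  using assms by (simp add: fp_bundle_def G_eq vec_eq_iff hprod_def algebra_simps)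

text \<open>Carries the bound on \<mu>/\<sigma> from the path to the ball of radius \<open>d\<close>
  in log-coordinates, at the cost of \<open>exp (2 * d)\<close>.\<close>

lemma softmax_near_ge:
  assumes "pos \<sigma>" "norm (\<theta> - hln \<sigma>) \<le> d"
  shows "\<sigma> $ i \<le> exp (2 * d) * softmax \<theta> $ i"
proof -
  have "\<sigma> $ i * exp (- 2 * norm (\<theta> - hln \<sigma>)) \<le> softmax \<theta> $ i"
    using softmax_ratio_ge[of "hln \<sigma>" i "\<theta> - hln \<sigma>"] by (simp add: softmax_hln assms(1))
  moreover have "\<sigma> $ i * exp (- 2 * d) \<le> \<sigma> $ i * exp (- 2 * norm (\<theta> - hln \<sigma>))"
    using assms by (intro mult_left_mono) (auto simp: pos_def less_imp_le)
  ultimately have "\<sigma> $ i * exp (- 2 * d) \<le> softmax \<theta> $ i" by linarith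
  then show ?thesis by (simp add: exp_minus field_simps)
qed

lemma dev_eq_0: "pos \<sigma> \<Longrightarrow> softmax \<theta> = \<sigma> \<Longrightarrow> dev \<sigma> \<theta> = 0"
proof -
  assume p: "pos \<sigma>" and e: "softmax \<theta> = \<sigma>"
  obtain c where "\<theta> = hln \<sigma> + c *\<^sub>R 1" using hln_softmax[of \<theta>] e by blast
  then have "\<theta> - hln \<sigma> = c *\<^sub>R 1" by (metis add_diff_cancel_left')
  then show ?thesis using p by (simp add: dev_def pr_scaleR pr_one pos_def)
qed

text \<open>Returns from deviations to distances of \<sigma>. The reweighting factors differ from 1
  by at most \<open>3 * norm (dev \<sigma> \<theta>)\<close>, so the constant does not depend on
  \<sigma>.\<close>

lemma softmax_lipschitz:
  assumes p: "pos \<sigma>" and r: "norm (dev \<sigma> \<theta>) \<le> 1 / 2"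
  shows "norm (softmax \<theta> - \<sigma>) \<le> 3 * norm (dev \<sigma> \<theta>)"
proof -
  let ?x = "dev \<sigma> \<theta>"
  have s: "softmax (hln \<sigma>) = \<sigma>" by (rule softmax_hln[OF p])
  have x0: "softmax (hln \<sigma>) \<bullet> ?x = 0" using p by (simp add: s inner_dev pos_def)
  note t = softmax_taylor[OF x0 r, unfolded softmax_dev[of \<theta> \<sigma>, symmetric] s]
  have sq: "(norm ?x)\<^sup>2 \<le> 1 / 2 * norm ?x"
    unfolding power2_eq_square using r by (intro mult_right_mono) auto
  have "norm (softmax \<theta> - \<sigma>) \<le> \<bar>3 * norm ?x\<bar> * norm \<sigma>"
  proof (rule norm_le_scaled_vec)
    fix i
    let ?u = "exp (?x $ i) / (\<Sum>j\<in>UNIV. \<sigma> $ j * exp (?x $ j))"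
    have "\<bar>?u - 1\<bar> \<le> 3 * norm ?x"
      using t(3)[of i] sq component_le_norm_cart[of ?x i] norm_ge_zero[of ?x] by linarith
    then have "\<bar>\<sigma> $ i\<bar> * \<bar>?u - 1\<bar> \<le> \<bar>\<sigma> $ i\<bar> * (3 * norm ?x)" by (intro mult_left_mono) auto
    moreover have "(softmax \<theta> - \<sigma>) $ i = \<sigma> $ i * (?u - 1)"
      using t(1)[of i] by (simp add: algebra_simps)
    ultimately show "\<bar>(softmax \<theta> - \<sigma>) $ i\<bar> \<le> 3 * norm ?x * \<bar>\<sigma> $ i\<bar>"
      by (simp add: abs_mult mult.commute)
  qed
  also have "\<dots> \<le> 3 * norm ?x"
    using mult_left_mono[OF simplex_norm[OF pos_simplex[OF p]], of "3 * norm ?x"] by simp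
  finally show ?thesis .
qed

section \<open>Paths\<close>

locale path_data =
  fixes F :: "real^'n \<Rightarrow> real^'n" and \<sigma>init :: "real^'n" and vinit :: real and P :: "'n fp_path"
  assumes path: "is_path F \<sigma>init vinit P"
begin

definition on_path :: "nat \<Rightarrow> real \<Rightarrow> bool" where
  "on_path i g \<longleftrightarrow> i \<in> {1..seg_num P} \<and> seg_gam P i \<le> g \<and> g \<le> 1"

lemma seg:
  assumes "i \<in> {1..seg_num P}"
  shows "0 < seg_mu P i $ j" "0 \<le> seg_gam P i" "seg_gam P i \<le> 1"
    "i < seg_num P \<Longrightarrow> 0 < seg_gam P i" "continuous_on {seg_gam P i..1} (seg_curve P i)"
    "seg_curve P i 1 = seg_sig P (i - 1)" "seg_curve P i (seg_gam P i) = seg_sig P i"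
    "g \<in> {seg_gam P i..1} \<Longrightarrow> (seg_curve P i g, g *\<^sub>R seg_mu P i) \<in> fp_bundle F"
  using path assms unfolding is_path_def by blast+

lemma seg_num_pos: "1 \<le> seg_num P" using path by (simp add: is_path_def)

lemma vsum_mu_pos: "i \<in> {1..seg_num P} \<Longrightarrow> 0 < vsum (seg_mu P i)"
  unfolding vsum_def by (intro sum_pos) (auto simp: seg(1))

lemma gam_last: "seg_gam P (seg_num P) = 0"
proof -
  have "seg_gam P (seg_num P) * vsum (seg_mu P (seg_num P)) = 0" using path unfolding is_path_def by blast
  then show ?thesis using vsum_mu_pos[of "seg_num P"] seg_num_pos by auto
qed

lemma on_path_bundle: "on_path i g \<Longrightarrow> (seg_curve P i g, g *\<^sub>R seg_mu P i) \<in> fp_bundle F"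
  by (rule seg(8)) (auto simp: on_path_def)

lemma on_path_simplex: "on_path i g \<Longrightarrow> seg_curve P i g \<in> std_simplex"
  using on_path_bundle by (auto simp: fp_bundle_def)

lemma on_path_nonneg: "on_path i g \<Longrightarrow> 0 \<le> g"
  using seg(2)[of i] by (auto simp: on_path_def)

lemma path_set_iff: "(\<sigma>, \<mu>) \<in> path_set P \<longleftrightarrow>
    (\<exists>i g. on_path i g \<and> \<sigma> = seg_curve P i g \<and> \<mu> = g *\<^sub>R seg_mu P i)"
proof -
  have "on_path i g \<longleftrightarrow> i \<in> {1..seg_num P} \<and> g \<in> {seg_gam P i..1}" for i g
    by (auto simp: on_path_def)
  then show ?thesis
    unfolding path_set_def path_point_def by (simp add: Bex_def del: atLeastAtMost_iff)
qed

text \<open>By \<open>bundle_quot\<close> a vanishing entry of \<sigma> would make the same entry of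
  \<mu> vanish; the path can meet the boundary of the simplex only at \<open>g = 0\<close>.\<close>

lemma on_path_pos:
  assumes o: "on_path i g" and g: "0 < g"
  shows "pos (seg_curve P i g)"
proof -
  have "0 < seg_curve P i g $ j" for j
  proof -
    have "0 < (g *\<^sub>R seg_mu P i) $ j" using o g seg(1)[of i j] by (simp add: on_path_def)
    then have "seg_curve P i g $ j \<noteq> 0"
      using bundle_quot[OF on_path_bundle[OF o], of j] by auto
    then show ?thesis using on_path_simplex[OF o] by (simp add: std_simplex_def less_le)
  qed
  then show ?thesis using simplex_vsum[OF on_path_simplex[OF o]] by (simp add: pos_def)
qed

lemma mu_bounds: "\<exists>V>0. \<forall>i\<in>{1..seg_num P}. vsum (seg_mu P i) \<le> V \<and> norm (seg_mu P i) \<le> V"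
proof -
  define V where "V = (\<Sum>i\<in>{1..seg_num P}. vsum (seg_mu P i) + norm (seg_mu P i))"
  have a: "vsum (seg_mu P i) + norm (seg_mu P i) \<le> V" if "i \<in> {1..seg_num P}" for i
    unfolding V_def using that vsum_mu_pos by (intro member_le_sum) (auto simp: add_nonneg_nonneg less_imp_le)
  have "vsum (seg_mu P i) \<le> V \<and> norm (seg_mu P i) \<le> V" if "i \<in> {1..seg_num P}" for i
    using a[OF that] vsum_mu_pos[OF that] norm_ge_zero[of "seg_mu P i"] by linarith
  moreover have "0 < V"
  proof -
    have "seg_num P \<in> {1..seg_num P}" using seg_num_pos by simp
    from a[OF this] vsum_mu_pos[OF this] norm_ge_zero[of "seg_mu P (seg_num P)"] show ?thesis by linarith
  qed
  ultimately show ?thesis by blast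
qed

lemma path_quot_bound:
  assumes C1: "C1_near std_simplex F"
  shows "\<exists>M\<ge>0. \<forall>\<sigma> \<mu> j. (\<sigma>, \<mu>) \<in> path_set P \<longrightarrow> \<bar>\<mu> $ j\<bar> \<le> M * \<sigma> $ j"
proof -
  have "continuous_on std_simplex F" using C1_jacobian[OF C1] by blast
  then obtain B where B: "B > 0" "\<And>\<sigma>. \<sigma> \<in> std_simplex \<Longrightarrow> norm (F \<sigma>) \<le> B"
    using compact_upper_bound[OF compact_simplex continuous_on_norm] by blast
  obtain V where V: "V > 0" "\<And>i. i \<in> {1..seg_num P} \<Longrightarrow> vsum (seg_mu P i) \<le> V"
    using mu_bounds by blast
  \<comment> \<open>One \<open>B\<close> for the entry of \<open>F \<sigma>\<close>, one for its
    mean under \<sigma>, and \<open>V\<close> for the level.\<close>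
  have "\<bar>\<mu> $ j\<bar> \<le> (2 * B + V) * \<sigma> $ j" if mem: "(\<sigma>, \<mu>) \<in> path_set P" for \<sigma> \<mu> j
  proof -
    obtain i g where o: "on_path i g" and e: "\<sigma> = seg_curve P i g" "\<mu> = g *\<^sub>R seg_mu P i"
      using mem by (auto simp: path_set_iff)
    have s: "\<sigma> \<in> std_simplex" using on_path_simplex[OF o] by (simp add: e)
    have i: "i \<in> {1..seg_num P}" "g \<le> 1" "0 \<le> g"
      using o on_path_nonneg[OF o] by (auto simp: on_path_def)
    have "g * vsum (seg_mu P i) \<le> 1 * V"
      using i V vsum_mu_pos[OF i(1)] by (intro mult_mono) auto
    moreover have "0 \<le> g * vsum (seg_mu P i)" using i vsum_mu_pos[OF i(1)] by simp
    ultimately have v: "0 \<le> vsum \<mu>" "vsum \<mu> \<le> V" by (auto simp: e vsum_scaleR)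
    have "\<bar>\<sigma> \<bullet> F \<sigma>\<bar> \<le> 1 * B"
      by (rule order_trans[OF Cauchy_Schwarz_ineq2]) (intro mult_mono simplex_norm s B, auto)
    then have "\<bar>F \<sigma> $ j - (\<sigma> \<bullet> F \<sigma> - vsum \<mu>)\<bar> \<le> 2 * B + V"
      using component_le_norm_cart[of "F \<sigma>" j] B(2)[OF s] v by linarith
    then have "\<bar>\<sigma> $ j\<bar> * \<bar>F \<sigma> $ j - (\<sigma> \<bullet> F \<sigma> - vsum \<mu>)\<bar> \<le> \<bar>\<sigma> $ j\<bar> * (2 * B + V)"
      by (intro mult_left_mono) auto
    then show ?thesis
      using s bundle_quot[OF on_path_bundle[OF o], folded e, of j]
      by (simp add: abs_mult std_simplex_def mult.commute)
  qed
  then show ?thesis using B(1) V(1) by (intro exI[of _ "2 * B + V"]) auto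
qed

lemma path_nbhd_region:
  assumes C1: "C1_near std_simplex F" and "0 \<le> \<zeta>"
  shows "\<exists>M\<ge>0. compact (path_nbhd P d \<zeta>) \<and>
    (\<forall>\<sigma> \<mu>. (\<sigma>, \<mu>) \<in> path_nbhd P d \<zeta> \<longrightarrow> \<sigma> \<in> std_simplex \<and> (\<forall>i. \<bar>\<mu> $ i\<bar> \<le> M * \<sigma> $ i))"
proof -
  obtain M where M: "M \<ge> 0" "\<And>\<sigma> \<mu> j. (\<sigma>, \<mu>) \<in> path_set P \<Longrightarrow> \<bar>\<mu> $ j\<bar> \<le> M * \<sigma> $ j"
    using path_quot_bound[OF C1] by blast
  define M' where "M' = M * exp (2 * d)"
  have M': "0 \<le> M'" using M(1) by (simp add: M'_def)
  \<comment> \<open>The inequality is multiplied out, so \<open>T\<close> is closed even where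
    entries of \<sigma> vanish and the bound passes to the closure defining the neighbourhood. It
    also bounds \<mu>, hence gives compactness.\<close>
  define T where "T = (std_simplex \<times> UNIV) \<inter> {p :: (real^'n) \<times> (real^'n). \<forall>i. \<bar>snd p $ i\<bar> \<le> M' * fst p $ i}"
  have "closed T" unfolding T_def
    by (intro closed_Int closed_Times compact_imp_closed[OF compact_simplex] closed_UNIV
        closed_Collect_all closed_Collect_le continuous_intros)
  moreover have "(softmax \<theta>, \<mu>) \<in> T"
    if n: "norm (\<theta> - hln \<sigma>) \<le> d" and m: "(\<sigma>, \<mu>) \<in> path_set P" and v: "vsum \<mu> > \<zeta>" for \<theta> \<sigma> \<mu>
  proof -
    obtain i g where o: "on_path i g" and e: "\<sigma> = seg_curve P i g" "\<mu> = g *\<^sub>R seg_mu P i"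
      using m by (auto simp: path_set_iff)
    have "g \<noteq> 0" using v assms(2) by (auto simp: e vsum_scaleR)
    then have p: "pos \<sigma>" using on_path_pos[OF o] on_path_nonneg[OF o] by (simp add: e)
    have "\<bar>\<mu> $ j\<bar> \<le> M' * softmax \<theta> $ j" for j
      using order_trans[OF M(2)[OF m, of j] mult_left_mono[OF softmax_near_ge[OF p n, of j] M(1)]]
      by (simp add: M'_def mult_ac)
    then show ?thesis by (simp add: T_def pos_simplex softmax_pos)
  qed
  ultimately have sub: "path_nbhd P d \<zeta> \<subseteq> T"
    unfolding path_nbhd_def by (intro closure_minimal) auto
  have "T \<subseteq> std_simplex \<times> cball 0 M'"
  proof
    fix p assume p: "p \<in> T"
    then have s: "fst p \<in> std_simplex" by (auto simp: T_def)
    have "norm (snd p) \<le> \<bar>M'\<bar> * norm (fst p)"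
      by (rule norm_le_scaled_vec) (use p in \<open>auto simp: T_def std_simplex_def\<close>)
    also have "\<dots> \<le> M'" using mult_left_mono[OF simplex_norm[OF s] M'] M' by simp
    finally show "p \<in> std_simplex \<times> cball 0 M'" using s by (cases p) auto
  qed
  then have "bounded (path_nbhd P d \<zeta>)"
    using sub by (intro bounded_subset[OF bounded_Times[OF compact_imp_bounded[OF compact_simplex] bounded_cball]]) blast
  then have "compact (path_nbhd P d \<zeta>)"
    by (simp add: compact_eq_bounded_closed path_nbhd_def)
  then show ?thesis using sub M' by (intro exI[of _ M']) (auto simp: T_def)
qed

text \<open>The neighbourhood is the closure of a set of levels strictly above \<zeta>. A point at
  level \<zeta> with \<open>g < 1\<close> is reached from larger parameters of the same segment,
  with the displacement in log-coordinates held fixed. At \<open>g = 1\<close> no larger parameter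
  exists, so the level itself must exceed \<zeta>.\<close>

lemma path_nbhd_mem:
  assumes o: "on_path i g" and g: "0 < g" and l: "\<zeta> \<le> vsum (g *\<^sub>R seg_mu P i)"
    and l': "\<zeta> < vsum (g *\<^sub>R seg_mu P i) \<or> g < 1"
    and n: "norm (\<theta> - hln (seg_curve P i g)) \<le> d"
  shows "(softmax \<theta>, g *\<^sub>R seg_mu P i) \<in> path_nbhd P d \<zeta>"
proof -
  have i: "i \<in> {1..seg_num P}" using o by (simp add: on_path_def)
  define B where "B = {(softmax \<theta>, \<mu>) |\<theta> \<sigma>\<mu> \<mu>. norm (\<theta> - hln \<sigma>\<mu>) \<le> d \<and> (\<sigma>\<mu>, \<mu>) \<in> path_set P \<and> vsum \<mu> > \<zeta>}"
  have nb: "path_nbhd P d \<zeta> = closure B" by (simp only: path_nbhd_def B_def)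
  have on: "on_path i t" if "t \<in> {g..1}" for t using o that by (auto simp: on_path_def)
  define h where "h t = (softmax (\<theta> - hln (seg_curve P i g) + hln (seg_curve P i t)), t *\<^sub>R seg_mu P i)" for t
  have h: "h t \<in> B" if t: "t \<in> {g..1}" "\<zeta> < vsum (t *\<^sub>R seg_mu P i)" for t
  proof -
    let ?\<phi> = "\<theta> - hln (seg_curve P i g) + hln (seg_curve P i t)"
    have 1: "(seg_curve P i t, t *\<^sub>R seg_mu P i) \<in> path_set P"
      unfolding path_set_iff using on[OF t(1)] by (intro exI[of _ i] exI[of _ t]) simp
    have 2: "norm (?\<phi> - hln (seg_curve P i t)) \<le> d" using n by simp
    show ?thesis unfolding h_def B_def
      by (rule CollectI, rule exI[of _ ?\<phi>], rule exI[of _ "seg_curve P i t"],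
          rule exI[of _ "t *\<^sub>R seg_mu P i"], intro conjI refl 1 2 t(2))
  qed
  have hg: "h g = (softmax \<theta>, g *\<^sub>R seg_mu P i)" by (simp add: h_def)
  show ?thesis
  proof (cases "g < 1")
    case False
    then have "\<zeta> < vsum (g *\<^sub>R seg_mu P i)" using l' by blast
    moreover have "g \<in> {g..1}" using o by (simp add: on_path_def)
    ultimately have "h g \<in> B" by (intro h)
    then have "h g \<in> closure B" by (rule subsetD[OF closure_subset])
    then show ?thesis by (simp only: hg nb)
  next
    case True
    have "continuous_on {g..1} (seg_curve P i)"
      using o by (intro continuous_on_subset[OF seg(5)[OF i]]) (auto simp: on_path_def)
    then have "continuous_on {g..1} (\<lambda>t. hln (seg_curve P i t))"
      using on g by (intro continuous_hln on_path_pos) auto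
    then have "continuous_on {g..1} h"
      unfolding h_def by (intro continuous_intros continuous_on_compose2[OF continuous_softmax[of UNIV]]) auto
    then have hc: "continuous_on (closure {g<..1}) h" using True by (simp add: closure_greaterThanAtMost)
    have "h t \<in> closure B" if t: "t \<in> {g<..1}" for t
    proof -
      have "g * vsum (seg_mu P i) < t * vsum (seg_mu P i)"
        using t vsum_mu_pos[OF i] by (intro mult_strict_right_mono) auto
      then have "h t \<in> B" using t l by (intro h) (simp_all add: vsum_scaleR)
      then show ?thesis by (rule subsetD[OF closure_subset])
    qed
    then have "h ` closure {g<..1} \<subseteq> closure B"
      by (intro image_closure_subset[OF hc closed_closure] image_subsetI)
    moreover have "g \<in> closure {g<..1}" using True by (simp add: closure_greaterThanAtMost)
    ultimately have "h g \<in> closure B" by (metis imageI subsetD)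
    then show ?thesis by (simp only: hg nb)
  qed
qed

end

section \<open>Variation of the path under a relative change of level\<close>

context newton_basin
begin

lemma Cv_nonneg: "0 \<le> Cv"
  using radii_pos M_nonneg by (simp add: Cv_def)

text \<open>Scaling \<open>\<mu>\<close> by \<open>b / t\<close> changes the residual by a multiple of \<open>(b - t) / t\<close> only, so along a
  continuous curve of solutions the deviation cannot jump over the gap up to \<open>r0\<close>.\<close>

lemma curve_variation:
  fixes c :: "real \<Rightarrow> real^'n"
  assumes a: "0 < a" "a \<le> b" and c: "continuous_on {a..b} c"
    and good: "\<And>t. t \<in> {a..b} \<Longrightarrow> good (c t) (t *\<^sub>R m)"
    and small: "Cv * ((b - a) / a) < r0"
  shows "norm (dev (c b) (hln (c a))) \<le> Cv * ((b - a) / a)"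
proof -
  let ?n = "norm (1 :: real^'n)"
  define h where "h t = norm (dev (c b) (hln (c t)))" for t
  have p: "pos (c t)" if "t \<in> {a..b}" for t using good[OF that] by (simp add: good_def)
  have "continuous_on {a..b} h"
    unfolding h_def dev_def by (intro continuous_intros continuous_hln c p)
  have hb: "h b = 0" using p[of b] a by (simp add: h_def dev_eq_0 softmax_hln)
  \<comment> \<open>The point \<open>c t\<close> solves the problem at level \<open>t\<close> but is
    tested at level \<open>b\<close>: its residual there is a pure multiple of the projected
    quotient, and \<open>basin\<close> at \<open>c b\<close> turns it into a deviation.\<close>
  have key: "h t \<le> Cv * ((b - a) / a)" if t: "t \<in> {a..b}" and r: "h t \<le> r0" for t
  proof -
    have b: "b \<in> {a..b}" and t0: "0 < t" using a t by auto
    have "h t \<le> C2 * norm (Gt F (c t) (b *\<^sub>R m))"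
      using basin[OF good[OF b], of "hln (c t)"] r by (simp add: h_def softmax_hln p[OF t])
    also have "Gt F (c t) (b *\<^sub>R m) = - ((b - t) / t) *\<^sub>R pr (c t) (hquot (t *\<^sub>R m) (c t))"
    proof -
      have "hquot (b *\<^sub>R m) (c t) = hquot (t *\<^sub>R m) (c t) + ((b - t) / t) *\<^sub>R hquot (t *\<^sub>R m) (c t)"
        using t0 by (simp add: hquot_def vec_eq_iff field_simps pos_nth_neq[OF p[OF t]])
      then have "F (c t) - hquot (b *\<^sub>R m) (c t)
          = (F (c t) - hquot (t *\<^sub>R m) (c t)) + (- ((b - t) / t)) *\<^sub>R hquot (t *\<^sub>R m) (c t)"
        by simp
      then show ?thesis
        using good_Gt[OF good[OF t]] unfolding Gt_pr[OF p[OF t]] by (simp only: pr_add pr_scaleR) simp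
    qed
    also have "norm \<dots> \<le> ((b - a) / a) * ((1 + ?n) * (M * ?n))"
    proof -
      have "norm (hquot (t *\<^sub>R m) (c t)) \<le> \<bar>M\<bar> * ?n"
      proof (rule norm_le_scaled_vec)
        fix i show "\<bar>hquot (t *\<^sub>R m) (c t) $ i\<bar> \<le> M * \<bar>(1 :: real^'n) $ i\<bar>"
          using quot_N[OF good_mem[OF good[OF t]], of i] p[OF t]
          by (simp add: hquot_def abs_divide pos_def abs_of_pos pos_divide_le_eq)
      qed
      then have "norm (pr (c t) (hquot (t *\<^sub>R m) (c t))) \<le> (1 + ?n) * (M * ?n)"
        using M_nonneg by (intro order_trans[OF norm_pr_le[OF pos_simplex[OF p[OF t]]]] mult_left_mono) auto
      moreover have "(b - t) / t \<le> (b - a) / a" using a t by (simp add: field_simps)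
      ultimately show ?thesis using a t M_nonneg t0
        by (simp only: norm_scaleR) (intro mult_mono, auto)
    qed
    finally show ?thesis using radii_pos(3) by (simp add: Cv_def mult_ac)
  qed
  have "h a \<le> r0"
  proof (rule ccontr)
    assume "\<not> h a \<le> r0"
    then obtain t where "a \<le> t" "t \<le> b" "h t = r0"
      using IVT2'[of h b r0 a] \<open>continuous_on {a..b} h\<close> a hb radii_pos(1) by auto
    with key[of t] small show False by simp
  qed
  then show ?thesis using key[of a] a by (simp add: h_def)
qed

end

section \<open>Positions of the algorithm\<close>

context path_data
begin

definition reach :: "real \<Rightarrow> nat \<times> real \<Rightarrow> bool" where
  "reach \<zeta> x \<longleftrightarrow> on_path (fst x) (snd x) \<and> 0 < snd x \<and>
     \<zeta> \<le> snd x * vsum (seg_mu P (fst x)) \<and> (\<zeta> < snd x * vsum (seg_mu P (fst x)) \<or> snd x < 1)"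

lemma reach_start: "\<zeta> < vsum (seg_mu P 1) \<Longrightarrow> reach \<zeta> (1, 1)"
  using seg_num_pos seg(3)[of 1] by (simp add: reach_def on_path_def)

lemma pc_next_halted: "pc_halted P \<zeta> x \<Longrightarrow> pc_next P \<zeta> \<eta> x = x"
  by (cases x) (simp add: pc_next_def)

lemma pc_next_predicts:
  "pc_predicts P \<zeta> (i, g) \<Longrightarrow>
    pc_next P \<zeta> \<eta> (i, g) = (i, Max {(1 - \<eta>) * g, seg_gam P i, \<zeta> / vsum (seg_mu P i)})"
  by (simp add: pc_next_def pc_predicts_def)

lemma pc_next_move:
  "\<not> pc_halted P \<zeta> (i, g) \<Longrightarrow> \<not> pc_predicts P \<zeta> (i, g) \<Longrightarrow> pc_next P \<zeta> \<eta> (i, g) = (i + 1, 1)"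
  by (simp add: pc_next_def)

lemma pc_halted_eq: "pc_halted P \<zeta> (i, g) \<longleftrightarrow> g * vsum (seg_mu P i) \<le> \<zeta> \<or>
     (g \<le> seg_gam P i \<and> \<not> (i < seg_num P \<and> \<zeta> < vsum (seg_mu P (i + 1))))"
  by (simp add: pc_halted_def vsum_scaleR)

text \<open>The maximum in \<open>pc_next\<close> is attained by the full step, by the segment end
  or by the level \<zeta>; in the last case the new position is halted. This gives the three cases
  at the end.\<close>

lemma predict_bounds:
  assumes r: "reach \<zeta> (i, g)" and p: "pc_predicts P \<zeta> (i, g)" and \<eta>: "0 < \<eta>" "\<eta> < 1"
  shows "\<exists>g'. pc_next P \<zeta> \<eta> (i, g) = (i, g') \<and> reach \<zeta> (i, g') \<and> 0 < g' \<and> g' < g \<and> (1 - \<eta>) * g \<le> g' \<and>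
    (pc_halted P \<zeta> (i, g') \<or> g' = seg_gam P i \<or> g' = (1 - \<eta>) * g)"
proof -
  let ?v = "vsum (seg_mu P i)"
  define g' where "g' = Max {(1 - \<eta>) * g, seg_gam P i, \<zeta> / ?v}"
  have i: "i \<in> {1..seg_num P}" and g: "0 < g" "seg_gam P i < g" "g \<le> 1"
    using r p by (auto simp: reach_def on_path_def pc_predicts_def)
  have v: "0 < ?v" by (rule vsum_mu_pos[OF i])
  have z: "\<zeta> < g * ?v" using p by (simp add: pc_predicts_def pc_halted_eq)
  have lt: "(1 - \<eta>) * g < g" "\<zeta> / ?v < g" using g \<eta> z v by (simp_all add: pos_divide_less_eq)
  have ge: "(1 - \<eta>) * g \<le> g'" "seg_gam P i \<le> g'" "\<zeta> / ?v \<le> g'" by (simp_all add: g'_def)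
  have mem: "g' = (1 - \<eta>) * g \<or> g' = seg_gam P i \<or> g' = \<zeta> / ?v"
  proof -
    have "g' \<in> {(1 - \<eta>) * g, seg_gam P i, \<zeta> / ?v}" unfolding g'_def by (rule Max_in) auto
    then show ?thesis by simp
  qed
  have g'g: "g' < g" using mem lt g(2) by auto
  have g'0: "0 < g'" using ge(1) mult_pos_pos[of "1 - \<eta>" g] g \<eta> by linarith
  have zl: "\<zeta> \<le> g' * ?v" using ge(3) v by (simp add: pos_divide_le_eq)
  have "reach \<zeta> (i, g')"
    using i g g'0 g'g ge(2) zl by (simp add: reach_def on_path_def)
  moreover have "pc_halted P \<zeta> (i, g') \<or> g' = seg_gam P i \<or> g' = (1 - \<eta>) * g"
    using mem v by (auto simp: pc_halted_eq)
  moreover have "pc_next P \<zeta> \<eta> (i, g) = (i, g')" unfolding g'_def by (rule pc_next_predicts[OF p])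
  ultimately show ?thesis
    using g'0 g'g ge(1) by (intro exI[of _ g'] conjI)
qed

lemma move_facts:
  assumes r: "reach \<zeta> (i, g)" and h: "\<not> pc_halted P \<zeta> (i, g)" and p: "\<not> pc_predicts P \<zeta> (i, g)"
  shows "g = seg_gam P i" "i < seg_num P" "reach \<zeta> (i + 1, 1)"
    "seg_curve P (i + 1) 1 = seg_curve P i g"
proof -
  have i: "i \<in> {1..seg_num P}" and g: "seg_gam P i \<le> g" using r by (auto simp: reach_def on_path_def)
  show e: "g = seg_gam P i" using h p g by (simp add: pc_predicts_def)
  then have "i < seg_num P \<and> \<zeta> < vsum (seg_mu P (i + 1))" using h by (simp add: pc_halted_eq)
  then have j: "i + 1 \<in> {1..seg_num P}" "\<zeta> < vsum (seg_mu P (i + 1))" and "i < seg_num P" using i by auto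
  then show "i < seg_num P" by simp
  show "reach \<zeta> (i + 1, 1)" using j seg(3)[OF j(1)] by (simp add: reach_def on_path_def)
  show "seg_curve P (i + 1) 1 = seg_curve P i g" using seg(6)[OF j(1)] seg(7)[OF i] e by simp
qed

lemma reach_next:
  assumes r: "reach \<zeta> x" and \<eta>: "0 < \<eta>" "\<eta> < 1"
  shows "reach \<zeta> (pc_next P \<zeta> \<eta> x)"
proof (cases x)
  case (Pair i g)
  show ?thesis
  proof (cases "pc_halted P \<zeta> x")
    case False
    then show ?thesis
      using predict_bounds[of \<zeta> i g \<eta>] move_facts(3)[of \<zeta> i g] pc_next_move[of \<zeta> i g \<eta>] r \<eta> Pair
      by (cases "pc_predicts P \<zeta> (i, g)") auto
  qed (simp add: pc_next_halted r)
qed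

lemma pc_pos_Suc: "pc_pos P \<zeta> \<eta> (Suc t) = pc_next P \<zeta> \<eta> (pc_pos P \<zeta> \<eta> t)"
  by (simp add: pc_pos_def)

lemma pc_pos_0: "pc_pos P \<zeta> \<eta> 0 = (1, 1)"
  by (simp add: pc_pos_def)

lemma reach_pos:
  assumes "\<zeta> < vsum (seg_mu P 1)" "0 < \<eta>" "\<eta> < 1"
  shows "reach \<zeta> (pc_pos P \<zeta> \<eta> t)"
proof (induction t)
  case 0
  show ?case unfolding pc_pos_0 by (rule reach_start[OF assms(1)])
qed (simp add: pc_pos_Suc reach_next assms)

lemma pc_pos_halted_mono:
  assumes "pc_halted P \<zeta> (pc_pos P \<zeta> \<eta> t)" "t \<le> s"
  shows "pc_pos P \<zeta> \<eta> s = pc_pos P \<zeta> \<eta> t"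
  using assms(2,1)
proof (induction s rule: dec_induct)
  case (step s)
  then show ?case by (simp add: pc_pos_Suc pc_next_halted)
qed simp

lemma pc_pos_halted_unique:
  assumes "pc_halted P \<zeta> (pc_pos P \<zeta> \<eta> t)" "pc_halted P \<zeta> (pc_pos P \<zeta> \<eta> s)"
  shows "pc_pos P \<zeta> \<eta> s = pc_pos P \<zeta> \<eta> t"
  using pc_pos_halted_mono[OF assms(1), of s] pc_pos_halted_mono[OF assms(2), of t] by (cases "t \<le> s") auto

text \<open>The end of the last segment has \<open>g = 0\<close>, which \<open>reach\<close>
  excludes. So a run halts only at level \<zeta> or before a segment starting at or below \<zeta>.
  Either way \<zeta> bounds a positive level, hence for \<zeta> = 0 a run never halts.\<close>

lemma halted_end:
  assumes r: "reach \<zeta> (i, g)" and h: "pc_halted P \<zeta> (i, g)" and "0 \<le> \<zeta>"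
  shows "0 < \<zeta>" and "g * vsum (seg_mu P i) = \<zeta> \<or>
    (i \<in> {1..<seg_num P} \<and> g = seg_gam P i \<and> vsum (seg_mu P (i + 1)) \<le> \<zeta>)"
proof -
  have i: "i \<in> {1..seg_num P}" and g: "seg_gam P i \<le> g" "0 < g" "\<zeta> \<le> g * vsum (seg_mu P i)"
    using r by (auto simp: reach_def on_path_def)
  have v: "0 < g * vsum (seg_mu P i)" using g vsum_mu_pos[OF i] by simp
  have ne: "i \<noteq> seg_num P" if "g \<le> seg_gam P i" using that g gam_last by auto
  show "g * vsum (seg_mu P i) = \<zeta> \<or> (i \<in> {1..<seg_num P} \<and> g = seg_gam P i \<and> vsum (seg_mu P (i + 1)) \<le> \<zeta>)"
    using h g i ne by (auto simp: pc_halted_eq)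
  show "0 < \<zeta>"
  proof (cases "g * vsum (seg_mu P i) \<le> \<zeta>")
    case False
    then have "g \<le> seg_gam P i" "\<not> (i < seg_num P \<and> \<zeta> < vsum (seg_mu P (i + 1)))"
      using h by (auto simp: pc_halted_eq)
    then have j: "i + 1 \<in> {1..seg_num P}" "vsum (seg_mu P (i + 1)) \<le> \<zeta>" using ne i by auto
    then show ?thesis using vsum_mu_pos[OF j(1)] by simp
  qed (use v in simp)
qed

text \<open>Every reset to \<open>g = 1\<close> at the end of segment \<open>j\<close> costs a factor \<open>1 / seg_gam P j\<close>, and the
  truncated step and the move itself cost one factor \<open>1 / (1 - \<eta>)\<close> each.\<close>

lemma level_decay:
  assumes z: "\<zeta> < vsum (seg_mu P 1)" and \<eta>: "0 < \<eta>" "\<eta> < 1"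
  shows "\<exists>A>0. \<forall>t. \<not> pc_halted P \<zeta> (pc_pos P \<zeta> \<eta> t) \<longrightarrow> snd (pc_pos P \<zeta> \<eta> t) \<le> A * (1 - \<eta>) ^ t"
proof -
  define A where "A i = (\<Prod>j\<in>{1..<i}. 1 / (seg_gam P j * (1 - \<eta>)\<^sup>2))" for i
  have A0: "0 < A i" if "i \<in> {1..seg_num P}" for i
    unfolding A_def using that \<eta> by (intro prod_pos) (auto intro!: seg(4) mult_pos_pos divide_pos_pos)
  have AS: "A (i + 1) = A i / (seg_gam P i * (1 - \<eta>)\<^sup>2)" if "1 \<le> i" for i
    using that by (simp add: A_def prod.atLeastLessThan_Suc)
  \<comment> \<open>A step cut short at a segment end may decrease \<open>g\<close> arbitrarily
    little. The clean bound is kept only strictly before the end; the end itself is allowed an extra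
    factor \<open>1 / (1 - \<eta>)\<close>, which the following move charges to
    \<open>A\<close>.\<close>
  have inv: "\<not> pc_halted P \<zeta> (i, g) \<Longrightarrow>
      (1 - \<eta>) * g \<le> A i * (1 - \<eta>) ^ t \<and> (seg_gam P i < g \<longrightarrow> g \<le> A i * (1 - \<eta>) ^ t)"
    if "pc_pos P \<zeta> \<eta> t = (i, g)" for t i g
    using that
  proof (induction t arbitrary: i g)
    case 0
    then show ?case using \<eta> by (simp add: pc_pos_0 A_def)
  next
    case (Suc t)
    obtain i0 g0 where e0: "pc_pos P \<zeta> \<eta> t = (i0, g0)" by fastforce
    have e: "pc_next P \<zeta> \<eta> (i0, g0) = (i, g)" using Suc.prems(2) by (simp add: pc_pos_Suc e0)
    have r0: "reach \<zeta> (i0, g0)" using reach_pos[OF z \<eta>, of t] by (simp add: e0)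
    have h0: "\<not> pc_halted P \<zeta> (i0, g0)" using Suc.prems(1) e pc_next_halted[of \<zeta> "(i0, g0)" \<eta>] by auto
    note IH = Suc.IH[OF h0 e0]
    show ?case
    proof (cases "pc_predicts P \<zeta> (i0, g0)")
      case True
      have g0: "g0 \<le> A i0 * (1 - \<eta>) ^ t" using IH True by (simp add: pc_predicts_def)
      obtain g' where g': "pc_next P \<zeta> \<eta> (i0, g0) = (i0, g')" "g' < g0"
        "pc_halted P \<zeta> (i0, g') \<or> g' = seg_gam P i0 \<or> g' = (1 - \<eta>) * g0"
        using predict_bounds[OF r0 True \<eta>] by blast
      then have eq: "i = i0" "g = g'" using e by auto
      have "(1 - \<eta>) * g0 \<le> (1 - \<eta>) * (A i0 * (1 - \<eta>) ^ t)" using g0 \<eta> by (intro mult_left_mono) auto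
      then have s: "(1 - \<eta>) * g0 \<le> A i * (1 - \<eta>) ^ Suc t" by (simp add: eq mult_ac)
      have "(1 - \<eta>) * g \<le> (1 - \<eta>) * g0" using \<eta> g'(2) eq by (intro mult_left_mono) auto
      moreover have "seg_gam P i < g \<Longrightarrow> g = (1 - \<eta>) * g0" using g'(3) Suc.prems(1) eq by auto
      ultimately show ?thesis using s by auto
    next
      case False
      note m = move_facts[OF r0 h0 False]
      have eq: "i = i0 + 1" "g = 1" using pc_next_move[OF h0 False, of \<eta>] e by auto
      have i0: "i0 \<in> {1..seg_num P}" using r0 by (simp add: reach_def on_path_def)
      have gp: "0 < seg_gam P i0" by (rule seg(4)[OF i0 m(2)])
      have "(1 - \<eta>) * seg_gam P i0 \<le> A i0 * (1 - \<eta>) ^ t" using IH m(1) by simp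
      moreover have q: "0 < (1 - \<eta>) * seg_gam P i0" using gp \<eta> by simp
      ultimately have "1 \<le> A i0 * (1 - \<eta>) ^ t / ((1 - \<eta>) * seg_gam P i0)"
        by (simp add: pos_le_divide_eq)
      also have "\<dots> = A i * (1 - \<eta>) ^ Suc t"
        using i0 q by (simp add: eq AS[simplified] power2_eq_square)
      finally have one: "g \<le> A i * (1 - \<eta>) ^ Suc t" by (simp only: eq)
      moreover have "(1 - \<eta>) * g \<le> g" using \<eta> eq by simp
      ultimately show ?thesis by linarith
    qed
  qed
  \<comment> \<open>The sum dominates every \<open>A i\<close>, and the division absorbs the weaker
    half of the invariant.\<close>
  define B where "B = (\<Sum>i\<in>{1..seg_num P}. A i) / (1 - \<eta>)"
  have le: "A i / (1 - \<eta>) \<le> B" if "i \<in> {1..seg_num P}" for i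
    unfolding B_def using that \<eta> A0 by (intro divide_right_mono member_le_sum) (auto simp: less_imp_le)
  have "snd (pc_pos P \<zeta> \<eta> t) \<le> B * (1 - \<eta>) ^ t" if h: "\<not> pc_halted P \<zeta> (pc_pos P \<zeta> \<eta> t)" for t
  proof -
    obtain i g where e: "pc_pos P \<zeta> \<eta> t = (i, g)" by fastforce
    have i: "i \<in> {1..seg_num P}" using reach_pos[OF z \<eta>, of t] by (simp add: e reach_def on_path_def)
    have "(1 - \<eta>) * g \<le> A i * (1 - \<eta>) ^ t" using inv[OF e] h e by auto
    then have "g \<le> A i / (1 - \<eta>) * (1 - \<eta>) ^ t" using \<eta> by (simp add: pos_le_divide_eq mult.commute)
    also have "\<dots> \<le> B * (1 - \<eta>) ^ t" using le[OF i] \<eta> by (intro mult_right_mono) auto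
    finally show ?thesis by (simp add: e)
  qed
  moreover have "0 < B" using le[of 1] A0[of 1] seg_num_pos \<eta>
    by (smt (verit) atLeastAtMost_iff divide_pos_pos le_refl)
  ultimately show ?thesis by blast
qed

end

section \<open>Tracking of the path by predictor steps\<close>

locale path_tracking = newton_basin F k M d N r0 C1 C2 L Kp Cv + path_data F \<sigma>init vinit P
  for F :: "real^'n \<Rightarrow> real^'n" and k M d :: real and N :: "((real^'n) \<times> (real^'n)) set"
    and r0 C1 C2 L Kp Cv :: real and \<sigma>init :: "real^'n" and vinit :: real and P :: "'n fp_path" +
  fixes \<zeta> :: real
  assumes N_eq: "N = path_nbhd P d \<zeta>" and zeta_nonneg: "0 \<le> \<zeta>"
begin

lemma good_reach:
  assumes "reach \<zeta> (i, g)"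
  shows "good (seg_curve P i g) (g *\<^sub>R seg_mu P i)"
proof -
  have o: "on_path i g" "0 < g" "\<zeta> \<le> vsum (g *\<^sub>R seg_mu P i)" "\<zeta> < vsum (g *\<^sub>R seg_mu P i) \<or> g < 1"
    using assms by (auto simp: reach_def vsum_scaleR)
  then show ?thesis
    unfolding good_def unfolding N_eq using on_path_pos[OF o(1,2)] on_path_bundle[OF o(1)] path_nbhd_mem[OF o]
    by (auto simp: fp_bundle_def)
qed

definition tracks :: "real^'n \<Rightarrow> nat \<times> real \<Rightarrow> real" where
  "tracks \<theta> x = norm (dev (seg_curve P (fst x) (snd x)) \<theta>)"

text \<open>Three contributions add up: \<open>C2 * \<epsilon>\<close> left over by the corrector,
  \<open>Kp * \<eta>\<close> from the predictor and \<open>Cv * (2 * \<eta>)\<close> from the motion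
  of the path point. The factor \<open>1 + norm 1\<close> is the price of projecting to the new base
  point. Without a predictor step neither \<theta> nor the \<sigma>-component of the path point
  changes.\<close>

lemma tracks_next:
  assumes r: "reach \<zeta> x" and \<eta>: "0 < \<eta>" "\<eta> \<le> 1 / 2"
    and t: "tracks \<theta> x \<le> r0" "tracks \<theta> x \<le> C2 * \<epsilon>"
    and small: "Cv * (2 * \<eta>) < r0" "(1 + norm (1 :: real^'n)) * (C2 * \<epsilon> + Kp * \<eta> + Cv * (2 * \<eta>)) \<le> r0"
  shows "tracks (if pc_predicts P \<zeta> x
           then predictor F k (1 - snd (pc_next P \<zeta> \<eta> x) / snd x) (snd (path_point P x)) \<theta>
           else \<theta>) (pc_next P \<zeta> \<eta> x) \<le> r0"
proof -
  obtain i g where x: "x = (i, g)" by fastforce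
  show ?thesis
  proof (cases "pc_halted P \<zeta> x")
    case True
    then show ?thesis using t by (simp add: pc_next_halted pc_predicts_def)
  next
    case False
    show ?thesis
    proof (cases "pc_predicts P \<zeta> (i, g)")
      case np: False
      then show ?thesis
        using False t(1) r pc_next_move[OF _ np, of \<eta>] move_facts(4)[of \<zeta> i g] by (simp add: x tracks_def)
    next
      case True
      have \<eta>1: "\<eta> < 1" using \<eta> by simp
      obtain g' where g': "pc_next P \<zeta> \<eta> (i, g) = (i, g')" "reach \<zeta> (i, g')" "0 < g'" "g' < g" "(1 - \<eta>) * g \<le> g'"
        using predict_bounds[OF r[unfolded x] True \<eta>(1) \<eta>1] by blast
      let ?c = "seg_curve P i" and ?e = "1 - g' / g"
      have g0: "0 < g" using g' by simp
      have i: "i \<in> {1..seg_num P}" and gam: "seg_gam P i \<le> g'" and g1: "g \<le> 1"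
        using g'(2) r by (auto simp: reach_def on_path_def x)
      \<comment> \<open>\<open>?e\<close> is the relative step actually taken; steps shortened at a
        segment end or at \<zeta> are covered by the bound for \<eta>.\<close>
      have e: "0 \<le> ?e" "?e \<le> \<eta>" using g' g0 by (simp_all add: field_simps)
      have reach_t: "reach \<zeta> (i, t)" if t: "t \<in> {g'..g}" for t
      proof (cases "t = g")
        case False
        have "\<zeta> \<le> g' * vsum (seg_mu P i)" using g'(2) by (simp add: reach_def)
        also have "\<dots> \<le> t * vsum (seg_mu P i)" using t vsum_mu_pos[OF i] by (intro mult_right_mono) auto
        finally show ?thesis using False t i gam g1 g'(3) by (auto simp: reach_def on_path_def)
      qed (use r x in simp)
      \<comment> \<open>\<open>curve_variation\<close> measures the change relative to the smaller
        parameter \<open>g'\<close>; \<eta> at most 1/2 gives \<open>g \<le> 2 * g'\<close>, whence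
        the factor 2.\<close>
      have ratio: "(g - g') / g' \<le> 2 * \<eta>"
      proof -
        have "g / 2 \<le> (1 - \<eta>) * g" using \<eta> g0 by (simp add: field_simps)
        then have "g \<le> 2 * g'" using g'(5) by linarith
        then have "\<eta> * g \<le> \<eta> * (2 * g')" using \<eta> by (intro mult_left_mono) auto
        then show ?thesis using g'(3,5) by (simp add: pos_divide_le_eq algebra_simps)
      qed
      have var: "norm (dev (?c g) (hln (?c g'))) \<le> Cv * ((g - g') / g')"
      proof (rule curve_variation)
        show "continuous_on {g'..g} ?c"
          using gam g1 by (intro continuous_on_subset[OF seg(5)[OF i]]) auto
        show "Cv * ((g - g') / g') < r0"
          using small(1) mult_left_mono[OF ratio Cv_nonneg] by linarith
      qed (use g' good_reach reach_t in auto)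
      have "norm (dev (?c g) (predictor F k ?e (g *\<^sub>R seg_mu P i) \<theta>)) \<le> norm (dev (?c g) \<theta>) + Kp * ?e"
        using basin[OF good_reach[OF r[unfolded x]], of \<theta>] t e by (simp add: x tracks_def)
      also have "\<dots> \<le> C2 * \<epsilon> + Kp * \<eta>"
        using t(2) e radii_pos by (intro add_mono mult_left_mono) (auto simp: x tracks_def)
      finally have "norm (dev (?c g) (predictor F k ?e (g *\<^sub>R seg_mu P i) \<theta>) - dev (?c g) (hln (?c g')))
          \<le> (C2 * \<epsilon> + Kp * \<eta>) + Cv * (2 * \<eta>)"
        using var mult_left_mono[OF ratio Cv_nonneg] norm_triangle_ineq4 order_trans by (smt (verit))
      then have "(1 + norm (1 :: real^'n)) * norm (dev (?c g) (predictor F k ?e (g *\<^sub>R seg_mu P i) \<theta>) - dev (?c g) (hln (?c g')))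
          \<le> (1 + norm (1 :: real^'n)) * (C2 * \<epsilon> + Kp * \<eta> + Cv * (2 * \<eta>))"
        by (intro mult_left_mono) auto
      moreover have "pos (?c g')" using good_reach[OF g'(2)] by (simp add: good_def)
      ultimately have "norm (dev (?c g') (predictor F k ?e (g *\<^sub>R seg_mu P i) \<theta>)) \<le> r0"
        using small(2) norm_pr_le[OF pos_simplex[of "?c g'"]] hln_eq_dev[of "?c g'" _ "?c g"]
        by (metis (no_types, lifting) order_trans pos_def)
      then show ?thesis using True g'(1) by (simp add: x tracks_def path_point_def)
    qed
  qed
qed

end

lemma bounded_bilinear_hprod: "bounded_bilinear hprod"
proof
  show "\<exists>K. \<forall>a b. norm (hprod a b) \<le> norm a * norm b * K"
    by (intro exI[of _ 1]) (simp add: norm_hprod_le)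
qed (simp_all add: hprod_def vec_eq_iff algebra_simps)

section \<open>The end point for level zero\<close>

text \<open>At a bundle point with \<open>\<mu> = 0\<close> an entry with \<open>\<sigma> $ i = 0\<close> and \<open>F \<sigma> $ i = \<sigma> \<bullet> F \<sigma>\<close> would put
  the \<open>i\<close>-th unit vector into the kernel of \<open>J\<close>. Hence strict complementarity holds, and a tangent
  vector in the kernel of the derivative of \<open>G F \<cdot> 0\<close> lifts to a kernel vector of \<open>J\<close>.\<close>

lemma endpoint_kernel_trivial:
  fixes F :: "real^'n \<Rightarrow> real^'n"
  assumes s: "s \<in> std_simplex" and G0: "G F s 0 = 0" and inv: "invertible (J F k s)"
    and x0: "vsum x = 0"
    and Lx: "hprod s (jacobian F (at s) *v x) + hprod x (F s)
      - ((s \<bullet> F s) *\<^sub>R x + (s \<bullet> (jacobian F (at s) *v x) + x \<bullet> F s) *\<^sub>R s) = 0"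
  shows "x = 0"
proof -
  define f c D \<tau> where "f = F s" and "c = s \<bullet> F s" and "D = jacobian F (at s) *v x"
    and "\<tau> = s \<bullet> D"
  have v0: "vsum 0 = 0" by (simp add: vsum_inner)
  have cf: "s $ i * (f $ i - c) = 0" for i
    using G0 by (simp add: G_eq v0 vec_eq_iff hprod_def f_def c_def algebra_simps)
  have ker: "y = 0" if "J F k s *v y = 0" for y
    using inv that by (simp add: invertible_iff_ker)
  have ne: "f $ i \<noteq> c" if si: "s $ i = 0" for i
  proof
    assume fi: "f $ i = c"
    let ?e = "axis i 1 :: real^'n"
    have 1: "s \<bullet> ?e = 0" by (simp add: inner_axis si)
    have 2: "hprod s ?e = 0" by (simp add: vec_eq_iff hprod_def axis_def si)
    have 3: "hprod (pr s (F s)) ?e = 0"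
      using fi by (simp add: vec_eq_iff hprod_def axis_def pr_def f_def c_def)
    have "J F k s *v ?e = 0" by (simp add: J_mult pr_id[OF 1] 1 2 3 pr_id[of s 0])
    then have "?e = 0" by (rule ker)
    then show False by (simp add: axis_eq_0_iff)
  qed
  have Li: "s $ i * D $ i + x $ i * f $ i - (c * x $ i + (\<tau> + x \<bullet> f) * s $ i) = 0" for i
    using arg_cong[OF Lx, of "\<lambda>w. w $ i"] by (simp add: hprod_def f_def c_def D_def \<tau>_def)
  have xoff: "x $ i = 0" if si: "s $ i = 0" for i
  proof -
    have "x $ i * (f $ i - c) = 0" using Li[of i] si by (simp add: algebra_simps)
    then show ?thesis using ne[OF si] by simp
  qed
  \<comment> \<open>On the support of \<open>s\<close> the entries of \<open>f\<close> equal
    \<open>c\<close>; off the support \<open>x\<close> vanishes.\<close>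
  have "x \<bullet> f = c * vsum x"
    unfolding inner_vec_def vsum_def sum_distrib_left
  proof (rule sum.cong)
    fix i show "inner (x $ i) (f $ i) = c * x $ i" using cf[of i] xoff[of i] by (cases "s $ i = 0") auto
  qed simp
  then have xf: "x \<bullet> f = 0" by (simp add: x0)
  have on: "D $ i = \<tau>" if "s $ i \<noteq> 0" for i
  proof -
    have "f $ i = c" using cf[of i] that by simp
    then have "s $ i * D $ i = s $ i * \<tau>" using Li[of i] xf by (simp add: algebra_simps)
    then show ?thesis using that by simp
  qed
  \<comment> \<open>On the support \<open>y\<close> is forced by \<open>hprod s y = x\<close>. Off
    the support that equation leaves it free, and its value makes \<open>(f $ i - c) * y $ i\<close>
    cancel \<open>D $ i - \<tau>\<close>; strict complementarity permits the division.\<close>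
  define y :: "real^'n" where "y = (\<chi> i. if s $ i = 0 then - (D $ i - \<tau>) / (f $ i - c) else x $ i / s $ i)"
  have sy: "hprod s y = x" using xoff by (simp add: vec_eq_iff hprod_def y_def)
  have "s \<bullet> y = vsum (hprod s y)" by (simp add: inner_vec_def vsum_def hprod_def)
  then have s0: "s \<bullet> y = 0" by (simp add: sy x0)
  define w where "w = hprod (pr s (F s)) y"
  have wi: "w $ i = (f $ i - c) * y $ i" for i by (simp add: w_def hprod_def pr_def f_def c_def)
  have "s \<bullet> w = 0"
    unfolding inner_vec_def wi using cf by (intro sum.neutral ballI) auto
  then have "J F k s *v y = D - \<tau> *\<^sub>R 1 + w"
    using s0 by (simp add: J_mult pr_id sy pr_add D_def[symmetric] w_def[symmetric] \<tau>_def)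
      (simp add: pr_def \<tau>_def)
  also have "\<dots> = 0"
  proof -
    have "D $ i - \<tau> + w $ i = 0" for i
      using on[of i] ne[of i] cf[of i] by (cases "s $ i = 0") (simp_all add: wi y_def)
    then show ?thesis by (simp add: vec_eq_iff)
  qed
  finally have "y = 0" by (rule ker)
  then show ?thesis using sy by (simp add: hprod_def vec_eq_iff)
qed

text \<open>By \<open>endpoint_kernel_trivial\<close> the derivative \<open>L\<close> is injective
  on the tangent space of the simplex, hence bounded below by \<open>m\<close> on its unit sphere;
  the remainder of the expansion takes away half of \<open>m\<close>.\<close>

lemma endpoint_lower_bound:
  fixes F :: "real^'n \<Rightarrow> real^'n"
  assumes s: "s \<in> std_simplex" and G0: "G F s 0 = 0" and inv: "invertible (J F k s)"
    and D: "(F has_derivative (\<lambda>z. jacobian F (at s) *v z)) (at s)"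
  shows "\<exists>c>0. \<exists>\<rho>>0. \<forall>\<sigma>\<in>std_simplex. norm (\<sigma> - s) < \<rho> \<longrightarrow> c * norm (\<sigma> - s) \<le> norm (G F \<sigma> 0)"
proof -
  define L where "L x = hprod s (jacobian F (at s) *v x) + hprod x (F s)
      - ((s \<bullet> F s) *\<^sub>R x + (s \<bullet> (jacobian F (at s) *v x) + x \<bullet> F s) *\<^sub>R s)" for x
  have v0: "vsum (0 :: real^'n) = 0" by (simp add: vsum_inner)
  have "((\<lambda>\<sigma>. hprod \<sigma> (F \<sigma>) - (\<sigma> \<bullet> F \<sigma>) *\<^sub>R \<sigma>) has_derivative L) (at s)"
    unfolding L_def
    by (intro derivative_intros bounded_bilinear.FDERIV[OF bounded_bilinear_hprod] D)
  then have G': "((\<lambda>\<sigma>. G F \<sigma> 0) has_derivative L) (at s)" by (simp add: G_eq v0)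
  then have lin: "linear L" by (rule has_derivative_linear)
  define K where "K = sphere (0 :: real^'n) 1 \<inter> {x. vsum x = 0}"
  have "closed {x :: real^'n. vsum x = 0}"
    unfolding vsum_inner by (intro closed_Collect_eq continuous_intros)
  then have "compact K" unfolding K_def by (rule compact_Int_closed[OF compact_sphere])
  moreover have "continuous_on K (\<lambda>x. norm (L x))"
    by (rule continuous_on_norm[OF linear_continuous_on[OF has_derivative_bounded_linear[OF G']]])
  moreover have "0 < norm (L x)" if "x \<in> K" for x
    using that endpoint_kernel_trivial[OF s G0 inv, of x] by (auto simp: K_def L_def)
  ultimately have "\<exists>m>0. \<forall>x\<in>K. m \<le> norm (L x)" by (rule compact_pos_min)
  then obtain m where m: "m > 0" "\<And>x. x \<in> K \<Longrightarrow> m \<le> norm (L x)" by blast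
  have lower: "m * norm x \<le> norm (L x)" if x0: "vsum x = 0" for x
  proof (cases "x = 0")
    case False
    have "inverse (norm x) *\<^sub>R x \<in> K" using False x0 by (simp add: K_def vsum_scaleR)
    from m(2)[OF this] have "m \<le> norm (L x) / norm x"
      by (simp add: linear_scale[OF lin] divide_inverse mult.commute)
    then show ?thesis using False by (simp add: field_simps)
  qed simp
  have "m / 2 > 0" using m by simp
  then obtain \<rho> where \<rho>: "\<rho> > 0"
    "\<And>\<sigma>. norm (\<sigma> - s) < \<rho> \<Longrightarrow> norm (G F \<sigma> 0 - G F s 0 - L (\<sigma> - s)) \<le> m / 2 * norm (\<sigma> - s)"
    using G' unfolding has_derivative_at_alt by blast
  have "m / 2 * norm (\<sigma> - s) \<le> norm (G F \<sigma> 0)" if "\<sigma> \<in> std_simplex" "norm (\<sigma> - s) < \<rho>" for \<sigma>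
  proof -
    have "vsum (\<sigma> - s) = 0"
      using that(1) s by (simp add: vsum_inner inner_diff_left std_simplex_def)
    from lower[OF this] \<rho>(2)[OF that(2)] show ?thesis
      using norm_triangle_sub[of "L (\<sigma> - s)" "G F \<sigma> 0"] by (simp add: G0 norm_minus_commute)
  qed
  then show ?thesis using \<open>m / 2 > 0\<close> \<rho>(1) by blast
qed

lemma simplex_dist: "\<sigma> \<in> std_simplex \<Longrightarrow> \<tau> \<in> std_simplex \<Longrightarrow> norm (\<sigma> - \<tau>) \<le> 2"
  using norm_triangle_ineq4[of \<sigma> \<tau>] simplex_norm[of \<sigma>] simplex_norm[of \<tau>] by simp

context path_data
begin

lemma last_seg: "seg_num P \<in> {1..seg_num P}"
  using seg_num_pos by simp

lemma last_on_path: "on_path (seg_num P) 0"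
  using seg_num_pos gam_last by (simp add: on_path_def)

lemma last_curve: "seg_curve P (seg_num P) 0 = seg_sig P (seg_num P)"
  using seg(7)[OF last_seg] by (simp add: gam_last)

text \<open>On the bundle \<open>G F \<sigma> 0\<close> is \<open>g\<close> times a bounded vector,
  so near the end \<open>endpoint_lower_bound\<close> yields a distance of order \<open>g\<close>.
  On earlier segments, and on the last one above \<open>g0\<close>, \<open>g\<close> is bounded away
  from 0 and the diameter bound 2 of the simplex suffices.\<close>

lemma endpoint_rate:
  assumes C1: "C1_near std_simplex F" and inv: "invertible (J F k (seg_sig P (seg_num P)))"
  shows "\<exists>C>0. \<forall>i g. on_path i g \<and> 0 < g \<longrightarrow> norm (seg_curve P i g - seg_sig P (seg_num P)) \<le> C * g"
proof -
  let ?q = "seg_num P" and ?s = "seg_sig P (seg_num P)"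
  have s: "?s \<in> std_simplex" using on_path_simplex[OF last_on_path] by (simp add: last_curve)
  have G0: "G F ?s 0 = 0" using on_path_bundle[OF last_on_path] by (simp add: last_curve fp_bundle_def)
  obtain c \<rho> where c: "c > 0" "\<rho> > 0"
    "\<And>\<sigma>. \<sigma> \<in> std_simplex \<Longrightarrow> norm (\<sigma> - ?s) < \<rho> \<Longrightarrow> c * norm (\<sigma> - ?s) \<le> norm (G F \<sigma> 0)"
    using endpoint_lower_bound[OF s G0 inv] C1_jacobian[OF C1] s by blast
  have "continuous_on {0..1} (seg_curve P ?q)" using seg(5)[OF last_seg] by (simp add: gam_last)
  then obtain g0 where g0: "g0 > 0" "\<And>g. g \<in> {0..1} \<Longrightarrow> dist g 0 < g0 \<Longrightarrow> dist (seg_curve P ?q g) ?s < \<rho>"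
    using c(2) last_curve unfolding continuous_on_iff by (metis atLeastAtMost_iff order_refl zero_le_one)
  obtain V where V: "V > 0" "\<And>i. i \<in> {1..?q} \<Longrightarrow> vsum (seg_mu P i) \<le> V" "\<And>i. i \<in> {1..?q} \<Longrightarrow> norm (seg_mu P i) \<le> V"
    using mu_bounds by blast
  define W where "W = (\<Sum>j\<in>{1..<?q}. 2 / seg_gam P j)"
  have gam: "0 < seg_gam P j" if "j \<in> {1..<?q}" for j using that by (intro seg(4)) auto
  have W: "0 \<le> W" unfolding W_def by (intro sum_nonneg) (use gam in \<open>auto simp: less_imp_le\<close>)
  define C where "C = 2 * V / c + 2 / g0 + W"
  have parts: "0 < 2 * V / c" "0 < 2 / g0" using V c g0 by auto
  have C: "0 < C" "2 * V / c \<le> C" "2 / g0 \<le> C" "W \<le> C" using parts W unfolding C_def by linarith+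
  have "norm (seg_curve P i g - ?s) \<le> C * g" if o: "on_path i g" and g: "0 < g" for i g
  proof -
    let ?\<sigma> = "seg_curve P i g"
    have i: "i \<in> {1..?q}" and g1: "g \<le> 1" "seg_gam P i \<le> g" using o by (auto simp: on_path_def)
    have \<sigma>: "?\<sigma> \<in> std_simplex" by (rule on_path_simplex[OF o])
    note two = simplex_dist[OF \<sigma> s]
    consider "i < ?q" | "i = ?q" "g0 \<le> g" | "i = ?q" "g < g0" using i by fastforce
    then show ?thesis
    proof cases
      case 1
      then have j: "i \<in> {1..<?q}" using i by simp
      have "2 / seg_gam P i \<le> W"
        unfolding W_def using gam j by (intro member_le_sum) (auto simp: less_imp_le)
      then have "2 / seg_gam P i \<le> C" using C(4) by linarith
      then have "2 / seg_gam P i * seg_gam P i \<le> C * g"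
        using gam[OF j] g1 C by (intro mult_mono) auto
      then show ?thesis using two gam[OF j] by simp
    next
      case 2
      have "2 / g0 * g0 \<le> C * g" using 2 g0 C by (intro mult_mono) auto
      then show ?thesis using two g0 by simp
    next
      case 3
      have "norm (?\<sigma> - ?s) < \<rho>" using g0(2)[of g] 3 g g1 by (simp add: dist_norm)
      from c(3)[OF \<sigma> this] have "c * norm (?\<sigma> - ?s) \<le> norm (G F ?\<sigma> 0)" .
      also have "G F ?\<sigma> 0 = g *\<^sub>R (seg_mu P i - vsum (seg_mu P i) *\<^sub>R ?\<sigma>)"
        using on_path_bundle[OF o] by (simp add: fp_bundle_def G_eq vsum_scaleR vsum_inner[of 0] algebra_simps)
      also have "norm \<dots> \<le> g * (V + V * 1)"
      proof -
        have "vsum (seg_mu P i) * norm ?\<sigma> \<le> V * 1"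
          using V(1) vsum_mu_pos[OF i] by (intro mult_mono V(2)[OF i] simplex_norm[OF \<sigma>]) auto
        then have "norm (seg_mu P i - vsum (seg_mu P i) *\<^sub>R ?\<sigma>) \<le> V + V * 1"
          using V(3)[OF i] vsum_mu_pos[OF i]
            norm_triangle_ineq4[of "seg_mu P i" "vsum (seg_mu P i) *\<^sub>R ?\<sigma>"] by simp
        then show ?thesis using g by simp
      qed
      finally have "norm (?\<sigma> - ?s) \<le> 2 * V / c * g" using c(1) by (simp add: field_simps)
      also have "\<dots> \<le> C * g" using C(2) g by (intro mult_right_mono) auto
      finally show ?thesis .
    qed
  qed
  with C(1) show ?thesis by blast
qed

end

section \<open>Runs of the algorithm\<close>

lemma dist_Pair_le: "dist (a, b) (c, e) \<le> dist a c + dist b e"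
  unfolding dist_Pair_Pair by (rule sqrt_sum_squares_le_sum) auto

context path_tracking
begin

lemma path_point_eq: "path_point P x = (seg_curve P (fst x) (snd x), snd x *\<^sub>R seg_mu P (fst x))"
  by (simp add: path_point_def case_prod_beta)

lemma good_pos:
  assumes "reach \<zeta> x"
  shows "good (fst (path_point P x)) (snd (path_point P x))"
  using good_reach[of "fst x" "snd x"] assms by (simp add: path_point_eq)

lemma tracks_eq: "tracks \<theta> x = norm (dev (fst (path_point P x)) \<theta>)"
  by (simp add: tracks_def path_point_eq)

text \<open>The radius \<open>r0\<close> is split in halves: \<epsilon> may use up one and \<eta>
  the other. \<open>C2 * \<epsilon> \<le> 1 / 2\<close> puts corrected iterates in the range of
  \<open>softmax_lipschitz\<close>.\<close>

lemma step_size_exists: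
  "\<exists>\<eta> \<epsilon>. 0 < \<eta> \<and> \<eta> \<le> 1 / 2 \<and> 0 < \<epsilon> \<and> C2 * \<epsilon> \<le> 1 / 2 \<and> Cv * (2 * \<eta>) < r0 \<and>
    (1 + norm (1 :: real^'n)) * (C2 * \<epsilon> + Kp * \<eta> + Cv * (2 * \<eta>)) \<le> r0"
proof -
  let ?n = "1 + norm (1 :: real^'n)"
  have n: "1 \<le> ?n" by simp
  define a where "a = ?n * (Kp + 2 * Cv)"
  have kc: "0 < Kp + 2 * Cv" using radii_pos Cv_nonneg by simp
  have a1: "Kp + 2 * Cv \<le> a"
    using mult_right_mono[OF n less_imp_le[OF kc]] by (simp add: a_def)
  have a: "0 < a" "Kp + 2 * Cv \<le> a" using less_le_trans[OF kc a1] a1 by auto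
  define \<eta> where "\<eta> = min (1 / 2) (r0 / (2 * a))"
  define \<epsilon> where "\<epsilon> = min (1 / (2 * C2)) (r0 / (2 * (?n * C2)))"
  have nC: "0 < ?n * C2" by (rule mult_pos_pos) (use n radii_pos in linarith)+
  have \<eta>: "0 < \<eta>" "\<eta> \<le> 1 / 2" "\<eta> \<le> r0 / (2 * a)" using a radii_pos by (auto simp: \<eta>_def)
  have \<epsilon>: "0 < \<epsilon>" "\<epsilon> \<le> 1 / (2 * C2)" "\<epsilon> \<le> r0 / (2 * (?n * C2))" using nC radii_pos by (auto simp: \<epsilon>_def)
  have "a * \<eta> \<le> a * (r0 / (2 * a))" using \<eta>(3) a by (intro mult_left_mono) auto
  then have a\<eta>: "a * \<eta> \<le> r0 / 2" using a by simp
  have "(?n * C2) * \<epsilon> \<le> (?n * C2) * (r0 / (2 * (?n * C2)))" using \<epsilon>(3) nC by (intro mult_left_mono) auto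
  also have "\<dots> = r0 / 2"
  proof -
    have "X * (r0 / (2 * X)) = r0 / 2" if "0 < X" for X :: real using that by simp
    then show ?thesis using nC by blast
  qed
  finally have n\<epsilon>: "(?n * C2) * \<epsilon> \<le> r0 / 2" .
  have "?n * (C2 * \<epsilon> + Kp * \<eta> + Cv * (2 * \<eta>)) = (?n * C2) * \<epsilon> + a * \<eta>"
    by (simp add: a_def algebra_simps)
  then have 1: "?n * (C2 * \<epsilon> + Kp * \<eta> + Cv * (2 * \<eta>)) \<le> r0" using a\<eta> n\<epsilon> by linarith
  have "Cv * (2 * \<eta>) \<le> (Kp + 2 * Cv) * \<eta>" using radii_pos \<eta> by (simp add: algebra_simps)
  also have "\<dots> \<le> a * \<eta>" using a \<eta> by (intro mult_right_mono) auto
  finally have 2: "Cv * (2 * \<eta>) < r0" using a\<eta> radii_pos(1) by linarith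
  have 3: "C2 * \<epsilon> \<le> 1 / 2"
    using mult_left_mono[OF \<epsilon>(2), of C2] radii_pos by simp
  show ?thesis using 1 2 3 \<eta> \<epsilon> by blast
qed

end

locale path_run = path_tracking F k M d N r0 C1 C2 L Kp Cv \<sigma>init vinit P \<zeta>
  for F :: "real^'n \<Rightarrow> real^'n" and k M d :: real and N :: "((real^'n) \<times> (real^'n)) set"
    and r0 C1 C2 L Kp Cv :: real and \<sigma>init :: "real^'n" and vinit :: real and P :: "'n fp_path"
    and \<zeta> :: real +
  fixes \<eta> \<epsilon> :: real
  assumes start: "\<zeta> < vsum (seg_mu P 1)"
    and eta: "0 < \<eta>" "\<eta> \<le> 1 / 2" and eps: "0 < \<epsilon>" "C2 * \<epsilon> \<le> 1 / 2"
    and small: "Cv * (2 * \<eta>) < r0" "(1 + norm (1 :: real^'n)) * (C2 * \<epsilon> + Kp * \<eta> + Cv * (2 * \<eta>)) \<le> r0"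
begin

abbreviation ps :: "nat \<Rightarrow> nat \<times> real" where "ps \<equiv> pc_pos P \<zeta> \<eta>"
abbreviation pm :: "nat \<Rightarrow> real^'n" where "pm \<equiv> pc_mu P \<zeta> \<eta>"

lemma eta1: "\<eta> < 1" using eta by simp

lemma reach_ps: "reach \<zeta> (ps t)"
  by (rule reach_pos[OF start eta(1) eta1])

lemma good_ps: "good (fst (path_point P (ps t))) (pm t)"
  unfolding pc_mu_def by (rule good_pos[OF reach_ps])

lemma corrects_tracks:
  assumes "tracks \<theta> (ps t) \<le> r0" "corrects_to F k (pm t) \<delta> \<theta> \<theta>'"
  shows "tracks \<theta>' (ps t) \<le> r0" "tracks \<theta>' (ps t) \<le> C2 * \<delta>"
  using basin_corrects_to(2)[OF good_ps _ assms(2)] assms(1) by (auto simp: tracks_eq)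

lemma pc_run_mono: "pc_run F k P \<zeta> \<eta> tol T \<theta>in \<theta> \<Longrightarrow> t \<le> T \<Longrightarrow> pc_run F k P \<zeta> \<eta> tol t \<theta>in \<theta>"
  by (simp add: pc_run_def)

lemma run_tracks:
  assumes "pc_run F k P \<zeta> \<eta> tol T \<theta>in \<theta>" and tol: "\<And>t. tol t \<le> \<epsilon>"
  shows "tracks (\<theta>in T) (ps T) \<le> r0"
  using assms(1)
proof (induction T)
  case 0
  have "seg_curve P 1 1 = seg_sig P 0" using seg(6)[of 1] seg_num_pos by simp
  moreover have "softmax (\<theta>in 0) = seg_sig P 0" using 0 by (simp add: pc_run_def)
  moreover have "pos (seg_curve P 1 1)" using good_ps[of 0] by (simp add: good_def pc_pos_0 path_point_eq)
  ultimately have "tracks (\<theta>in 0) (ps 0) = 0" by (simp add: tracks_def pc_pos_0 dev_eq_0)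
  then show ?case using radii_pos by simp
next
  case (Suc T)
  have "pc_run F k P \<zeta> \<eta> tol T \<theta>in \<theta>" by (rule pc_run_mono[OF Suc.prems]) simp
  then have t: "tracks (\<theta>in T) (ps T) \<le> r0" by (rule Suc.IH)
  have c: "corrects_to F k (pm T) (tol T) (\<theta>in T) (\<theta> T)" and
    n: "\<theta>in (Suc T) = (if pc_predicts P \<zeta> (ps T)
           then predictor F k (1 - snd (ps (Suc T)) / snd (ps T)) (pm T) (\<theta> T) else \<theta> T)"
    using Suc.prems by (auto simp: pc_run_def)
  note ct = corrects_tracks[OF t c]
  have "C2 * tol T \<le> C2 * \<epsilon>" using tol radii_pos by (intro mult_left_mono) auto
  then have "tracks (\<theta> T) (ps T) \<le> C2 * \<epsilon>" using ct(2) by linarith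
  from tracks_next[OF reach_ps eta ct(1) this small] show ?case
    unfolding n pc_pos_Suc pc_mu_def .
qed

lemma run_tracks_corrected:
  assumes "pc_run F k P \<zeta> \<eta> tol T \<theta>in \<theta>" "\<And>t. tol t \<le> \<epsilon>" "t < T"
  shows "tracks (\<theta> t) (ps t) \<le> r0" "tracks (\<theta> t) (ps t) \<le> C2 * tol t"
proof -
  have "tracks (\<theta>in t) (ps t) \<le> r0"
    using run_tracks[OF pc_run_mono[OF assms(1), of t] assms(2)] assms(3) by simp
  moreover have "corrects_to F k (pm t) (tol t) (\<theta>in t) (\<theta> t)"
    using assms(1,3) by (simp add: pc_run_def)
  ultimately show "tracks (\<theta> t) (ps t) \<le> r0" "tracks (\<theta> t) (ps t) \<le> C2 * tol t"
    using corrects_tracks by blast+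
qed

lemma run_close:
  assumes "pc_run F k P \<zeta> \<eta> tol T \<theta>in \<theta>" "\<And>t. tol t \<le> \<epsilon>" "t < T"
  shows "norm (softmax (\<theta> t) - fst (path_point P (ps t))) \<le> 3 * C2 * tol t"
proof -
  note t = run_tracks_corrected[OF assms]
  have "C2 * tol t \<le> C2 * \<epsilon>" using assms(2) radii_pos by (intro mult_left_mono) auto
  then have h: "norm (dev (fst (path_point P (ps t))) (\<theta> t)) \<le> 1 / 2"
    using t(2) eps(2) by (simp add: tracks_eq)
  have "pos (fst (path_point P (ps t)))" using good_ps[of t] by (simp add: good_def)
  from softmax_lipschitz[OF this h] show ?thesis using t(2) by (simp add: tracks_eq)
qed

text \<open>The choice in \<open>cor\<close> is meaningful only where the corrector can reach its
  tolerance. \<open>run_tracks\<close> guarantees this at \<open>T\<close> from the run up to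
  \<open>T\<close>, so the choices are justified along the induction although
  \<open>\<theta>in\<close> is defined for all steps beforehand.\<close>

lemma run_exists:
  assumes tol: "\<And>t. 0 < tol t \<and> tol t \<le> \<epsilon>"
  shows "\<exists>\<theta>in \<theta>. \<forall>T. pc_run F k P \<zeta> \<eta> tol T \<theta>in \<theta>"
proof -
  define cor where "cor t \<theta> = (SOME \<theta>'. corrects_to F k (pm t) (tol t) \<theta> \<theta>')" for t \<theta>
  define \<theta>in where "\<theta>in = rec_nat (hln (seg_sig P 0)) (\<lambda>t x.
      if pc_predicts P \<zeta> (ps t)
      then predictor F k (1 - snd (ps (Suc t)) / snd (ps t)) (pm t) (cor t x) else cor t x)"
  define \<theta> where "\<theta> t = cor t (\<theta>in t)" for t
  have "pc_run F k P \<zeta> \<eta> tol T \<theta>in \<theta>" for T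
  proof (induction T)
    case 0
    have "pos (seg_curve P 1 1)" using good_ps[of 0] by (simp add: good_def pc_pos_0 path_point_eq)
    then have "pos (seg_sig P 0)" using seg(6)[of 1] seg_num_pos by simp
    then show ?case by (simp add: pc_run_def \<theta>in_def softmax_hln)
  next
    case (Suc T)
    have "tracks (\<theta>in T) (ps T) \<le> r0" by (rule run_tracks[OF Suc]) (use tol in blast)
    then have "\<exists>\<theta>'. corrects_to F k (pm T) (tol T) (\<theta>in T) \<theta>'"
      using basin_corrects_to(1)[OF good_ps] tol by (simp add: tracks_eq)
    then have "corrects_to F k (pm T) (tol T) (\<theta>in T) (\<theta> T)"
      unfolding \<theta>_def cor_def by (rule someI_ex)
    moreover have "\<theta>in (Suc T) = (if pc_predicts P \<zeta> (ps T)
           then predictor F k (1 - snd (ps (Suc T)) / snd (ps T)) (pm T) (\<theta> T) else \<theta> T)"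
      by (simp add: \<theta>in_def \<theta>_def)
    ultimately show ?case using Suc by (auto simp: pc_run_def less_Suc_eq)
  qed
  then show ?thesis by blast
qed

lemma level_bound: "\<exists>A>0. \<forall>t. \<not> pc_halted P \<zeta> (ps t) \<longrightarrow>
    snd (ps t) \<le> A * (1 - \<eta>) ^ t \<and> vsum (pm t) \<le> A * (1 - \<eta>) ^ t"
proof -
  obtain A where A: "A > 0" "\<And>t. \<not> pc_halted P \<zeta> (ps t) \<Longrightarrow> snd (ps t) \<le> A * (1 - \<eta>) ^ t"
    using level_decay[OF start eta(1) eta1] by blast
  obtain V where V: "V > 0" "\<And>i. i \<in> {1..seg_num P} \<Longrightarrow> vsum (seg_mu P i) \<le> V"
    using mu_bounds by blast
  \<comment> \<open>\<open>max 1 V\<close> lets one constant serve both the parameter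
    \<open>g\<close> and the level.\<close>
  define B where "B = A * max 1 V"
  have B: "0 < B" "A \<le> B" "A * V \<le> B" using A(1) V(1) by (auto simp: B_def)
  have q: "0 \<le> (1 - \<eta>) ^ t" for t using eta1 by simp
  have "snd (ps t) \<le> B * (1 - \<eta>) ^ t \<and> vsum (pm t) \<le> B * (1 - \<eta>) ^ t"
    if h: "\<not> pc_halted P \<zeta> (ps t)" for t
  proof
    show "snd (ps t) \<le> B * (1 - \<eta>) ^ t"
      using A(2)[OF h] mult_right_mono[OF B(2) q] by (rule order_trans)
    have i: "fst (ps t) \<in> {1..seg_num P}" "0 < snd (ps t)"
      using reach_ps[of t] by (auto simp: reach_def on_path_def)
    have "vsum (pm t) = snd (ps t) * vsum (seg_mu P (fst (ps t)))"
      by (simp add: pc_mu_def path_point_eq vsum_scaleR)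
    also have "\<dots> \<le> (A * (1 - \<eta>) ^ t) * V"
      using A(2)[OF h] V i vsum_mu_pos[OF i(1)] A(1) q[of t] by (intro mult_mono) auto
    also have "\<dots> \<le> B * (1 - \<eta>) ^ t" using mult_right_mono[OF B(3) q[of t]] by (simp add: mult_ac)
    finally show "vsum (pm t) \<le> B * (1 - \<eta>) ^ t" .
  qed
  with B(1) show ?thesis by blast
qed

lemma halts:
  assumes "0 < \<zeta>"
  shows "\<exists>t. pc_halted P \<zeta> (ps t)"
proof (rule ccontr)
  assume no: "\<nexists>t. pc_halted P \<zeta> (ps t)"
  obtain A where A: "A > 0" "\<And>t. \<not> pc_halted P \<zeta> (ps t) \<Longrightarrow> vsum (pm t) \<le> A * (1 - \<eta>) ^ t"
    using level_bound by blast
  obtain t where "(1 - \<eta>) ^ t < \<zeta> / A"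
    using real_arch_pow_inv[of "\<zeta> / A" "1 - \<eta>"] A(1) assms eta by auto
  then have "A * (1 - \<eta>) ^ t < \<zeta>" using A(1) by (simp add: pos_less_divide_eq mult.commute)
  moreover have "\<zeta> < vsum (pm t)"
    using no pc_halted_eq[of \<zeta> "fst (ps t)" "snd (ps t)"]
    by (auto simp: pc_mu_def path_point_eq vsum_scaleR)
  ultimately show False using A(2)[of t] no by force
qed

lemma ps_path_set: "path_point P (ps t) \<in> path_set P"
proof -
  have "on_path (fst (ps t)) (snd (ps t))" using reach_ps[of t] by (simp add: reach_def)
  then show ?thesis unfolding path_point_eq path_set_iff by blast
qed

text \<open>For \<zeta> = 0 the run never halts; \<open>level_bound\<close> makes \<open>g\<close>
  decay geometrically and \<open>endpoint_rate\<close> turns this into a rate for the distance. For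
  \<zeta> > 0 the run halts after finitely many steps, and the constant is built from the distances
  up to that step.\<close>

lemma endpoint_convergence:
  assumes inv: "\<zeta> = 0 \<longrightarrow> invertible (J F k (seg_sig P (seg_num P)))"
  shows "\<exists>\<sigma>e \<mu>e C. 0 < C \<and> (\<sigma>e, \<mu>e) \<in> path_set P \<and>
     (\<forall>t. pc_halted P \<zeta> (ps t) \<longrightarrow> path_point P (ps t) = (\<sigma>e, \<mu>e)) \<and>
     (vsum \<mu>e = \<zeta> \<or> (\<exists>i\<in>{1..<seg_num P}. (\<sigma>e, \<mu>e) = path_point P (i, seg_gam P i) \<and>
        vsum (seg_mu P (i + 1)) \<le> \<zeta>)) \<and>
     (\<zeta> = 0 \<longrightarrow> (\<sigma>e, \<mu>e) = (seg_sig P (seg_num P), 0)) \<and>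
     (\<forall>t. dist (path_point P (ps t)) (\<sigma>e, \<mu>e) \<le> C * (1 - \<eta>) ^ t)"
proof (cases "\<zeta> = 0")
  case True
  have never: "\<not> pc_halted P \<zeta> (ps t)" for t
    using halted_end(1)[of \<zeta> "fst (ps t)" "snd (ps t)"] reach_ps[of t] True by auto
  obtain A where A: "A > 0" "\<And>t. snd (ps t) \<le> A * (1 - \<eta>) ^ t"
    using level_bound never by blast
  obtain E where E: "E > 0" "\<And>i g. on_path i g \<Longrightarrow> 0 < g \<Longrightarrow>
      norm (seg_curve P i g - seg_sig P (seg_num P)) \<le> E * g"
    using endpoint_rate[OF C1 inv[rule_format, OF True]] by blast
  obtain V where V: "V > 0" "\<And>i. i \<in> {1..seg_num P} \<Longrightarrow> norm (seg_mu P i) \<le> V"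
    using mu_bounds by blast
  have d: "dist (path_point P (ps t)) (seg_sig P (seg_num P), 0) \<le> ((E + V) * A) * (1 - \<eta>) ^ t" for t
  proof -
    obtain i g where e: "ps t = (i, g)" by fastforce
    have o: "on_path i g" "0 < g" using reach_ps[of t] by (auto simp: reach_def e)
    have "dist (path_point P (ps t)) (seg_sig P (seg_num P), 0)
        \<le> norm (seg_curve P i g - seg_sig P (seg_num P)) + norm (g *\<^sub>R seg_mu P i)"
      using dist_Pair_le[of "seg_curve P i g" "g *\<^sub>R seg_mu P i" "seg_sig P (seg_num P)" 0]
      by (simp add: path_point_eq e dist_norm)
    also have "\<dots> \<le> E * g + g * V"
      using E(2)[OF o] V(2)[of i] o by (intro add_mono) (auto simp: on_path_def)
    also have "\<dots> = (E + V) * g" by (simp add: algebra_simps)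
    also have "\<dots> \<le> (E + V) * (A * (1 - \<eta>) ^ t)"
      using A(2)[of t] E V by (intro mult_left_mono) (auto simp: e)
    finally show ?thesis by (simp add: mult_ac)
  qed
  have mem: "(seg_sig P (seg_num P), 0) \<in> path_set P"
    unfolding path_set_iff by (intro exI[of _ "seg_num P"] exI[of _ 0]) (simp add: last_on_path last_curve)
  have v0: "vsum (0 :: real^'n) = \<zeta>" by (simp add: vsum_inner True)
  have "0 < (E + V) * A" using E V A by simp
  then show ?thesis
    using d mem never v0 by (intro exI[of _ "seg_sig P (seg_num P)"] exI[of _ 0] exI[of _ "(E + V) * A"] conjI) auto
next
  case False
  then have z: "0 < \<zeta>" using zeta_nonneg by simp
  then obtain t0 where h: "pc_halted P \<zeta> (ps t0)" using halts by blast
  obtain i g where e: "ps t0 = (i, g)" by fastforce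
  obtain \<sigma>e \<mu>e where pe: "path_point P (ps t0) = (\<sigma>e, \<mu>e)" by fastforce
  have r: "reach \<zeta> (i, g)" using reach_ps[of t0] by (simp add: e)
  have end_cases: "vsum \<mu>e = \<zeta> \<or> (\<exists>i\<in>{1..<seg_num P}. (\<sigma>e, \<mu>e) = path_point P (i, seg_gam P i) \<and>
        vsum (seg_mu P (i + 1)) \<le> \<zeta>)"
  proof -
    have "\<mu>e = g *\<^sub>R seg_mu P i" "(\<sigma>e, \<mu>e) = path_point P (i, g)" using pe e by (auto simp: path_point_eq)
    then show ?thesis using halted_end(2)[OF r h[unfolded e] zeta_nonneg] by (auto simp: vsum_scaleR)
  qed
  have uniq: "path_point P (ps t) = (\<sigma>e, \<mu>e)" if "pc_halted P \<zeta> (ps t)" for t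
    using pc_pos_halted_unique[OF h that] pe by simp
  define D where "D = (\<Sum>t\<le>t0. dist (path_point P (ps t)) (\<sigma>e, \<mu>e) / (1 - \<eta>) ^ t)"
  have q: "0 < (1 - \<eta>) ^ t" for t using eta1 by simp
  have D: "0 \<le> D" unfolding D_def using q by (intro sum_nonneg divide_nonneg_pos) auto
  have "dist (path_point P (ps t)) (\<sigma>e, \<mu>e) \<le> (D + 1) * (1 - \<eta>) ^ t" for t
  proof (cases "t \<le> t0")
    case True
    then have "dist (path_point P (ps t)) (\<sigma>e, \<mu>e) / (1 - \<eta>) ^ t \<le> D"
      unfolding D_def using less_imp_le[OF q]
      by (intro member_le_sum[where f = "\<lambda>t. dist (path_point P (ps t)) (\<sigma>e, \<mu>e) / (1 - \<eta>) ^ t"]) auto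
    then have "dist (path_point P (ps t)) (\<sigma>e, \<mu>e) / (1 - \<eta>) ^ t \<le> D + 1" by simp
    then show ?thesis by (simp only: pos_divide_le_eq[OF q])
  next
    case False
    then have "ps t = ps t0" using pc_pos_halted_mono[OF h, of t] by simp
    then show ?thesis using D q[of t] by (simp add: pe)
  qed
  moreover have "(\<sigma>e, \<mu>e) \<in> path_set P" using ps_path_set[of t0] by (simp add: pe)
  moreover have "0 < D + 1" using D by simp
  ultimately show ?thesis
    using uniq end_cases False by (intro exI[of _ \<sigma>e] exI[of _ \<mu>e] exI[of _ "D + 1"]) blast
qed

end

section \<open>Choice of the constants and assembly of the global statement\<close>

theorem mainTheorem1:
  fixes F :: "real^'n \<Rightarrow> real^'n"
    and k d \<zeta> vinit :: real
    and \<sigma>init \<sigma>star :: "real^'n"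
    and P :: "'n fp_path"
    and N :: "((real^'n) \<times> (real^'n)) set"
  assumes F_C1: "C1_near std_simplex F"
    and path: "is_path F \<sigma>init vinit P"
    and end_pt: "\<sigma>star = seg_sig P (seg_num P)"
    and path_regular: "path_set P \<inter> singular_manifold F k \<subseteq> {(\<sigma>star, 0)}"
    and zeta: "0 \<le> \<zeta>" "\<not> invertible (J F k \<sigma>star) \<longrightarrow> \<zeta> \<noteq> 0"
    and d: "0 < d"
    and N_def: "N = path_nbhd P d \<zeta>"
    and N_regular: "N \<inter> singular_manifold F k = {}"
    and F_C2: "C2_near (fst ` N) F"
    and k: "k \<noteq> 0" "\<forall>(\<sigma>, \<mu>)\<in>N. k + vsum \<mu> \<noteq> 0"
  shows
    \<comment> \<open>(1) uniform quadratic convergence of the corrector\<close>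
    "(\<exists>C1>0. \<exists>\<delta>>0. \<forall>\<theta> \<mu>. (softmax \<theta>, \<mu>) \<in> N \<longrightarrow>
       (norm (Gt F (softmax \<theta>) \<mu>) \<le> \<delta> \<longrightarrow> invertible (newton_mat F k \<mu> (softmax \<theta>))) \<and>
       (invertible (newton_mat F k \<mu> (softmax \<theta>)) \<and>
        (norm (Gt F (softmax \<theta>) \<mu>) \<le> \<delta> \<or>
         (softmax (corrector F k \<mu> \<theta>), \<mu>) \<in> N \<or>
         (\<forall>(s, m)\<in>N. invertible (newton_mat F k m s))) \<longrightarrow>
        norm (Gt F (softmax (corrector F k \<mu> \<theta>)) \<mu>) \<le> C1 * (norm (Gt F (softmax \<theta>) \<mu>))\<^sup>2)) \<and>
     (\<exists>r>0. \<forall>\<sigma>\<mu> \<mu> \<theta>. (\<sigma>\<mu>, \<mu>) \<in> path_set P \<and> \<zeta> < vsum \<mu> \<and> norm (\<theta> - hln \<sigma>\<mu>) \<le> r \<longrightarrow>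
       softmax \<theta> \<in> conv_region F k N \<mu>) \<and>
     (\<zeta> < vsum (seg_mu P 1) \<longrightarrow>
      (\<exists>\<eta> \<epsilon> C M. 0 < \<eta> \<and> \<eta> < 1 \<and> 0 < \<epsilon> \<and> 0 < C \<and>
       \<comment> \<open>(2) with step size \<open>\<eta>\<close> the algorithm never leaves the convergence region\<close>
       (\<forall>tol. (\<forall>t. 0 < tol t \<and> tol t \<le> \<epsilon>) \<longrightarrow>
          (\<exists>\<theta>in \<theta>. \<forall>T. pc_run F k P \<zeta> \<eta> tol T \<theta>in \<theta>) \<and>
          (\<forall>T \<theta>in \<theta>. pc_run F k P \<zeta> \<eta> tol T \<theta>in \<theta> \<longrightarrow>
             (\<forall>t\<le>T. softmax (\<theta>in t) \<in> conv_region F k N (pc_mu P \<zeta> \<eta> t) \<and>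
                (\<exists>m\<le>M. norm (Gt F (softmax ((corrector F k (pc_mu P \<zeta> \<eta> t) ^^ m) (\<theta>in t)))
                                 (pc_mu P \<zeta> \<eta> t)) \<le> \<epsilon>)) \<and>
             (\<forall>t<T. invertible (newton_mat F k (pc_mu P \<zeta> \<eta> t) (softmax (\<theta> t))) \<and>
                norm (softmax (\<theta> t) - fst (path_point P (pc_pos P \<zeta> \<eta> t))) \<le> C * tol t))) \<and>
       \<comment> \<open>(3) linear reduction of the level to \<open>\<zeta>\<close>\<close>
       (\<forall>t. \<not> pc_halted P \<zeta> (pc_pos P \<zeta> \<eta> t) \<longrightarrow>
          vsum (pc_mu P \<zeta> \<eta> t) \<le> C * (1 - \<eta>) ^ t) \<and>
       (0 < \<zeta> \<longrightarrow> (\<exists>t. pc_halted P \<zeta> (pc_pos P \<zeta> \<eta> t))) \<and>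
       \<comment> \<open>global linear convergence to the ending point\<close>
       (\<exists>\<sigma>e \<mu>e. (\<sigma>e, \<mu>e) \<in> path_set P \<and>
          (\<forall>t. pc_halted P \<zeta> (pc_pos P \<zeta> \<eta> t) \<longrightarrow> path_point P (pc_pos P \<zeta> \<eta> t) = (\<sigma>e, \<mu>e)) \<and>
          (vsum \<mu>e = \<zeta> \<or>
           (\<exists>i\<in>{1..<seg_num P}. (\<sigma>e, \<mu>e) = path_point P (i, seg_gam P i) \<and>
              vsum (seg_mu P (i + 1)) \<le> \<zeta>)) \<and>
          (\<zeta> = 0 \<longrightarrow> (\<sigma>e, \<mu>e) = (\<sigma>star, 0)) \<and>
          (\<forall>tol T \<theta>in \<theta>. (\<forall>t. 0 < tol t \<and> tol t \<le> \<epsilon> * (1 - \<eta>) ^ t) \<and>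
             pc_run F k P \<zeta> \<eta> tol T \<theta>in \<theta> \<longrightarrow>
             (\<forall>t<T. dist (softmax (\<theta> t), pc_mu P \<zeta> \<eta> t) (\<sigma>e, \<mu>e) \<le> C * (1 - \<eta>) ^ t)))))"
proof -
  interpret path_data F \<sigma>init vinit P by unfold_locales (rule path)
  obtain M where M: "0 \<le> M" "compact N"
    "\<And>\<sigma> \<mu>. (\<sigma>, \<mu>) \<in> N \<Longrightarrow> \<sigma> \<in> std_simplex \<and> (\<forall>i. \<bar>\<mu> $ i\<bar> \<le> M * \<sigma> $ i)"
    using path_nbhd_region[OF F_C1 zeta(1), of d] unfolding N_def by blast
  have knz: "k + vsum \<mu> \<noteq> 0" if "(\<sigma>, \<mu>) \<in> N" for \<sigma> \<mu> using k(2) that by blast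
  interpret newton_region F k M d N
    by unfold_locales (use M F_C1 F_C2 N_regular knz d in blast)+
  obtain r0 C1 C2 L Kp where pos: "r0 > 0" "C1 > 0" "C2 > 0" "L > 0" "Kp > 0"
    and step: "\<forall>\<sigma> \<mu> \<theta>. good \<sigma> \<mu> \<and> norm (dev \<sigma> \<theta>) \<le> r0 \<longrightarrow>
     (softmax \<theta>, \<mu>) \<in> N \<and> invertible (newton_mat F k \<mu> (softmax \<theta>)) \<and>
     norm (dev \<sigma> (corrector F k \<mu> \<theta>)) \<le> norm (dev \<sigma> \<theta>) / 2 \<and>
     norm (Gt F (softmax (corrector F k \<mu> \<theta>)) \<mu>) \<le> C1 * (norm (Gt F (softmax \<theta>) \<mu>))\<^sup>2 \<and>
     norm (dev \<sigma> \<theta>) \<le> C2 * norm (Gt F (softmax \<theta>) \<mu>) \<and>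
     norm (Gt F (softmax \<theta>) \<mu>) \<le> L * norm (dev \<sigma> \<theta>) \<and>
     (\<forall>e\<ge>0. norm (dev \<sigma> (predictor F k e \<mu> \<theta>)) \<le> norm (dev \<sigma> \<theta>) + Kp * e)"
    using basin_step by (elim exE conjE)
  define Cv where "Cv = C2 * ((1 + norm (1 :: real^'n)) * (M * norm (1 :: real^'n)))"
  interpret path_tracking F k M d N r0 C1 C2 L Kp Cv \<sigma>init vinit P \<zeta>
  proof unfold_locales
    fix \<sigma> \<mu> \<theta> assume "good \<sigma> \<mu>" "norm (dev \<sigma> \<theta>) \<le> r0"
    with step show "(softmax \<theta>, \<mu>) \<in> N \<and> invertible (newton_mat F k \<mu> (softmax \<theta>)) \<and>
     norm (dev \<sigma> (corrector F k \<mu> \<theta>)) \<le> norm (dev \<sigma> \<theta>) / 2 \<and>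
     norm (Gt F (softmax (corrector F k \<mu> \<theta>)) \<mu>) \<le> C1 * (norm (Gt F (softmax \<theta>) \<mu>))\<^sup>2 \<and>
     norm (dev \<sigma> \<theta>) \<le> C2 * norm (Gt F (softmax \<theta>) \<mu>) \<and>
     norm (Gt F (softmax \<theta>) \<mu>) \<le> L * norm (dev \<sigma> \<theta>) \<and>
     (\<forall>e\<ge>0. norm (dev \<sigma> (predictor F k e \<mu> \<theta>)) \<le> norm (dev \<sigma> \<theta>) + Kp * e)" by simp
  qed (use pos Cv_def N_def zeta(1) in auto)
  \<comment> \<open>The radius is \<open>r0\<close> divided by the operator bound of
    \<open>pr\<close>, which passes from the plain norm of \<theta> - ln \<sigma> to the
    deviation.\<close>
  have region: "\<exists>r>0. \<forall>\<sigma>\<mu> \<mu> \<theta>. (\<sigma>\<mu>, \<mu>) \<in> path_set P \<and> \<zeta> < vsum \<mu> \<and> norm (\<theta> - hln \<sigma>\<mu>) \<le> r \<longrightarrow>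
       softmax \<theta> \<in> conv_region F k N \<mu>"
  proof (rule exI[of _ "r0 / (1 + norm (1 :: real^'n))"], intro conjI allI impI)
    have n: "0 < 1 + norm (1 :: real^'n)" by (simp add: add_pos_nonneg)
    then show "0 < r0 / (1 + norm (1 :: real^'n))" using pos by simp
    fix \<sigma>\<mu> \<mu> \<theta>
    assume a: "(\<sigma>\<mu>, \<mu>) \<in> path_set P \<and> \<zeta> < vsum \<mu> \<and> norm (\<theta> - hln \<sigma>\<mu>) \<le> r0 / (1 + norm (1 :: real^'n))"
    then obtain i g where o: "on_path i g" and e: "\<sigma>\<mu> = seg_curve P i g" "\<mu> = g *\<^sub>R seg_mu P i"
      by (auto simp: path_set_iff)
    have z: "\<zeta> < g * vsum (seg_mu P i)" using a by (simp add: e vsum_scaleR)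
    then have "g \<noteq> 0" using zeta(1) by auto
    then have "reach \<zeta> (i, g)" using o z on_path_nonneg[OF o] by (simp add: reach_def)
    then have g: "good \<sigma>\<mu> \<mu>" unfolding e by (rule good_reach)
    then have s: "\<sigma>\<mu> \<in> std_simplex" by (simp add: good_def pos_simplex)
    have "norm (dev \<sigma>\<mu> \<theta>) \<le> (1 + norm (1 :: real^'n)) * norm (\<theta> - hln \<sigma>\<mu>)"
      unfolding dev_def by (rule norm_pr_le[OF s])
    also have "\<dots> \<le> r0" using a n by (simp add: pos_le_divide_eq mult.commute)
    finally show "softmax \<theta> \<in> conv_region F k N \<mu>" by (rule basin_conv_region[OF g])
  qed
  have run: "\<exists>\<eta> \<epsilon> C M. 0 < \<eta> \<and> \<eta> < 1 \<and> 0 < \<epsilon> \<and> 0 < C \<and>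
       (\<forall>tol. (\<forall>t. 0 < tol t \<and> tol t \<le> \<epsilon>) \<longrightarrow>
          (\<exists>\<theta>in \<theta>. \<forall>T. pc_run F k P \<zeta> \<eta> tol T \<theta>in \<theta>) \<and>
          (\<forall>T \<theta>in \<theta>. pc_run F k P \<zeta> \<eta> tol T \<theta>in \<theta> \<longrightarrow>
             (\<forall>t\<le>T. softmax (\<theta>in t) \<in> conv_region F k N (pc_mu P \<zeta> \<eta> t) \<and>
                (\<exists>m\<le>M. norm (Gt F (softmax ((corrector F k (pc_mu P \<zeta> \<eta> t) ^^ m) (\<theta>in t)))
                                 (pc_mu P \<zeta> \<eta> t)) \<le> \<epsilon>)) \<and>
             (\<forall>t<T. invertible (newton_mat F k (pc_mu P \<zeta> \<eta> t) (softmax (\<theta> t))) \<and>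
                norm (softmax (\<theta> t) - fst (path_point P (pc_pos P \<zeta> \<eta> t))) \<le> C * tol t))) \<and>
       (\<forall>t. \<not> pc_halted P \<zeta> (pc_pos P \<zeta> \<eta> t) \<longrightarrow>
          vsum (pc_mu P \<zeta> \<eta> t) \<le> C * (1 - \<eta>) ^ t) \<and>
       (0 < \<zeta> \<longrightarrow> (\<exists>t. pc_halted P \<zeta> (pc_pos P \<zeta> \<eta> t))) \<and>
       (\<exists>\<sigma>e \<mu>e. (\<sigma>e, \<mu>e) \<in> path_set P \<and>
          (\<forall>t. pc_halted P \<zeta> (pc_pos P \<zeta> \<eta> t) \<longrightarrow> path_point P (pc_pos P \<zeta> \<eta> t) = (\<sigma>e, \<mu>e)) \<and>
          (vsum \<mu>e = \<zeta> \<or>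
           (\<exists>i\<in>{1..<seg_num P}. (\<sigma>e, \<mu>e) = path_point P (i, seg_gam P i) \<and>
              vsum (seg_mu P (i + 1)) \<le> \<zeta>)) \<and>
          (\<zeta> = 0 \<longrightarrow> (\<sigma>e, \<mu>e) = (\<sigma>star, 0)) \<and>
          (\<forall>tol T \<theta>in \<theta>. (\<forall>t. 0 < tol t \<and> tol t \<le> \<epsilon> * (1 - \<eta>) ^ t) \<and>
             pc_run F k P \<zeta> \<eta> tol T \<theta>in \<theta> \<longrightarrow>
             (\<forall>t<T. dist (softmax (\<theta> t), pc_mu P \<zeta> \<eta> t) (\<sigma>e, \<mu>e) \<le> C * (1 - \<eta>) ^ t)))"
    if start: "\<zeta> < vsum (seg_mu P 1)"
  proof -
    obtain \<eta> \<epsilon> where he: "0 < \<eta>" "\<eta> \<le> 1 / 2" "0 < \<epsilon>" "C2 * \<epsilon> \<le> 1 / 2" "Cv * (2 * \<eta>) < r0"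
      "(1 + norm (1 :: real^'n)) * (C2 * \<epsilon> + Kp * \<eta> + Cv * (2 * \<eta>)) \<le> r0"
      using step_size_exists by blast
    interpret path_run F k M d N r0 C1 C2 L Kp Cv \<sigma>init vinit P \<zeta> \<eta> \<epsilon>
      by unfold_locales (rule start he)+
    obtain A where A: "A > 0" "\<And>t. \<not> pc_halted P \<zeta> (ps t) \<Longrightarrow> vsum (pm t) \<le> A * (1 - \<eta>) ^ t"
      using level_bound by blast
    have inv: "\<zeta> = 0 \<longrightarrow> invertible (J F k (seg_sig P (seg_num P)))" using zeta(2) end_pt by blast
    from endpoint_convergence[OF inv, folded end_pt]
    obtain \<sigma>e \<mu>e E where E: "0 < E" "(\<sigma>e, \<mu>e) \<in> path_set P"
      "\<forall>t. pc_halted P \<zeta> (ps t) \<longrightarrow> path_point P (ps t) = (\<sigma>e, \<mu>e)"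
      "vsum \<mu>e = \<zeta> \<or> (\<exists>i\<in>{1..<seg_num P}. (\<sigma>e, \<mu>e) = path_point P (i, seg_gam P i) \<and>
        vsum (seg_mu P (i + 1)) \<le> \<zeta>)"
      "\<zeta> = 0 \<longrightarrow> (\<sigma>e, \<mu>e) = (\<sigma>star, 0)"
      "\<forall>t. dist (path_point P (ps t)) (\<sigma>e, \<mu>e) \<le> E * (1 - \<eta>) ^ t"
      by (elim exE conjE) (rule that)
    \<comment> \<open>Halving from the radius \<open>r0\<close> brings the residual below \<epsilon>
      after \<open>m\<close> corrector steps, a number independent of \<open>t\<close> and of the
      run.\<close>
    obtain m where "(1 / 2) ^ m < \<epsilon> / (L * r0)"
      using real_arch_pow_inv[of "\<epsilon> / (L * r0)" "1/2"] he pos by auto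
    then have m: "L * r0 * (1 / 2) ^ m \<le> \<epsilon>" using pos by (simp add: pos_less_divide_eq mult.commute less_imp_le)
    \<comment> \<open>One constant for the distance to the path, for the level and for the distance
      to the end point. In the last case the tolerance \<open>\<epsilon> * (1 - \<eta>) ^ t\<close>
      makes the corrector error decay at the same geometric rate.\<close>
    define C where "C = 3 * C2 + A + (3 * C2 * \<epsilon> + E)"
    have C3: "0 \<le> 3 * C2 * \<epsilon> + E" using pos E(1) he(3) by simp
    have C: "0 < C" "3 * C2 \<le> C" "A \<le> C" "3 * C2 * \<epsilon> + E \<le> C"
      using pos A(1) C3 unfolding C_def by linarith+
    have q: "0 < (1 - \<eta>) ^ t" "(1 - \<eta>) ^ t \<le> 1" for t
      using he by (auto intro: power_le_one)
    have part2: "(\<exists>\<theta>in \<theta>. \<forall>T. pc_run F k P \<zeta> \<eta> tol T \<theta>in \<theta>) \<and>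
          (\<forall>T \<theta>in \<theta>. pc_run F k P \<zeta> \<eta> tol T \<theta>in \<theta> \<longrightarrow>
             (\<forall>t\<le>T. softmax (\<theta>in t) \<in> conv_region F k N (pm t) \<and>
                (\<exists>j\<le>m. norm (Gt F (softmax ((corrector F k (pm t) ^^ j) (\<theta>in t))) (pm t)) \<le> \<epsilon>)) \<and>
             (\<forall>t<T. invertible (newton_mat F k (pm t) (softmax (\<theta> t))) \<and>
                norm (softmax (\<theta> t) - fst (path_point P (ps t))) \<le> C * tol t))"
      if tol: "\<forall>t. 0 < tol t \<and> tol t \<le> \<epsilon>" for tol
    proof (intro conjI allI impI)
      show "\<exists>\<theta>in \<theta>. \<forall>T. pc_run F k P \<zeta> \<eta> tol T \<theta>in \<theta>" by (rule run_exists) (use tol in blast)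
    next
      fix T \<theta>in \<theta> t assume r: "pc_run F k P \<zeta> \<eta> tol T \<theta>in \<theta>" and t: "t \<le> T"
      have "tracks (\<theta>in t) (ps t) \<le> r0"
        by (rule run_tracks[OF pc_run_mono[OF r t]]) (use tol in blast)
      then have d: "norm (dev (fst (path_point P (ps t))) (\<theta>in t)) \<le> r0" by (simp add: tracks_eq)
      show "softmax (\<theta>in t) \<in> conv_region F k N (pm t)" by (rule basin_conv_region[OF good_ps d])
      show "\<exists>j\<le>m. norm (Gt F (softmax ((corrector F k (pm t) ^^ j) (\<theta>in t))) (pm t)) \<le> \<epsilon>"
        using order_trans[OF basin_Gt_iterate[OF good_ps d, of m] m] by blast
    next
      fix T \<theta>in \<theta> t assume r: "pc_run F k P \<zeta> \<eta> tol T \<theta>in \<theta>" and t: "t < T"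
      have tol': "tol s \<le> \<epsilon>" for s using tol by blast
      have "norm (dev (fst (path_point P (ps t))) (\<theta> t)) \<le> r0"
        using run_tracks_corrected(1)[OF r tol' t] by (simp add: tracks_eq)
      then show "invertible (newton_mat F k (pm t) (softmax (\<theta> t)))"
        using basin[OF good_ps] by blast
      have "3 * C2 * tol t \<le> C * tol t" using C(2) tol by (intro mult_right_mono) (auto simp: less_imp_le)
      with run_close[OF r tol' t]
      show "norm (softmax (\<theta> t) - fst (path_point P (ps t))) \<le> C * tol t" by linarith
    qed
    have part3: "vsum (pm t) \<le> C * (1 - \<eta>) ^ t" if "\<not> pc_halted P \<zeta> (ps t)" for t
      using A(2)[OF that] mult_right_mono[OF C(3) less_imp_le[OF q(1)]] by (rule order_trans)
    have part4: "dist (softmax (\<theta> t), pm t) (\<sigma>e, \<mu>e) \<le> C * (1 - \<eta>) ^ t"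
      if tol: "\<forall>t. 0 < tol t \<and> tol t \<le> \<epsilon> * (1 - \<eta>) ^ t" and r: "pc_run F k P \<zeta> \<eta> tol T \<theta>in \<theta>"
        and t: "t < T" for tol T \<theta>in \<theta> t
    proof -
      have tol': "tol s \<le> \<epsilon>" for s
        using order_trans[OF conjunct2[OF spec[OF tol, of s]], of \<epsilon>] mult_left_mono[OF q(2)[of s], of \<epsilon>] he(3)
        by simp
      have "dist (softmax (\<theta> t), pm t) (path_point P (ps t)) \<le> norm (softmax (\<theta> t) - fst (path_point P (ps t)))"
        using dist_Pair_le[of "softmax (\<theta> t)" "pm t" "fst (path_point P (ps t))" "snd (path_point P (ps t))"]
        by (simp add: dist_norm pc_mu_def)
      also have "\<dots> \<le> 3 * C2 * tol t" by (rule run_close[OF r tol' t])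
      also have "\<dots> \<le> 3 * C2 * (\<epsilon> * (1 - \<eta>) ^ t)"
        using tol pos by (intro mult_left_mono) auto
      finally have "dist (softmax (\<theta> t), pm t) (\<sigma>e, \<mu>e) \<le> 3 * C2 * (\<epsilon> * (1 - \<eta>) ^ t) + E * (1 - \<eta>) ^ t"
        using dist_triangle[of "(softmax (\<theta> t), pm t)" "(\<sigma>e, \<mu>e)" "path_point P (ps t)"] spec[OF E(6), of t] by linarith
      also have "\<dots> = (3 * C2 * \<epsilon> + E) * (1 - \<eta>) ^ t" by (simp add: algebra_simps)
      also have "\<dots> \<le> C * (1 - \<eta>) ^ t" by (rule mult_right_mono[OF C(4) less_imp_le[OF q(1)]])
      finally show ?thesis .
    qed
    show ?thesis
    proof (rule exI[of _ \<eta>], rule exI[of _ \<epsilon>], rule exI[of _ C], rule exI[of _ m], intro conjI)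
      show "0 < \<eta>" "\<eta> < 1" "0 < \<epsilon>" "0 < C" using he C(1) by auto
    next
      show "\<exists>\<sigma>e \<mu>e. (\<sigma>e, \<mu>e) \<in> path_set P \<and>
          (\<forall>t. pc_halted P \<zeta> (ps t) \<longrightarrow> path_point P (ps t) = (\<sigma>e, \<mu>e)) \<and>
          (vsum \<mu>e = \<zeta> \<or>
           (\<exists>i\<in>{1..<seg_num P}. (\<sigma>e, \<mu>e) = path_point P (i, seg_gam P i) \<and>
              vsum (seg_mu P (i + 1)) \<le> \<zeta>)) \<and>
          (\<zeta> = 0 \<longrightarrow> (\<sigma>e, \<mu>e) = (\<sigma>star, 0)) \<and>
          (\<forall>tol T \<theta>in \<theta>. (\<forall>t. 0 < tol t \<and> tol t \<le> \<epsilon> * (1 - \<eta>) ^ t) \<and>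
             pc_run F k P \<zeta> \<eta> tol T \<theta>in \<theta> \<longrightarrow>
             (\<forall>t<T. dist (softmax (\<theta> t), pm t) (\<sigma>e, \<mu>e) \<le> C * (1 - \<eta>) ^ t))"
      proof (rule exI[of _ \<sigma>e], rule exI[of _ \<mu>e], intro conjI)
        show "\<forall>tol T \<theta>in \<theta>. (\<forall>t. 0 < tol t \<and> tol t \<le> \<epsilon> * (1 - \<eta>) ^ t) \<and>
             pc_run F k P \<zeta> \<eta> tol T \<theta>in \<theta> \<longrightarrow>
             (\<forall>t<T. dist (softmax (\<theta> t), pm t) (\<sigma>e, \<mu>e) \<le> C * (1 - \<eta>) ^ t)"
          by (intro allI impI, elim conjE, rule part4)
      qed (rule E(2-5))+
    qed (use part2 part3 halts in blast)+
  qed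
  show ?thesis
    by (intro conjI impI corrector_quadratic region run)
qed

end
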